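(* Let $L$, $\Theta$, $T$, $\mathcal F_r^L$, $\Pi_r^T$, $\mu_{r,y}$, $\Lambda_r$, $\mathscr D_T$, $\mathscr Z_r$, $y(r,z)$, $K^T_{r,h}$ and $\mathcal K^T_{r,h}$ be as defined in the context. Then for every $r\ge 0$, $L_r$ is a sufficient statistic for $\Theta$ (based on $\mathcal F_r^L$), and for every Borel set $A\subseteq S$, $\mathsf P(\Theta\in A\mid\mathcal F_r^L)=\mu_{r,L_r}(A)$ a.s.; consequently $\Pi_r^T=\Lambda_r(L_r)$ almost surely. Fix $0\le t<s$ and $h>0$, and let $J\subseteq\bigcap_{r\in[t,s]}\mathscr Z_r$ be a nonempty open interval. Suppose that, for every compact interval $J_0\subset J$, the set $\{(r,y(r,z)):r\in[t,s],\ z\in J_0\}$ has compact closure contained in $\mathscr D_T$. Then: (i) For every $z\in J$, $K_{t,h}^T(z,\cdot)\geq_{\mathrm{cx}}K_{s,h}^T(z,\cdot)$. Equivalently, $\mathcal K_{t,h}^Tf(z)\ge\mathcal K_{s,h}^Tf(z)$ for every convex function $f$ for which both sides are finite. (ii) For each $r\in[t,s]$ and every finite convex function $f:\mathbb R\to\mathbb R$ satisfying $\mathcal K_{r,h}^T|f|(z)<\infty$ for $z\in J$, the map $z\mapsto\mathcal K_{r,h}^Tf(z)$ is convex on $J$.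
   Context: Exponential family. Let $\nu$ be a $\sigma$-finite measure on $\mathbb R$, $N:=\{u\in\mathbb R:\int_{\mathbb R} e^{ux}\nu(dx)<\infty\}$, with interior $N^\circ$, $B(u):=\log\int_{\mathbb R} e^{ux}\nu(dx)$, and for $u\in N$ let $P_u(dx):=e^{ux-B(u)}\nu(dx)$, a probability measure; $B''>0$ on $N^\circ$. Suppose that $P_{u_0}$ is nondegenerate and infinitely divisible for some $u_0\in N^\circ$. Lévy family. Let $L=(L_r)_{r\ge0}$ be a Lévy process under $\mathsf P_{u_0}$ with $L_1\sim P_{u_0}$, and let $(\mathcal F_r^L)_{r\ge0}$ be its raw natural filtration. For $u\in N^\circ$ the Esscher law $\mathsf P_u$ is defined by $$\frac{d\mathsf P_u}{d\mathsf P_{u_0}}\Big|_{\mathcal F_r^L}=\exp\{(u-u_0)L_r-r(B(u)-B(u_0))\},\qquad r\ge0.$$ The parameter $\Theta$ has prior distribution $\mu$, a probability measure with support $S=\operatorname{supp}\mu\subseteq N^\circ$, and conditionally on $\Theta=u$ the process $L$ has law $\mathsf P_u$; $\mathsf P$ and $\mathsf E$ denote the resulting joint probability and expectation. Let $T:S\to\mathbb R$ be non-decreasing, $\mu$-integrable and not $\mu$-a.s. constant, and $\Pi_r^T:=\mathsf E[T(\Theta)\mid\mathcal F_r^L]$. Posterior family. For real $r\ge0$ let $\mathcal Y_r:=\{y\in\mathbb R:\int_S(1+|T(u)|)e^{uy-rB(u)}\mu(du)<\infty\}$ and, for $y\in\mathcal Y_r$, $$\mu_{r,y}(du):=\frac{e^{uy-rB(u)}\mu(du)}{\int_S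 e^{u'y-rB(u')}\mu(du')},\qquad \Lambda_r(y):=\int_S T(u)\,\mu_{r,y}(du);$$ $\Lambda_r$ is strictly increasing on the interval $\mathcal Y_r$. Define $$\mathscr D_T:=\operatorname{int}_{[0,\infty)\times\mathbb R}\Big\{(r,y):\int_S(1+|T(u)|)(1+u^2+|B(u)|)e^{uy-rB(u)}\mu(du)<\infty\Big\},$$ the interior being taken relative to $[0,\infty)\times\mathbb R$; $\mathscr Y_r:=\{y:(r,y)\in\mathscr D_T\}\subseteq\mathcal Y_r$ and $\mathscr Z_r:=\Lambda_r(\mathscr Y_r)$. For $z\in\mathscr Z_r$ let $y(r,z)\in\mathscr Y_r$ be the unique solution of $\Lambda_r(y(r,z))=z$, and $\mu_{r,z}:=\mu_{r,y(r,z)}$. Transition kernel and operator. For $h>0$ let $Q_u^h$ be the law of $L_h$ under $\mathsf P_u$, $$\ell_h(u,x):=\frac{dQ_u^h}{dQ_{u_0}^h}(x)=\exp\{(u-u_0)x-h(B(u)-B(u_0))\},\qquad \overline Q_{r,z}^h(dx):=\int_S Q_u^h(dx)\,\mu_{r,z}(du),\quad z\in\mathscr Z_r.$$ For $\overline Q_{r,z}^h$-almost every $x$ put $$M_{r,z}^{(h)}(x):=\frac{\int_S T(u)\ell_h(u,x)\mu_{r,z}(du)}{\int_S\ell_h(u,x)\mu_{r,z}(du)},$$ and $M_{r,z}^{(h)}(x):=z$ on the exceptional null set where this ratio is not well defined (denominator not in $(0,\infty)$ or $\int_S|T(u)|\ell_h(u,x)\mu_{r,z}(du)=\infty$). For Borel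 $A\subseteq\mathbb R$ and $z\in\mathscr Z_r$, $$K_{r,h}^T(z,A):=\int_{\mathbb R}\mathbf 1_A\big(M_{r,z}^{(h)}(x)\big)\,\overline Q_{r,z}^h(dx),\qquad \mathcal K_{r,h}^Tf(z):=\int_{\mathbb R}f(w)\,K_{r,h}^T(z,dw).$$ Convex order. For probability measures $\alpha,\beta$ on $\mathbb R$ with finite and equal means, $\beta\geq_{\mathrm{cx}}\alpha$ means $\int f\,d\beta\ge\int f\,d\alpha$ for every convex $f:\mathbb R\to\mathbb R$ for which both integrals exist; equivalently $\int(x-a)^+\alpha(dx)\le\int(x-a)^+\beta(dx)$ for every $a\in\mathbb R$. *)

theory Defs
  imports "HOL-Probability.Probability"
begin

section \<open>Exponential families\<close>

definition exp_domain :: "real measure \<Rightarrow> real set" where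
  "exp_domain \<nu> = {u. (\<integral>\<^sup>+x. ennreal (exp (u * x)) \<partial>\<nu>) < \<infinity>}"

definition log_partition :: "real measure \<Rightarrow> real \<Rightarrow> real" where
  "log_partition \<nu> u = ln (LINT x|\<nu>. exp (u * x))"

definition exp_family :: "real measure \<Rightarrow> real \<Rightarrow> real measure" where
  "exp_family \<nu> u = density \<nu> (\<lambda>x. ennreal (exp (u * x - log_partition \<nu> u)))"

definition nondegenerate :: "real measure \<Rightarrow> bool" where
  "nondegenerate P \<longleftrightarrow> \<not> (\<exists>c. AE x in P. x = c)"

definition infinitely_divisible :: "real measure \<Rightarrow> bool" where
  "infinitely_divisible P \<longleftrightarrow> prob_space P \<and> sets P = sets borel \<and>
     (\<forall>n>0. \<exists>Q. prob_space Q \<and> sets Q = sets borel \<and>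
        P = (convolution Q ^^ n) (return borel 0))"

definition measure_support :: "'a::topological_space measure \<Rightarrow> 'a set" where
  "measure_support \<mu> = {x. \<forall>U. open U \<and> x \<in> U \<longrightarrow> emeasure \<mu> U > 0}"

section \<open>Levy processes, Esscher laws and the Bayesian model\<close>

definition cadlag :: "(real \<Rightarrow> real) \<Rightarrow> bool" where
  "cadlag f \<longleftrightarrow> (\<forall>r\<ge>0. (f \<longlongrightarrow> f r) (at_right r)) \<and> (\<forall>r>0. \<exists>l. (f \<longlongrightarrow> l) (at_left r))"

text \<open>Processes are indexed by all reals, but only indices \<open>r \<ge> 0\<close> are ever used. Stochastic
  continuity is not listed separately in the following definition, because it follows from
  right-continuity and stationarity.\<close>

definition levy_process :: "'a measure \<Rightarrow> (real \<Rightarrow> 'a \<Rightarrow> real) \<Rightarrow> bool" where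
  "levy_process M X \<longleftrightarrow>
     prob_space M \<and>
     (\<forall>r\<ge>0. X r \<in> borel_measurable M) \<and>
     (AE \<omega> in M. X 0 \<omega> = 0) \<and>
     (\<forall>(n::nat) (t::nat \<Rightarrow> real). 0 \<le> t 0 \<and> (\<forall>i<n. t i \<le> t (Suc i)) \<longrightarrow>
        prob_space.indep_vars M (\<lambda>_. borel) (\<lambda>i \<omega>. X (t (Suc i)) \<omega> - X (t i) \<omega>) {..<n}) \<and>
     (\<forall>r\<ge>0. \<forall>h\<ge>0. distr M borel (\<lambda>\<omega>. X (r + h) \<omega> - X r \<omega>) = distr M borel (X h)) \<and>
     (AE \<omega> in M. cadlag (\<lambda>r. X r \<omega>))"

text \<open>The \<open>\<sigma>\<close>-algebra on \<open>\<Omega>\<close> generated by \<open>X r\<close> for \<open>r \<in> I\<close>; the raw natural filtration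
  consists of the \<open>\<sigma>\<close>-algebras for \<open>I = {0..r}\<close>.\<close>

definition generated_algebra :: "'a set \<Rightarrow> (real \<Rightarrow> 'a \<Rightarrow> real) \<Rightarrow> real set \<Rightarrow> 'a measure" where
  "generated_algebra \<Omega> X I = sigma \<Omega> {X r -` A \<inter> \<Omega> | r A. r \<in> I \<and> A \<in> sets borel}"

abbreviation natural_filtration :: "'a set \<Rightarrow> (real \<Rightarrow> 'a \<Rightarrow> real) \<Rightarrow> real \<Rightarrow> 'a measure" where
  "natural_filtration \<Omega> X r \<equiv> generated_algebra \<Omega> X {0..r}"

definition esscher_density ::
    "real measure \<Rightarrow> real \<Rightarrow> real \<Rightarrow> real \<Rightarrow> real \<Rightarrow> real" where
  "esscher_density \<nu> u0 h u x = exp ((u - u0) * x - h * (log_partition \<nu> u - log_partition \<nu> u0))"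

definition esscher_law ::
    "real measure \<Rightarrow> real \<Rightarrow> 'a measure \<Rightarrow> (real \<Rightarrow> 'a \<Rightarrow> real) \<Rightarrow> real \<Rightarrow> 'a measure \<Rightarrow> bool" where
  "esscher_law \<nu> u0 P0 L u P \<longleftrightarrow>
     prob_space P \<and> subalgebra P (generated_algebra (space P0) L {0..}) \<and>
     (\<forall>r\<ge>0. restr_to_subalg P (natural_filtration (space P0) L r) =
        density (restr_to_subalg P0 (natural_filtration (space P0) L r))
          (\<lambda>\<omega>. ennreal (esscher_density \<nu> u0 r u (L r \<omega>))))"

text \<open>Under \<open>M\<close>, the parameter \<open>\<Theta>\<close> has law \<open>\<mu>\<close> and, conditionally on \<open>\<Theta> = u\<close>, the process \<open>L\<close>
  has law \<open>P u\<close>. Here \<open>P u\<close> is only meaningful for \<open>u\<close> in the support of \<open>\<mu>\<close>.\<close>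

definition bayes_model ::
    "real measure \<Rightarrow> (real \<Rightarrow> 'a measure) \<Rightarrow> (real \<Rightarrow> 'a \<Rightarrow> real) \<Rightarrow> ('a \<Rightarrow> real) \<Rightarrow> 'a measure \<Rightarrow> bool"
  where
  "bayes_model \<mu> P L \<Theta> M \<longleftrightarrow>
     prob_space M \<and> (\<forall>r\<ge>0. L r \<in> borel_measurable M) \<and>
     \<Theta> \<in> borel_measurable M \<and> distr M borel \<Theta> = \<mu> \<and>
     (\<forall>A\<in>sets borel. \<forall>C\<in>sets (generated_algebra (space M) L {0..}).
        emeasure M ((\<Theta> -` A \<inter> space M) \<inter> C) =
          (\<integral>\<^sup>+u\<in>A \<inter> measure_support \<mu>. emeasure (P u) C \<partial>\<mu>))"

text \<open>Sufficiency of \<open>X\<close>, based on the \<open>\<sigma>\<close>-algebra \<open>F\<close>, for the family \<open>(P u)\<close>, \<open>u \<in> I\<close>: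
  conditional probabilities of events of \<open>F\<close> given \<open>X\<close> have versions not depending on \<open>u\<close>.\<close>

definition sufficient_statistic ::
    "'a measure \<Rightarrow> ('i \<Rightarrow> 'a measure) \<Rightarrow> 'i set \<Rightarrow> ('a \<Rightarrow> real) \<Rightarrow> bool" where
  "sufficient_statistic F P I X \<longleftrightarrow> X \<in> borel_measurable F \<and>
     (\<forall>C\<in>sets F. \<exists>k\<in>borel_measurable (vimage_algebra (space F) X borel). \<forall>u\<in>I.
        AE \<omega> in P u. real_cond_exp (P u) (vimage_algebra (space F) X borel) (indicat_real C) \<omega> = k \<omega>)"

text \<open>Bayesian sufficiency: the posterior of \<open>\<Theta>\<close> given \<open>F\<close> is the posterior given \<open>X\<close>.\<close>

definition bayes_sufficient_statistic ::
    "'a measure \<Rightarrow> 'a measure \<Rightarrow> ('a \<Rightarrow> real) \<Rightarrow> ('a \<Rightarrow> real) \<Rightarrow> bool" where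
  "bayes_sufficient_statistic M F \<Theta> X \<longleftrightarrow> X \<in> borel_measurable F \<and>
     (\<forall>A\<in>sets borel. AE \<omega> in M.
        real_cond_exp M F (\<lambda>\<omega>. indicat_real A (\<Theta> \<omega>)) \<omega> =
        real_cond_exp M (vimage_algebra (space F) X borel) (\<lambda>\<omega>. indicat_real A (\<Theta> \<omega>)) \<omega>)"

section \<open>Posterior family\<close>

text \<open>The estimand \<open>T\<close> is a function on the support of \<open>\<mu>\<close> only; its values elsewhere are
  never used, and all integrals are restricted to the support.\<close>

definition posterior_weight :: "real measure \<Rightarrow> real \<Rightarrow> real \<Rightarrow> real \<Rightarrow> real" where
  "posterior_weight \<nu> r y u = exp (u * y - r * log_partition \<nu> u)"

definition posterior :: "real measure \<Rightarrow> real measure \<Rightarrow> real \<Rightarrow> real \<Rightarrow> real measure" where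
  "posterior \<nu> \<mu> r y = density \<mu> (\<lambda>u. ennreal (indicat_real (measure_support \<mu>) u *
     posterior_weight \<nu> r y u / (LINT u':measure_support \<mu>|\<mu>. posterior_weight \<nu> r y u')))"

definition posterior_mean ::
    "real measure \<Rightarrow> real measure \<Rightarrow> (real \<Rightarrow> real) \<Rightarrow> real \<Rightarrow> real \<Rightarrow> real" where
  "posterior_mean \<nu> \<mu> T r y = (LINT u:measure_support \<mu>|posterior \<nu> \<mu> r y. T u)"

definition regular_domain ::
    "real measure \<Rightarrow> real measure \<Rightarrow> (real \<Rightarrow> real) \<Rightarrow> (real \<times> real) set" where
  "regular_domain \<nu> \<mu> T = top_of_set ({0..} \<times> UNIV) interior_of
     {(r, y). 0 \<le> r \<and> (\<integral>\<^sup>+u\<in>measure_support \<mu>.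
        ennreal ((1 + \<bar>T u\<bar>) * (1 + u\<^sup>2 + \<bar>log_partition \<nu> u\<bar>) * posterior_weight \<nu> r y u) \<partial>\<mu>) < \<infinity>}"

definition regular_states ::
    "real measure \<Rightarrow> real measure \<Rightarrow> (real \<Rightarrow> real) \<Rightarrow> real \<Rightarrow> real set" where
  "regular_states \<nu> \<mu> T r = {y. (r, y) \<in> regular_domain \<nu> \<mu> T}"

definition regular_means ::
    "real measure \<Rightarrow> real measure \<Rightarrow> (real \<Rightarrow> real) \<Rightarrow> real \<Rightarrow> real set" where
  "regular_means \<nu> \<mu> T r = posterior_mean \<nu> \<mu> T r ` regular_states \<nu> \<mu> T r"

definition state_of_mean ::
    "real measure \<Rightarrow> real measure \<Rightarrow> (real \<Rightarrow> real) \<Rightarrow> real \<Rightarrow> real \<Rightarrow> real" where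
  "state_of_mean \<nu> \<mu> T r z =
     (THE y. y \<in> regular_states \<nu> \<mu> T r \<and> posterior_mean \<nu> \<mu> T r y = z)"

definition posterior_of_mean ::
    "real measure \<Rightarrow> real measure \<Rightarrow> (real \<Rightarrow> real) \<Rightarrow> real \<Rightarrow> real \<Rightarrow> real measure" where
  "posterior_of_mean \<nu> \<mu> T r z = posterior \<nu> \<mu> r (state_of_mean \<nu> \<mu> T r z)"

section \<open>Transition kernel and operator\<close>

definition predictive_law ::
    "(real \<Rightarrow> 'a measure) \<Rightarrow> (real \<Rightarrow> 'a \<Rightarrow> real) \<Rightarrow> real measure \<Rightarrow> real measure \<Rightarrow> (real \<Rightarrow> real) \<Rightarrow>
     real \<Rightarrow> real \<Rightarrow> real \<Rightarrow> real measure" where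
  "predictive_law P L \<nu> \<mu> T r h z =
     restrict_space (posterior_of_mean \<nu> \<mu> T r z) (measure_support \<mu>) \<bind>
       (\<lambda>u. distr (P u) borel (L h))"

definition updated_mean ::
    "real measure \<Rightarrow> real \<Rightarrow> real measure \<Rightarrow> (real \<Rightarrow> real) \<Rightarrow> real \<Rightarrow> real \<Rightarrow> real \<Rightarrow> real \<Rightarrow> real" where
  "updated_mean \<nu> u0 \<mu> T r h z x =
     (let S = measure_support \<mu>; \<pi> = posterior_of_mean \<nu> \<mu> T r z; l = (\<lambda>u. esscher_density \<nu> u0 h u x)
      in if 0 < (\<integral>\<^sup>+u\<in>S. ennreal (l u) \<partial>\<pi>) \<and> (\<integral>\<^sup>+u\<in>S. ennreal (l u) \<partial>\<pi>) < \<infinity> \<and>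
            (\<integral>\<^sup>+u\<in>S. ennreal (\<bar>T u\<bar> * l u) \<partial>\<pi>) < \<infinity>
         then (LINT u:S|\<pi>. T u * l u) / (LINT u:S|\<pi>. l u)
         else z)"

definition transition_kernel ::
    "(real \<Rightarrow> 'a measure) \<Rightarrow> (real \<Rightarrow> 'a \<Rightarrow> real) \<Rightarrow> real measure \<Rightarrow> real \<Rightarrow> real measure \<Rightarrow>
     (real \<Rightarrow> real) \<Rightarrow> real \<Rightarrow> real \<Rightarrow> real \<Rightarrow> real measure" where
  "transition_kernel P L \<nu> u0 \<mu> T r h z =
     distr (predictive_law P L \<nu> \<mu> T r h z) borel (updated_mean \<nu> u0 \<mu> T r h z)"

definition transition_operator ::
    "(real \<Rightarrow> 'a measure) \<Rightarrow> (real \<Rightarrow> 'a \<Rightarrow> real) \<Rightarrow> real measure \<Rightarrow> real \<Rightarrow> real measure \<Rightarrow>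
     (real \<Rightarrow> real) \<Rightarrow> real \<Rightarrow> real \<Rightarrow> (real \<Rightarrow> real) \<Rightarrow> real \<Rightarrow> real" where
  "transition_operator P L \<nu> u0 \<mu> T r h f z = (LINT w|transition_kernel P L \<nu> u0 \<mu> T r h z. f w)"

section \<open>Convex order\<close>

definition convex_order_le :: "real measure \<Rightarrow> real measure \<Rightarrow> bool" where
  "convex_order_le \<alpha> \<beta> \<longleftrightarrow>
     prob_space \<alpha> \<and> prob_space \<beta> \<and> sets \<alpha> = sets borel \<and> sets \<beta> = sets borel \<and>
     integrable \<alpha> (\<lambda>x. x) \<and> integrable \<beta> (\<lambda>x. x) \<and> (LINT x|\<alpha>. x) = (LINT x|\<beta>. x) \<and>
     (\<forall>f. convex_on UNIV f \<and> integrable \<alpha> f \<and> integrable \<beta> f \<longrightarrow>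
        (LINT x|\<alpha>. f x) \<le> (LINT x|\<beta>. f x))"

end

theory Submission
  imports Defs
begin

text \<open>
  On the \<open>\<sigma>\<close>-algebra of the path up to time \<open>r\<close>, the Esscher law with parameter \<open>u\<close> has a
  density that depends on the path through \<open>L r\<close> only. Sufficiency is the factorisation argument, and
  Bayes' formula for this likelihood gives the posterior of the parameter; the same formula
  serves for conditioning on the whole path and on \<open>L r\<close> alone (\<open>cond_exp_posterior_ratio\<close>).

  Both claims on the transition kernel are instances of one comparison, \<open>estimates_convex_le\<close>. Fix
  a prior \<open>\<pi>\<close>, one of the posteriors \<open>\<mu>\<^bsub>r,z\<^esub>\<close>. The kernel is the law of the estimate of \<open>T\<close>
  after one more observation \<open>x\<close>. Let \<open>\<pi>'\<close> be a mixture of other posteriors at times at most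
  \<open>r\<close> with the same mean of \<open>T\<close>. Its density \<open>v\<close> with respect to \<open>\<pi>\<close> is a nonnegative combination of
  functions \<open>u \<mapsto> exp (u * d + c * B u)\<close> with \<open>c \<ge> 0\<close>, and so it is convex, because \<open>B\<close> is.
  Comparing two times at the same state uses one posterior, and convexity in the state uses two posteriors at the same time.

  It remains to see that a convex \<open>v\<close> with \<open>E v = 1\<close> and \<open>E (T v) = E T\<close> makes stop-loss
  transforms larger (\<open>stop_loss_le_mixture\<close>). For a level \<open>a\<close> the stop-loss transform is
  \<open>E ((T - a) G)\<close>, where \<open>G u\<close> is the probability under \<open>u\<close> of the event that the estimate exceeds \<open>a\<close>;
  no other event gives a larger value, so keeping this event when \<open>\<pi>\<close> is replaced by \<open>\<pi>'\<close>
  gives a lower bound for the new transform. Hence it suffices that \<open>E (D v) \<ge> 0\<close> for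
  \<open>D = (T - a) (G - \<beta>) - \<alpha>\<close>, for any constants \<open>\<alpha>\<close> and \<open>\<beta>\<close> with \<open>E D = 0\<close>. Choose \<open>\<beta>\<close> such that
  also \<open>E (u D) = 0\<close>. The functions \<open>T\<close> and \<open>G\<close> are non-decreasing, so if \<open>\<alpha> \<ge> 0\<close> then \<open>D\<close> has at most
  the signs \<open>+, -, +\<close>, and a function with these signs that is orthogonal to affine
  functions is nonnegative on convex ones (\<open>convex_cut_criterion\<close>). Finally \<open>\<alpha>\<close> equals the stop-loss
  transform minus \<open>\<beta> (E T - a)\<close>. The transform is at least \<open>max 0 (E T - a)\<close>, so \<open>\<alpha> \<ge> 0\<close> follows from
  \<open>0 \<le> \<beta> \<le> 1\<close>. This last fact says that the stop-loss transform of the estimate increases with a tilt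
  of the prior, but no faster than the mean; it is proved with Chebyshev's
  association inequality (\<open>covariance_on_event_nonneg\<close>).

  Stop-loss inequalities extend to all convex functions because a convex function is a limit of
  affine functions plus nonnegative combinations of functions \<open>x \<mapsto> max 0 (x - a)\<close>
  (\<open>stop_loss_imp_convex_le\<close>).
\<close>

section \<open>Chebyshev's association inequality\<close>

text \<open>Integrating the product of increments over \<open>v\<close> as well gives twice a weighted covariance. Doing
  this one variable at a time needs no product measure.\<close>

lemma weighted_covariance_kernel:
  fixes f g p :: "real \<Rightarrow> real"
  assumes "integrable M p" "integrable M (\<lambda>u. p u * f u)" "integrable M (\<lambda>u. p u * g u)"
    and "integrable M (\<lambda>u. p u * (f u * g u))"
  shows "(LINT u|M. p u * ((f u - f v) * (g u - g v))) =
      (LINT u|M. p u * (f u * g u)) - f v * (LINT u|M. p u * g u)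
        - g v * (LINT u|M. p u * f u) + f v * g v * (LINT u|M. p u)"
    and "integrable M (\<lambda>u. p u * ((f u - f v) * (g u - g v)))"
proof -
  have eq: "(\<lambda>u. p u * ((f u - f v) * (g u - g v))) =
      (\<lambda>u. p u * (f u * g u) - f v * (p u * g u) - g v * (p u * f u) + f v * g v * p u)"
    by (auto simp: algebra_simps)
  show "(LINT u|M. p u * ((f u - f v) * (g u - g v))) =
      (LINT u|M. p u * (f u * g u)) - f v * (LINT u|M. p u * g u)
        - g v * (LINT u|M. p u * f u) + f v * g v * (LINT u|M. p u)"
    unfolding eq using assms by simp
  show "integrable M (\<lambda>u. p u * ((f u - f v) * (g u - g v)))"
    unfolding eq using assms by simp
qed

lemma comonotone_increments_nonneg:
  fixes f g :: "real \<Rightarrow> real"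
  assumes f: "mono_on S f" and g: "mono_on S g" and u: "u \<in> S" and v: "v \<in> S"
  shows "0 \<le> (f u - f v) * (g u - g v)"
  using mono_onD[OF f u v] mono_onD[OF f v u] mono_onD[OF g u v] mono_onD[OF g v u]
  by (cases "u \<le> v") (auto intro!: mult_nonneg_nonneg mult_nonpos_nonpos)

text \<open>Integrating \<open>p v * (LINT u|M. p u * ((f u - f v) * (g u - g v)))\<close>, which is nonnegative, over
  \<open>v\<close> gives twice the difference of the two sides. The weight is not normalised, because it will be a
  likelihood function.\<close>

lemma weighted_chebyshev:
  fixes f g p :: "real \<Rightarrow> real"
  assumes S: "AE u in M. u \<in> S" and p: "\<And>u. u \<in> S \<Longrightarrow> 0 \<le> p u"
    and f: "mono_on S f" and g: "mono_on S g"
    and int: "integrable M p" "integrable M (\<lambda>u. p u * f u)" "integrable M (\<lambda>u. p u * g u)"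
      "integrable M (\<lambda>u. p u * (f u * g u))"
  shows "(LINT u|M. p u * f u) * (LINT u|M. p u * g u)
      \<le> (LINT u|M. p u) * (LINT u|M. p u * (f u * g u))"
proof -
  let ?A = "LINT u|M. p u * (f u * g u)" and ?F = "LINT u|M. p u * f u"
    and ?G = "LINT u|M. p u * g u" and ?P = "LINT u|M. p u"
  have nn: "0 \<le> ?A - f v * ?G - g v * ?F + f v * g v * ?P" if v: "v \<in> S" for v
  proof -
    have "0 \<le> p u * ((f u - f v) * (g u - g v))" if u: "u \<in> S" for u
      using p[OF u] comonotone_increments_nonneg[OF f g u v] by simp
    then have "0 \<le> (LINT u|M. p u * ((f u - f v) * (g u - g v)))"
      using S by (intro integral_nonneg_AE) auto
    then show ?thesis
      using weighted_covariance_kernel(1)[OF int] by simp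
  qed
  have "0 \<le> (LINT v|M. p v * (?A - f v * ?G - g v * ?F + f v * g v * ?P))"
    using S nn p by (intro integral_nonneg_AE) (auto intro!: mult_nonneg_nonneg)
  also have "(\<lambda>v. p v * (?A - f v * ?G - g v * ?F + f v * g v * ?P)) =
      (\<lambda>v. ?A * p v - ?G * (p v * f v) - ?F * (p v * g v) + ?P * (p v * (f v * g v)))"
    by (auto simp: algebra_simps)
  also have "(LINT v|M. \<dots> v) = ?A * ?P - ?G * ?F - ?F * ?G + ?P * ?A"
    using int by simp
  finally show ?thesis by (simp add: mult.commute)
qed

text \<open>Equality forces \<open>LINT u|M. (f u - f v) * (g u - g v)\<close> to vanish for almost every \<open>v\<close>. One such
  \<open>v\<close> is enough: as \<open>g\<close> separates points, \<open>f u = f v\<close> for almost every \<open>u\<close>.\<close>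

lemma strict_chebyshev:
  fixes f g :: "real \<Rightarrow> real"
  assumes "prob_space M" and S: "AE u in M. u \<in> S"
    and f: "mono_on S f" and g: "strict_mono_on S g"
    and int: "integrable M f" "integrable M g" "integrable M (\<lambda>u. f u * g u)"
    and nc: "\<not> (\<exists>c. AE u in M. f u = c)"
  shows "(LINT u|M. f u) * (LINT u|M. g u) < (LINT u|M. f u * g u)"
proof (rule ccontr)
  interpret prob_space M by fact
  let ?A = "LINT u|M. f u * g u" and ?F = "LINT u|M. f u" and ?G = "LINT u|M. g u"
  let ?\<phi> = "\<lambda>v. ?A - f v * ?G - g v * ?F + f v * g v"
  have gm: "mono_on S g"
    using g by (rule strict_mono_on_imp_mono_on)
  have int': "integrable M (\<lambda>u. 1::real)" "integrable M (\<lambda>u. 1 * f u)" "integrable M (\<lambda>u. 1 * g u)"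
      "integrable M (\<lambda>u. 1 * (f u * g u))"
    using int by auto
  note ker = weighted_covariance_kernel[OF int', simplified]
  note pos = comonotone_increments_nonneg[OF f gm]
  have \<phi>: "?\<phi> v = (LINT u|M. (f u - f v) * (g u - g v))" for v
    using ker(1)[of v] by (simp add: prob_space)
  have nn: "0 \<le> ?\<phi> v" if v: "v \<in> S" for v
    unfolding \<phi> using S pos[OF _ v] by (intro integral_nonneg_AE) auto
  assume "\<not> ?F * ?G < ?A"
  moreover have "?F * ?G \<le> ?A"
    using weighted_chebyshev[OF S _ f gm int'] by (simp add: prob_space)
  ultimately have eq: "?A = ?F * ?G" by simp
  have int\<phi>: "integrable M ?\<phi>" using int by simp
  have "(LINT v|M. ?\<phi> v) = ?A - ?F * ?G - ?G * ?F + ?A"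
    using int by (simp add: prob_space)
  then have "(LINT v|M. ?\<phi> v) = 0" using eq by simp
  moreover have "AE v in M. 0 \<le> ?\<phi> v" using S nn by auto
  ultimately have "AE v in M. ?\<phi> v = 0"
    using integral_nonneg_eq_0_iff_AE[OF int\<phi>] by simp
  with S have "AE v in M. v \<in> S \<and> ?\<phi> v = 0" by auto
  then obtain v where v: "v \<in> S" "?\<phi> v = 0"
    using eventually_happens[of _ "ae_filter M"] ae_filter_bot by blast
  have "(LINT u|M. (f u - f v) * (g u - g v)) = 0"
    using v(2) \<phi> by simp
  moreover have "AE u in M. 0 \<le> (f u - f v) * (g u - g v)" using S pos[OF _ v(1)] by auto
  ultimately have "AE u in M. (f u - f v) * (g u - g v) = 0"
    using integral_nonneg_eq_0_iff_AE[OF ker(2)] by simp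
  with S have "AE u in M. f u = f v"
  proof eventually_elim
    case (elim u)
    then show ?case
      using strict_mono_onD[OF g, of u v] strict_mono_onD[OF g, of v u] v(1)
      by (cases u v rule: linorder_cases) auto
  qed
  then show False using nc by blast
qed

section \<open>A cut criterion for convex functions\<close>

text \<open>For \<open>a < b\<close> this is the chord; for \<open>a = b\<close> it is a supporting line, which exists because \<open>I\<close> is
  open.\<close>

lemma convex_secant_line:
  fixes v :: "real \<Rightarrow> real"
  assumes "open I" "convex I" and v: "convex_on I v" and "a \<in> I" "b \<in> I" "a \<le> b"
  obtains \<alpha> \<beta> where "v a = \<alpha> + \<beta> * a" "v b = \<alpha> + \<beta> * b"
    "\<And>u. u \<in> I \<Longrightarrow> a \<le> u \<Longrightarrow> u \<le> b \<Longrightarrow> v u \<le> \<alpha> + \<beta> * u"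
    "\<And>u. u \<in> I \<Longrightarrow> u \<le> a \<or> b \<le> u \<Longrightarrow> \<alpha> + \<beta> * u \<le> v u"
proof (cases "a = b")
  case True
  define A where "A = Inf ((\<lambda>t. (v a - v t) / (a - t)) ` ({a<..} \<inter> I))"
  have "v a + A * (u - a) \<le> v u" if "u \<in> I" for u
    unfolding A_def using that assms
    by (intro convex_le_Inf_differential) (auto simp: interior_open)
  then show thesis
    using True by (intro that[of "v a - A * a" A]) (auto simp: algebra_simps)
next
  case False
  then have ab: "a < b" using assms by simp
  define \<beta> where "\<beta> = (v b - v a) / (b - a)"
  have 1: "v b = v a + \<beta> * (b - a)" using ab by (simp add: \<beta>_def)
  show thesis
  proof (rule that[of "v a - \<beta> * a" \<beta>])
    fix u assume u: "u \<in> I" "a \<le> u" "u \<le> b"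
    define t where "t = (u - a) / (b - a)"
    have "t * (b - a) = u - a" using ab by (simp add: t_def)
    then have t: "0 \<le> t" "t \<le> 1" "u = (1 - t) *\<^sub>R a + t *\<^sub>R b"
      using u ab by (simp add: t_def, simp add: t_def, simp add: algebra_simps)
    have "v u \<le> (1 - t) * v a + t * v b"
      unfolding t(3) using convex_onD[OF v t(1,2)] assms by simp
    also have "\<dots> = v a + t * (\<beta> * (b - a))" unfolding 1 by (simp add: algebra_simps)
    also have "t * (\<beta> * (b - a)) = \<beta> * (u - a)" using ab by (simp add: t_def)
    finally show "v u \<le> v a - \<beta> * a + \<beta> * u" by (simp add: algebra_simps)
  next
    fix u assume u: "u \<in> I" "u \<le> a \<or> b \<le> u"
    consider "u < a" | "u = a \<or> u = b" | "b < u" using u by force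
    then show "v a - \<beta> * a + \<beta> * u \<le> v u"
    proof cases
      case 1
      define t where "t = (a - u) / (b - u)"
      have "t * (b - u) = a - u" using 1 ab by (simp add: t_def)
      then have t: "0 \<le> t" "t < 1" "a = (1 - t) *\<^sub>R u + t *\<^sub>R b"
        using 1 ab by (simp add: t_def, simp add: t_def, simp add: algebra_simps)
      have "v a \<le> (1 - t) * v u + t * v b"
        using convex_onD[OF v t(1) less_imp_le[OF t(2)] u(1) \<open>b \<in> I\<close>] t(3) by simp
      then have "v a \<le> (1 - t) * v u + t * v a + t * (\<beta> * (b - a))"
        using \<open>v b = v a + \<beta> * (b - a)\<close> by (simp add: algebra_simps)
      moreover from t(3) have "t * (b - a) = (1 - t) * (a - u)"
         by (simp add: algebra_simps)
      then have "t * (\<beta> * (b - a)) = (1 - t) * (\<beta> * (a - u))" by (metis mult.left_commute)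
      ultimately have "(1 - t) * v a \<le> (1 - t) * (v u + \<beta> * (a - u))"
        by (simp add: algebra_simps)
      then have "v a \<le> v u + \<beta> * (a - u)"
        using t(2) by (simp add: mult_le_cancel_left)
      then show ?thesis by (simp add: algebra_simps)
    next
      case 3
      define t where "t = (b - a) / (u - a)"
      have "t * (u - a) = b - a" using 3 ab by (simp add: t_def)
      then have t: "0 < t" "t \<le> 1" "b = (1 - t) *\<^sub>R a + t *\<^sub>R u"
        using 3 ab by (simp add: t_def, simp add: t_def, simp add: algebra_simps)
      have "v b \<le> (1 - t) * v a + t * v u"
        using convex_onD[OF v less_imp_le[OF t(1)] t(2) \<open>a \<in> I\<close> u(1)] t(3) by simp
      then have "v a + \<beta> * (b - a) \<le> (1 - t) * v a + t * v u"
        using \<open>v b = v a + \<beta> * (b - a)\<close> by simp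
      moreover have "b - a = t * (u - a)"
        using t(3) by (simp add: algebra_simps)
      ultimately have "t * (v a + \<beta> * (u - a)) \<le> t * v u"
        by (simp add: algebra_simps)
      then have "v a + \<beta> * (u - a) \<le> v u"
        using t(1) by (simp add: mult_le_cancel_left)
      then show ?thesis by (simp add: algebra_simps)
    qed (use 1 in \<open>auto simp: algebra_simps\<close>)
  qed (use 1 in \<open>auto simp: algebra_simps\<close>)
qed

text \<open>By \<open>cut\<close>, the signs of \<open>d\<close> are at most \<open>+, -, +\<close>. Subtract from \<open>v\<close> the affine function that
  agrees with it at the two sign changes: the difference has the sign of \<open>d\<close> everywhere, and the affine
  function integrates to zero against \<open>d\<close>. With fewer than two sign changes, orthogonality to affine
  functions makes \<open>d\<close> vanish almost everywhere, except possibly at the point of the change.\<close>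

lemma convex_cut_criterion:
  fixes d v :: "real \<Rightarrow> real" and M :: "real measure"
  assumes I: "open I" "convex I" "S \<subseteq> I" and v: "convex_on I v" and S: "AE u in M. u \<in> S"
    and cut: "\<And>p q r. \<lbrakk>p \<in> S; q \<in> S; r \<in> S; p < q; q < r; d p < 0; d r < 0\<rbrakk> \<Longrightarrow> d q \<le> 0"
    and int: "integrable M d" "integrable M (\<lambda>u. u * d u)" "integrable M (\<lambda>u. v u * d u)"
    and zero: "(LINT u|M. d u) = 0" "(LINT u|M. u * d u) = 0"
  shows "0 \<le> (LINT u|M. v u * d u)"
proof -
  have line: ?thesis if "AE u in M. 0 \<le> d u * (v u - (\<alpha> + \<beta> * u))" for \<alpha> \<beta>
  proof -
    have "0 \<le> (LINT u|M. d u * (v u - (\<alpha> + \<beta> * u)))"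
      using that by (rule integral_nonneg_AE)
    also have "(\<lambda>u. d u * (v u - (\<alpha> + \<beta> * u))) = (\<lambda>u. v u * d u - \<alpha> * d u - \<beta> * (u * d u))"
      by (auto simp: algebra_simps)
    finally show ?thesis using int zero by simp
  qed
  define Neg where "Neg = {u \<in> S. d u < 0}"
  define Pos where "Pos = {u \<in> S. 0 < d u}"
  have split: ?thesis if "AE u in M. 0 \<le> c * ((u - m) * d u)" "c \<noteq> 0" for c m
  proof -
    have eq: "(\<lambda>u. c * ((u - m) * d u)) = (\<lambda>u. c * (u * d u) - (c * m) * d u)"
      by (auto simp: algebra_simps)
    have "integrable M (\<lambda>u. c * ((u - m) * d u))" "(LINT u|M. c * ((u - m) * d u)) = 0"
      unfolding eq using int zero by simp_all
    then have "AE u in M. c * ((u - m) * d u) = 0"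
      using integral_nonneg_eq_0_iff_AE that(1) by blast
    then show ?thesis
      using that(2) by (intro line[of "v m" 0]) auto
  qed
  show ?thesis
  proof (cases "\<exists>p\<in>Pos. \<exists>n\<in>Neg. \<exists>r\<in>Pos. p < n \<and> n < r")
    case True
    then obtain p n r where pnr: "p \<in> Pos" "n \<in> Neg" "r \<in> Pos" "p < n" "n < r" by blast
    have bd: "p \<le> m \<and> m \<le> r" if "m \<in> Neg" for m
      using cut[of m p n] cut[of n r m] pnr that by (force simp: Neg_def Pos_def)
    then have bdd: "bdd_below Neg" "bdd_above Neg" by (auto intro!: bdd_belowI bdd_aboveI)
    define a b where "a = Inf Neg" and "b = Sup Neg"
    have ab: "a \<le> n" "n \<le> b"
      using bdd pnr(2) by (auto simp: a_def b_def intro: cInf_lower cSup_upper)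
    have "p \<le> a" "b \<le> r"
      using bd pnr(2) by (auto simp: a_def b_def intro!: cInf_greatest cSup_least)
    moreover have "p \<in> I" "r \<in> I" using pnr I by (auto simp: Pos_def)
    ultimately have abI: "a \<in> I" "b \<in> I"
      using I(2) ab unfolding is_interval_convex_1[symmetric] is_interval_1 by (meson order_trans)+
    obtain \<alpha> \<beta> where l: "v a = \<alpha> + \<beta> * a" "v b = \<alpha> + \<beta> * b"
      "\<And>u. u \<in> I \<Longrightarrow> a \<le> u \<Longrightarrow> u \<le> b \<Longrightarrow> v u \<le> \<alpha> + \<beta> * u"
      "\<And>u. u \<in> I \<Longrightarrow> u \<le> a \<or> b \<le> u \<Longrightarrow> \<alpha> + \<beta> * u \<le> v u"
      by (rule convex_secant_line[OF I(1,2) v abI order_trans[OF ab]]) blast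
    have "0 \<le> d u * (v u - (\<alpha> + \<beta> * u))" if u: "u \<in> S" for u
    proof -
      have uI: "u \<in> I" using u I by auto
      consider "u = a \<or> u = b" | "a < u" "u < b" | "u < a \<or> b < u" by force
      then show ?thesis
      proof cases
        case 2
        obtain m1 where m1: "m1 \<in> Neg" "m1 < u"
          using 2(1) pnr(2) bdd unfolding a_def by (metis cInf_lessD empty_iff)
        obtain m2 where m2: "m2 \<in> Neg" "u < m2"
          using 2(2) pnr(2) bdd unfolding b_def by (metis less_cSupD empty_iff)
        have "d u \<le> 0" using cut[of m1 u m2] m1 m2 u by (auto simp: Neg_def)
        moreover have "v u \<le> \<alpha> + \<beta> * u" using l(3) uI 2 by simp
        ultimately show ?thesis by (intro mult_nonpos_nonpos) auto
      next
        case 3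
        then have "u \<notin> Neg" using bdd by (auto simp: a_def b_def dest: cInf_lower cSup_upper)
        then have "0 \<le> d u" using u by (auto simp: Neg_def)
        moreover have "\<alpha> + \<beta> * u \<le> v u" using l(4) uI 3 by auto
        ultimately show ?thesis by auto
      qed (use l in auto)
    qed
    then show ?thesis using S by (intro line[of \<alpha> \<beta>]) auto
  next
    case False
    consider (N) "Neg = {}" | (P) "Pos = {}" | (NP) "Neg \<noteq> {}" "Pos \<noteq> {}" "\<forall>n\<in>Neg. \<forall>p\<in>Pos. n \<le> p"
      | (PN) "Neg \<noteq> {}" "Pos \<noteq> {}" "\<forall>n\<in>Neg. \<forall>p\<in>Pos. p \<le> n"
    proof (cases "Neg = {} \<or> Pos = {} \<or> (\<forall>n\<in>Neg. \<forall>p\<in>Pos. n \<le> p)")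
      case False
      then obtain n p where np: "n \<in> Neg" "p \<in> Pos" "p < n" "Neg \<noteq> {}" "Pos \<noteq> {}" by force
      have "p' \<le> n'" if "n' \<in> Neg" "p' \<in> Pos" for n' p'
      proof (rule ccontr)
        assume "\<not> p' \<le> n'"
        have 1: "\<not> n < p'"
          using \<open>\<not> (\<exists>p\<in>Pos. \<exists>n\<in>Neg. \<exists>r\<in>Pos. p < n \<and> n < r)\<close> np that by blast
        have "n \<noteq> p'" using np that by (auto simp: Neg_def Pos_def)
        then show False
          using 1 cut[of n' p' n] np that \<open>\<not> p' \<le> n'\<close> by (auto simp: Neg_def Pos_def)
      qed
      then show thesis using that np by blast
    qed (use that in blast)
    then show ?thesis
    proof cases
      case N
      then have nn: "AE u in M. 0 \<le> d u" using S by (auto simp: Neg_def not_less)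
      have "AE u in M. d u = 0"
        using integral_nonneg_eq_0_iff_AE[OF int(1) nn] zero by simp
      then show ?thesis by (intro line[of 0 0]) auto
    next
      case P
      then have nn: "AE u in M. 0 \<le> - d u" using S by (auto simp: Pos_def not_less)
      have "AE u in M. d u = 0"
        using integral_nonneg_eq_0_iff_AE[OF _ nn] int(1) zero by simp
      then show ?thesis by (intro line[of 0 0]) auto
    next
      case NP
      then obtain p where "\<forall>n\<in>Neg. n \<le> p" by blast
      then have bdd: "bdd_above Neg" by (auto simp: bdd_above_def)
      define m where "m = Sup Neg"
      have m: "\<forall>n\<in>Neg. n \<le> m" "\<forall>p\<in>Pos. m \<le> p"
        using NP bdd by (auto simp: m_def intro!: cSup_upper cSup_least)
      have "0 \<le> 1 * ((u - m) * d u)" if "u \<in> S" for u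
        using m that by (cases "d u" "0::real" rule: linorder_cases)
          (auto simp: Neg_def Pos_def intro!: mult_nonneg_nonneg mult_nonpos_nonpos)
      then show ?thesis using S by (intro split[of 1 m]) auto
    next
      case PN
      then obtain n where "\<forall>p\<in>Pos. p \<le> n" by blast
      then have bdd: "bdd_above Pos" by (auto simp: bdd_above_def)
      define m where "m = Sup Pos"
      have m: "\<forall>n\<in>Neg. m \<le> n" "\<forall>p\<in>Pos. p \<le> m"
        using PN bdd by (auto simp: m_def intro!: cSup_upper cSup_least)
      have "0 \<le> (-1) * ((u - m) * d u)" if "u \<in> S" for u
        using m that by (cases "d u" "0::real" rule: linorder_cases)
          (auto simp: Neg_def Pos_def mult_le_0_iff)
      then show ?thesis using S by (intro split[of "-1" m]) auto
    qed
  qed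
qed

section \<open>From stop-loss inequalities to all convex functions\<close>

definition tangent_line :: "(real \<Rightarrow> real) \<Rightarrow> (real \<Rightarrow> real) \<Rightarrow> real \<Rightarrow> real \<Rightarrow> real" where
  "tangent_line f \<sigma> p x = f p + \<sigma> p * (x - p)"

text \<open>The maximum of the tangents at \<open>p 0, \<dots>, p m\<close> for increasing \<open>p\<close>, written as a telescoping sum in
  which every term but the first is a nonnegative multiple of some \<open>max 0 (x - a)\<close>.\<close>

definition tangent_hull ::
    "(real \<Rightarrow> real) \<Rightarrow> (real \<Rightarrow> real) \<Rightarrow> (nat \<Rightarrow> real) \<Rightarrow> nat \<Rightarrow> real \<Rightarrow> real" where
  "tangent_hull f \<sigma> p m x = tangent_line f \<sigma> (p 0) x +
     (\<Sum>i<m. max 0 (tangent_line f \<sigma> (p (Suc i)) x - tangent_line f \<sigma> (p i) x))"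

lemma subgradient_exists:
  fixes f :: "real \<Rightarrow> real"
  assumes "convex_on UNIV f"
  obtains \<sigma> where "\<And>p x. tangent_line f \<sigma> p x \<le> f x"
proof
  fix p x
  show "tangent_line f (\<lambda>p. Inf ((\<lambda>t. (f p - f t) / (p - t)) ` ({p<..} \<inter> UNIV))) p x \<le> f x"
    unfolding tangent_line_def using convex_le_Inf_differential[OF assms] by simp
qed

lemma subgradient_mono:
  assumes sub: "\<And>p x. tangent_line f \<sigma> p x \<le> f x" and "p < q"
  shows "\<sigma> p \<le> \<sigma> q"
proof -
  have "0 \<le> (\<sigma> q - \<sigma> p) * (q - p)"
    using sub[of p q] sub[of q p] by (simp add: tangent_line_def algebra_simps)
  then show ?thesis using \<open>p < q\<close> by (simp add: zero_le_mult_iff)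
qed

text \<open>Tangents of equal slope coincide; otherwise they cross once.\<close>

lemma tangent_increment_is_hinge:
  assumes sub: "\<And>p x. tangent_line f \<sigma> p x \<le> f x" and "p < q"
  obtains c a where "0 \<le> c"
    "\<And>x. max 0 (tangent_line f \<sigma> q x - tangent_line f \<sigma> p x) = c * max 0 (x - a)"
proof (cases "\<sigma> p = \<sigma> q")
  case True
  have "tangent_line f \<sigma> q x = tangent_line f \<sigma> p x" for x
    using sub[of p q] sub[of q p] True by (simp add: tangent_line_def algebra_simps)
  then show thesis by (intro that[of 0 0]) auto
next
  case False
  then have pos: "0 < \<sigma> q - \<sigma> p" using subgradient_mono[OF assms] by simp
  define a where "a = (f p - \<sigma> p * p - f q + \<sigma> q * q) / (\<sigma> q - \<sigma> p)"
  have "(\<sigma> q - \<sigma> p) * a = f p - \<sigma> p * p - f q + \<sigma> q * q" using pos by (simp add: a_def)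
  then have "tangent_line f \<sigma> q x - tangent_line f \<sigma> p x = (\<sigma> q - \<sigma> p) * (x - a)" for x
    by (simp add: tangent_line_def algebra_simps)
  then show thesis
    using pos by (intro that[of "\<sigma> q - \<sigma> p" a]) (auto simp: max_def zero_le_mult_iff)
qed

lemma tangent_hull_ge:
  assumes "j \<le> m"
  shows "tangent_line f \<sigma> (p j) x \<le> tangent_hull f \<sigma> p m x"
proof -
  have "tangent_line f \<sigma> (p j) x = tangent_line f \<sigma> (p 0) x +
      (\<Sum>i<j. tangent_line f \<sigma> (p (Suc i)) x - tangent_line f \<sigma> (p i) x)"
    using sum_lessThan_telescope[of "\<lambda>i. tangent_line f \<sigma> (p i) x" j] by simp
  also have "\<dots> \<le> tangent_hull f \<sigma> p j x"
    unfolding tangent_hull_def by (intro add_left_mono sum_mono) auto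
  also have "\<dots> \<le> tangent_hull f \<sigma> p m x"
    unfolding tangent_hull_def using assms by (intro add_left_mono sum_mono2) auto
  finally show ?thesis .
qed

text \<open>To the left of \<open>p m\<close> the last increment is zero. To the right of it all earlier increments are
  positive parts of nonnegative numbers, so that the sum telescopes to the maximum of the last two
  tangents.\<close>

lemma tangent_hull_le:
  assumes sub: "\<And>p x. tangent_line f \<sigma> p x \<le> f x" and p: "\<And>i. p i < p (Suc i)"
  shows "tangent_hull f \<sigma> p m x \<le> f x"
proof (induction m)
  case 0
  then show ?case using sub by (simp add: tangent_hull_def)
next
  case (Suc m)
  have slope: "\<sigma> (p i) \<le> \<sigma> (p (Suc i))" for i using subgradient_mono[OF sub p] .
  show ?case
  proof (cases "x \<le> p m")
    case True
    have "tangent_line f \<sigma> (p (Suc m)) x - tangent_line f \<sigma> (p m) x =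
      tangent_line f \<sigma> (p (Suc m)) (p m) - tangent_line f \<sigma> (p m) (p m)
        + (\<sigma> (p (Suc m)) - \<sigma> (p m)) * (x - p m)"
      by (simp add: tangent_line_def algebra_simps)
    also have "\<dots> \<le> 0"
      using sub[of "p (Suc m)" "p m"] slope[of m] True
      by (intro add_nonpos_nonpos mult_nonneg_nonpos) (auto simp: tangent_line_def)
    finally have "tangent_hull f \<sigma> p (Suc m) x = tangent_hull f \<sigma> p m x"
      by (simp add: tangent_hull_def)
    then show ?thesis using Suc by simp
  next
    case False
    have mono: "strict_mono p" using p by (simp add: strict_mono_Suc_iff)
    have "max 0 (tangent_line f \<sigma> (p (Suc i)) x - tangent_line f \<sigma> (p i) x) =
        tangent_line f \<sigma> (p (Suc i)) x - tangent_line f \<sigma> (p i) x" if "i < m" for i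
    proof -
      have "p (Suc i) \<le> p m" using that mono by (simp add: strict_mono_less_eq)
      then have x: "p (Suc i) \<le> x" using False by simp
      have "0 \<le> f (p (Suc i)) - tangent_line f \<sigma> (p i) (p (Suc i))
          + (\<sigma> (p (Suc i)) - \<sigma> (p i)) * (x - p (Suc i))"
        using sub[of "p i" "p (Suc i)"] slope[of i] x by simp
      also have "\<dots> = tangent_line f \<sigma> (p (Suc i)) x - tangent_line f \<sigma> (p i) x"
        by (simp add: tangent_line_def algebra_simps)
      finally show ?thesis by simp
    qed
    then have "tangent_hull f \<sigma> p m x = tangent_line f \<sigma> (p m) x"
      unfolding tangent_hull_def
      using sum_lessThan_telescope[of "\<lambda>i. tangent_line f \<sigma> (p i) x" m] by simp
    then have "tangent_hull f \<sigma> p (Suc m) x =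
        max (tangent_line f \<sigma> (p m) x) (tangent_line f \<sigma> (p (Suc m)) x)"
      by (simp add: tangent_hull_def)
    then show ?thesis using sub by simp
  qed
qed

text \<open>For \<open>i \<le> 2 * (n + 1)\<^sup>2\<close> these points have mesh \<open>1 / (n + 1)\<close> and cover
  \<open>[- (n + 1), n + 1]\<close>.\<close>

definition grid_point :: "nat \<Rightarrow> nat \<Rightarrow> real" where
  "grid_point n i = real i / real (Suc n) - real (Suc n)"

text \<open>The hull is at least the tangent at the grid point \<open>q n\<close> just to the left of \<open>x\<close>. Slopes increase,
  so this tangent is bounded below at \<open>x\<close> with the fixed slope \<open>\<sigma> (x - 2)\<close>, and the bound tends to
  \<open>f x\<close>.\<close>

lemma tangent_hull_tendsto:
  assumes f: "convex_on UNIV f" and sub: "\<And>p x. tangent_line f \<sigma> p x \<le> f x"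
  shows "(\<lambda>n. tangent_hull f \<sigma> (grid_point n) (2 * (Suc n)\<^sup>2) x) \<longlonglongrightarrow> f x"
proof -
  have grid: "grid_point n i < grid_point n (Suc i)" for n i
    by (simp add: grid_point_def divide_strict_right_mono)
  define q where "q n = real_of_int \<lfloor>x * real (Suc n)\<rfloor> / real (Suc n)" for n
  have q: "q n \<le> x" "x - 1 / real (Suc n) \<le> q n" for n
  proof -
    have "real_of_int \<lfloor>x * real (Suc n)\<rfloor> \<le> x * real (Suc n)" by simp
    then show "q n \<le> x" by (simp add: q_def divide_le_eq mult.commute del: of_nat_Suc mult_Suc mult_Suc_right)
    have "x * real (Suc n) - 1 \<le> real_of_int \<lfloor>x * real (Suc n)\<rfloor>" by linarith
    then have "(x * real (Suc n) - 1) / real (Suc n) \<le> q n"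
      unfolding q_def by (intro divide_right_mono) auto
    then show "x - 1 / real (Suc n) \<le> q n" by (simp add: diff_divide_distrib del: of_nat_Suc mult_Suc mult_Suc_right)
  qed
  have qlim: "q \<longlonglongrightarrow> x"
  proof (rule tendsto_sandwich[of "\<lambda>n. x - 1 / real (Suc n)"])
    show "(\<lambda>n. x - 1 / real (Suc n)) \<longlonglongrightarrow> x"
      using tendsto_diff[OF tendsto_const LIMSEQ_Suc[OF lim_1_over_n]] by (simp del: of_nat_Suc mult_Suc mult_Suc_right)
  qed (use q in auto)
  have isCont: "isCont f x"
    using convex_on_continuous[of UNIV f] f by (simp add: continuous_on_eq_continuous_at)
  have "(\<lambda>n. f (q n) + \<sigma> (x - 2) * (x - q n)) \<longlonglongrightarrow> f x + \<sigma> (x - 2) * (x - x)"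
    by (intro tendsto_intros isCont_tendsto_compose[OF isCont] qlim)
  then have lower: "(\<lambda>n. f (q n) + \<sigma> (x - 2) * (x - q n)) \<longlonglongrightarrow> f x" by simp
  have ge: "f (q n) + \<sigma> (x - 2) * (x - q n) \<le> tangent_hull f \<sigma> (grid_point n) (2 * (Suc n)\<^sup>2) x"
    if n: "\<bar>x\<bar> \<le> real (Suc n)" for n
  proof -
    let ?k = "\<lfloor>x * real (Suc n)\<rfloor> + int ((Suc n)\<^sup>2)"
    have "- real (Suc n) * real (Suc n) \<le> x * real (Suc n)"
      using n by (intro mult_right_mono) auto
    then have "- int ((Suc n)\<^sup>2) \<le> \<lfloor>x * real (Suc n)\<rfloor>"
      by (simp add: le_floor_iff power2_eq_square del: of_nat_Suc mult_Suc mult_Suc_right)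
    then have k0: "0 \<le> ?k" by simp
    have "x * real (Suc n) \<le> real (Suc n) * real (Suc n)"
      using n by (intro mult_right_mono) auto
    then have "x * real (Suc n) < real (Suc n) * real (Suc n) + 1" by linarith
    then have "\<lfloor>x * real (Suc n)\<rfloor> \<le> int ((Suc n)\<^sup>2)"
      by (simp add: floor_le_iff power2_eq_square del: of_nat_Suc mult_Suc mult_Suc_right)
    then have k1: "nat ?k \<le> 2 * (Suc n)\<^sup>2" by (simp add: nat_le_iff)
    have "grid_point n (nat ?k) = q n"
      using k0 by (simp add: grid_point_def q_def add_divide_distrib power2_eq_square
          del: of_nat_Suc mult_Suc mult_Suc_right)
    then have "tangent_line f \<sigma> (q n) x \<le> tangent_hull f \<sigma> (grid_point n) (2 * (Suc n)\<^sup>2) x"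
      using tangent_hull_ge[OF k1, of f \<sigma> "grid_point n" x] by simp
    moreover have "x - 2 < q n"
    proof -
      have "1 / real (Suc n) \<le> 1" by simp
      then show ?thesis using q(2)[of n] by linarith
    qed
    then have "\<sigma> (x - 2) * (x - q n) \<le> \<sigma> (q n) * (x - q n)"
      using q(1)[of n] subgradient_mono[OF sub] by (intro mult_right_mono) auto
    ultimately show ?thesis by (simp add: tangent_line_def)
  qed
  have "eventually (\<lambda>n. \<bar>x\<bar> \<le> real (Suc n)) sequentially"
    using eventually_ge_at_top[of "nat \<lceil>\<bar>x\<bar>\<rceil>"] by eventually_elim linarith
  then have "eventually (\<lambda>n. f (q n) + \<sigma> (x - 2) * (x - q n)
      \<le> tangent_hull f \<sigma> (grid_point n) (2 * (Suc n)\<^sup>2) x) sequentially"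
    by (rule eventually_mono) (rule ge)
  then show ?thesis
    by (rule tendsto_sandwich[OF _ _ lower tendsto_const])
      (simp add: tangent_hull_le[of f \<sigma> "grid_point n" for n, OF sub grid])
qed

lemma convex_on_UNIV_borel_measurable:
  fixes f :: "real \<Rightarrow> real"
  assumes "convex_on UNIV f"
  shows "f \<in> borel_measurable borel"
  using convex_on_continuous[OF open_UNIV assms] by (rule borel_measurable_continuous_onI)

lemma integrable_hinge:
  fixes M :: "real measure"
  assumes "finite_measure M" "sets M = sets borel" "integrable M (\<lambda>x. x)"
  shows "integrable M (\<lambda>x. max 0 (x - a))"
proof -
  interpret finite_measure M by fact
  show ?thesis using assms(3) by auto
qed

text \<open>For tangent hulls the claim is linear in the hypotheses. All hulls lie between the tangent at
  \<open>0\<close>, a point of every grid, and \<open>f\<close>, so dominated convergence applies. Two measures on the right-hand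
  side cover a comparison of two laws as well as convexity along a segment.\<close>

lemma stop_loss_imp_convex_le:
  fixes \<alpha> \<beta> \<gamma> :: "real measure"
  assumes \<alpha>: "prob_space \<alpha>" "sets \<alpha> = sets borel" "integrable \<alpha> (\<lambda>x. x)"
    and \<beta>: "prob_space \<beta>" "sets \<beta> = sets borel" "integrable \<beta> (\<lambda>x. x)"
    and \<gamma>: "prob_space \<gamma>" "sets \<gamma> = sets borel" "integrable \<gamma> (\<lambda>x. x)"
    and s: "s + t = (1::real)"
    and mean: "(LINT x|\<alpha>. x) = s * (LINT x|\<beta>. x) + t * (LINT x|\<gamma>. x)"
    and stop_loss: "\<And>a. (LINT x|\<alpha>. max 0 (x - a)) \<le>
        s * (LINT x|\<beta>. max 0 (x - a)) + t * (LINT x|\<gamma>. max 0 (x - a))"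
    and f: "convex_on UNIV f" "integrable \<alpha> f" "integrable \<beta> f" "integrable \<gamma> f"
  shows "(LINT x|\<alpha>. f x) \<le> s * (LINT x|\<beta>. f x) + t * (LINT x|\<gamma>. f x)"
proof -
  obtain \<sigma> where sub: "\<And>p x. tangent_line f \<sigma> p x \<le> f x"
    using subgradient_exists[OF f(1)] by blast
  define g where "g n = tangent_hull f \<sigma> (grid_point n) (2 * (Suc n)\<^sup>2)" for n
  have grid: "grid_point n i < grid_point n (Suc i)" for n i
    by (simp add: grid_point_def divide_strict_right_mono)
  have hinge: "\<exists>c a. 0 \<le> c \<and> (\<forall>x. max 0 (tangent_line f \<sigma> (grid_point n (Suc i)) x
      - tangent_line f \<sigma> (grid_point n i) x) = c * max 0 (x - a))" for n i
    using tangent_increment_is_hinge[OF sub grid] by metis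
  then obtain c a where ca: "\<And>n i. 0 \<le> c n i"
    "\<And>n i x. max 0 (tangent_line f \<sigma> (grid_point n (Suc i)) x
      - tangent_line f \<sigma> (grid_point n i) x) = c n i * max 0 (x - a n i)"
    by metis
  have g: "g n x = f (grid_point n 0) - \<sigma> (grid_point n 0) * grid_point n 0
      + \<sigma> (grid_point n 0) * x + (\<Sum>i<2 * (Suc n)\<^sup>2. c n i * max 0 (x - a n i))" for n x
    unfolding g_def tangent_hull_def ca(2) by (simp add: tangent_line_def algebra_simps)
  have int_g: "(LINT x|M. g n x) = f (grid_point n 0) - \<sigma> (grid_point n 0) * grid_point n 0
      + \<sigma> (grid_point n 0) * (LINT x|M. x)
      + (\<Sum>i<2 * (Suc n)\<^sup>2. c n i * (LINT x|M. max 0 (x - a n i)))"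
    and gM: "integrable M (g n)"
    if M: "prob_space M" "sets M = sets borel" "integrable M (\<lambda>x. x)" for M n
  proof -
    interpret prob_space M by fact
    note h = integrable_hinge[OF finite_measure_axioms M(2,3)]
    show "integrable M (g n)" unfolding g[abs_def] using M(3) h by auto
    show "(LINT x|M. g n x) = f (grid_point n 0) - \<sigma> (grid_point n 0) * grid_point n 0
      + \<sigma> (grid_point n 0) * (LINT x|M. x)
      + (\<Sum>i<2 * (Suc n)\<^sup>2. c n i * (LINT x|M. max 0 (x - a n i)))"
      unfolding g using M(3) h by (simp add: prob_space)
  qed
  have le: "(LINT x|\<alpha>. g n x) \<le> s * (LINT x|\<beta>. g n x) + t * (LINT x|\<gamma>. g n x)" for n
  proof -
    let ?k = "f (grid_point n 0) - \<sigma> (grid_point n 0) * grid_point n 0"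
    let ?m = "\<sigma> (grid_point n 0)"
    have "(\<Sum>i<2 * (Suc n)\<^sup>2. c n i * (LINT x|\<alpha>. max 0 (x - a n i))) \<le>
        (\<Sum>i<2 * (Suc n)\<^sup>2. c n i * (s * (LINT x|\<beta>. max 0 (x - a n i))
          + t * (LINT x|\<gamma>. max 0 (x - a n i))))"
      using ca(1) stop_loss by (intro sum_mono mult_left_mono) auto
    also have "\<dots> = s * (\<Sum>i<2 * (Suc n)\<^sup>2. c n i * (LINT x|\<beta>. max 0 (x - a n i)))
        + t * (\<Sum>i<2 * (Suc n)\<^sup>2. c n i * (LINT x|\<gamma>. max 0 (x - a n i)))"
      by (simp add: sum_distrib_left sum.distrib[symmetric] algebra_simps)
    finally have "(LINT x|\<alpha>. g n x) \<le> ?k + ?m * (LINT x|\<alpha>. x) +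
        (s * (\<Sum>i<2 * (Suc n)\<^sup>2. c n i * (LINT x|\<beta>. max 0 (x - a n i)))
        + t * (\<Sum>i<2 * (Suc n)\<^sup>2. c n i * (LINT x|\<gamma>. max 0 (x - a n i))))"
      unfolding int_g[OF \<alpha>] by simp
    also have "\<dots> = (s + t) * ?k + ?m * (s * (LINT x|\<beta>. x) + t * (LINT x|\<gamma>. x)) +
        (s * (\<Sum>i<2 * (Suc n)\<^sup>2. c n i * (LINT x|\<beta>. max 0 (x - a n i)))
        + t * (\<Sum>i<2 * (Suc n)\<^sup>2. c n i * (LINT x|\<gamma>. max 0 (x - a n i))))"
      using s mean by simp
    also have "\<dots> = s * (LINT x|\<beta>. g n x) + t * (LINT x|\<gamma>. g n x)"
      unfolding int_g[OF \<beta>] int_g[OF \<gamma>] by (simp only: distrib_left distrib_right mult_ac add_ac)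
    finally show ?thesis .
  qed
  have lim: "(\<lambda>n. LINT x|M. g n x) \<longlonglongrightarrow> (LINT x|M. f x)"
    if M: "prob_space M" "sets M = sets borel" "integrable M (\<lambda>x. x)" "integrable M f" for M
  proof (rule integral_dominated_convergence)
    interpret prob_space M by fact
    show "integrable M (\<lambda>x. \<bar>f x\<bar> + \<bar>tangent_line f \<sigma> 0 x\<bar>)"
      unfolding tangent_line_def using M(3,4) by auto
    show "AE x in M. (\<lambda>n. g n x) \<longlonglongrightarrow> f x"
      unfolding g_def using tangent_hull_tendsto[OF f(1) sub] by simp
    have "norm (g n x) \<le> \<bar>f x\<bar> + \<bar>tangent_line f \<sigma> 0 x\<bar>" for n x
    proof -
      have "grid_point n ((Suc n)\<^sup>2) = 0" by (simp add: grid_point_def power2_eq_square del: of_nat_Suc mult_Suc mult_Suc_right)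
      then have "tangent_line f \<sigma> 0 x \<le> g n x"
        unfolding g_def using tangent_hull_ge[of "(Suc n)\<^sup>2" "2 * (Suc n)\<^sup>2" f \<sigma> "grid_point n" x] by simp
      moreover have "g n x \<le> f x" unfolding g_def using tangent_hull_le[of f \<sigma> "grid_point n", OF sub grid] .
      ultimately show ?thesis by (simp add: abs_le_iff) linarith
    qed
    then show "AE x in M. norm (g n x) \<le> \<bar>f x\<bar> + \<bar>tangent_line f \<sigma> 0 x\<bar>" for n by simp
    show "f \<in> borel_measurable M" using M(4) by simp
    show "g n \<in> borel_measurable M" for n using gM[OF M(1-3)] by simp
  qed
  show ?thesis
    using lim[OF \<alpha> f(2)] lim[OF \<beta> f(3)] lim[OF \<gamma> f(4)] le
    by (intro LIMSEQ_le[of "\<lambda>n. LINT x|\<alpha>. g n x" _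
          "\<lambda>n. s * (LINT x|\<beta>. g n x) + t * (LINT x|\<gamma>. g n x)"] tendsto_intros) auto
qed

section \<open>Mixtures of likelihoods\<close>

text \<open>The parameter has law \<open>\<pi>\<close> and, given the parameter \<open>u\<close>, the observation has density \<open>l u\<close> with
  respect to \<open>R\<close>. Below, \<open>mix f x\<close> is the unnormalised posterior integral of \<open>f\<close> given \<open>x\<close>, and
  \<open>power_of A u\<close>, the power function of the test with critical region \<open>A\<close>, is the probability of \<open>A\<close>
  under \<open>u\<close>.\<close>

locale likelihood_mixture = prior: prob_space \<pi> + obs: prob_space R
  for \<pi> :: "real measure" and R :: "'b measure" +
  fixes l :: "real \<Rightarrow> 'b \<Rightarrow> real"
  assumes sets_prior: "sets \<pi> = sets borel"
    and l_measurable: "(\<lambda>(u, x). l u x) \<in> borel_measurable (\<pi> \<Otimes>\<^sub>M R)"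
    and l_pos: "\<And>u x. 0 < l u x"
    and l_mass: "AE u in \<pi>. (\<integral>\<^sup>+x. ennreal (l u x) \<partial>R) = 1"
begin

definition mix :: "(real \<Rightarrow> real) \<Rightarrow> 'b \<Rightarrow> real" where
  "mix f x = (LINT u|\<pi>. f u * l u x)"

definition power_of :: "'b set \<Rightarrow> real \<Rightarrow> real" where
  "power_of A u = (LINT x|R. indicator A x * l u x)"

sublocale pair: pair_sigma_finite \<pi> R ..

lemma l_measurable_obs: "u \<in> space \<pi> \<Longrightarrow> l u \<in> borel_measurable R"
  using measurable_Pair2[OF l_measurable] by simp

lemma space_prior: "space \<pi> = UNIV"
  using sets_eq_imp_space_eq[OF sets_prior] by simp

lemma l_integrable:
  assumes "(\<integral>\<^sup>+x. ennreal (l u x) \<partial>R) = 1"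
  shows "integrable R (l u)" "(LINT x|R. l u x) = 1"
proof -
  have "l u \<in> borel_measurable R" using l_measurable_obs by (simp add: space_prior)
  then show "integrable R (l u)" "(LINT x|R. l u x) = 1"
    using assms l_pos by (auto intro!: integrableI_nonneg simp: integral_eq_nn_integral less_imp_le)
qed

lemma joint_integrable:
  assumes f: "integrable \<pi> f"
  shows "integrable (\<pi> \<Otimes>\<^sub>M R) (\<lambda>(u, x). f u * l u x)"
proof (rule pair.Fubini_integrable)
  note [measurable] = l_measurable borel_measurable_integrable[OF f]
  show m: "(\<lambda>(u, x). f u * l u x) \<in> borel_measurable (\<pi> \<Otimes>\<^sub>M R)"
    using l_measurable by (simp add: split_beta')
  have "AE u in \<pi>. (LINT x|R. norm (case (u, x) of (u, x) \<Rightarrow> f u * l u x)) = \<bar>f u\<bar>"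
    using l_mass
  proof eventually_elim
    case (elim u)
    have "(LINT x|R. norm (case (u, x) of (u, x) \<Rightarrow> f u * l u x)) = (LINT x|R. \<bar>f u\<bar> * l u x)"
      using l_pos by (intro Bochner_Integration.integral_cong) (auto simp: abs_mult less_imp_le)
    then show ?case using l_integrable[OF elim] by simp
  qed
  moreover have "(\<lambda>u. LINT x|R. norm (case (u, x) of (u, x) \<Rightarrow> f u * l u x)) \<in> borel_measurable \<pi>"
    using m by measurable
  ultimately show "integrable \<pi> (\<lambda>u. LINT x|R. norm (case (u, x) of (u, x) \<Rightarrow> f u * l u x))"
    using f by (subst integrable_cong_AE[where g = "\<lambda>u. \<bar>f u\<bar>"]) auto
  show "AE u in \<pi>. integrable R (\<lambda>x. case (u, x) of (u, x) \<Rightarrow> f u * l u x)"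
    using l_mass by eventually_elim (simp add: l_integrable)
qed

lemma joint_integrable_set:
  assumes f: "integrable \<pi> f" and A: "A \<in> sets R"
  shows "integrable (\<pi> \<Otimes>\<^sub>M R) (\<lambda>(u, x). f u * (indicator A x * l u x))"
proof -
  note [measurable] = l_measurable borel_measurable_integrable[OF f] A
  have "(\<lambda>(u, x). f u * (indicator A x * l u x)) \<in> borel_measurable (\<pi> \<Otimes>\<^sub>M R)"
    using l_measurable by (simp add: split_beta')
  then show ?thesis
    by (rule Bochner_Integration.integrable_bound[OF joint_integrable[OF f]])
      (auto simp: indicator_def)
qed

lemma mix_AE_integrable:
  assumes "integrable \<pi> f"
  shows "AE x in R. integrable \<pi> (\<lambda>u. f u * l u x)"
  using pair.AE_integrable_snd[OF joint_integrable[OF assms]] .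

lemma mix_integrable:
  assumes "integrable \<pi> f"
  shows "integrable R (mix f)"
  using pair.integrable_snd[OF joint_integrable[OF assms]] by (simp add: mix_def[abs_def])

lemma integrable_power_of:
  assumes "integrable \<pi> f" "A \<in> sets R"
  shows "integrable \<pi> (\<lambda>u. f u * power_of A u)"
  using pair.integrable_fst[OF joint_integrable_set[OF assms]] by (simp add: power_of_def)

lemma integral_mix_set:
  assumes "integrable \<pi> f" "A \<in> sets R"
  shows "(LINT x|R. indicator A x * mix f x) = (LINT u|\<pi>. f u * power_of A u)"
proof -
  have "(LINT x|R. indicator A x * mix f x) =
      (LINT x|R. LINT u|\<pi>. f u * (indicator A x * l u x))"
    by (simp add: mix_def mult.left_commute[of _ "indicator _ _"])
  also have "\<dots> = (LINT u|\<pi>. LINT x|R. f u * (indicator A x * l u x))"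
    using pair.Fubini_integral[OF joint_integrable_set[OF assms]] by simp
  finally show ?thesis by (simp add: power_of_def)
qed

lemma centred_likelihood_integrable:
  assumes "integrable \<pi> (\<lambda>u. l u x)" "integrable \<pi> (\<lambda>u. f u * l u x)"
    "integrable \<pi> (\<lambda>u. u * l u x)" "integrable \<pi> (\<lambda>u. f u * u * l u x)"
  shows "integrable \<pi> (\<lambda>u. l u x * (f u - a))" "integrable \<pi> (\<lambda>u. l u x * (u - m))"
    "integrable \<pi> (\<lambda>u. l u x * ((f u - a) * (u - m)))"
proof -
  have "(\<lambda>u. l u x * (f u - a)) = (\<lambda>u. f u * l u x - a * l u x)"
    "(\<lambda>u. l u x * (u - m)) = (\<lambda>u. u * l u x - m * l u x)"
    "(\<lambda>u. l u x * ((f u - a) * (u - m))) =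
      (\<lambda>u. f u * u * l u x - m * (f u * l u x) - a * (u * l u x) + a * m * l u x)"
    by (auto simp: algebra_simps)
  then show "integrable \<pi> (\<lambda>u. l u x * (f u - a))" "integrable \<pi> (\<lambda>u. l u x * (u - m))"
    "integrable \<pi> (\<lambda>u. l u x * ((f u - a) * (u - m)))"
    using assms by simp_all
qed

lemma mix_centred:
  assumes "integrable \<pi> (\<lambda>u. l u x)" "integrable \<pi> (\<lambda>u. f u * l u x)"
  shows "mix (\<lambda>u. f u - a) x = mix f x - a * mix (\<lambda>_. 1) x"
  using assms by (simp add: mix_def left_diff_distrib)

lemma power_of_nonneg: "0 \<le> power_of A u"
  unfolding power_of_def using l_pos by (intro integral_nonneg_AE) (simp add: less_imp_le)

lemma set_l_integrable:
  assumes "(\<integral>\<^sup>+x. ennreal (l u x) \<partial>R) = 1" "A \<in> sets R"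
  shows "integrable R (\<lambda>x. indicator A x * l u x)"
  using integrable_mult_indicator[OF assms(2) l_integrable(1)[OF assms(1)]] by simp

lemma power_of_compl:
  assumes u: "(\<integral>\<^sup>+x. ennreal (l u x) \<partial>R) = 1" and A: "A \<in> sets R"
  shows "power_of (space R - A) u = 1 - power_of A u"
proof -
  have "power_of (space R - A) u + power_of A u =
      (LINT x|R. indicator (space R - A) x * l u x + indicator A x * l u x)"
    unfolding power_of_def
    by (rule Bochner_Integration.integral_add[symmetric]; intro set_l_integrable u A sets.compl_sets)
  also have "\<dots> = (LINT x|R. l u x)"
    by (intro Bochner_Integration.integral_cong) (auto simp: indicator_def)
  finally show ?thesis using l_integrable(2)[OF u] by simp
qed

lemma integral_mix:
  assumes "integrable \<pi> f"
  shows "(LINT x|R. mix f x) = (LINT u|\<pi>. f u)"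
proof -
  have 1: "AE u in \<pi>. f u * power_of (space R) u = f u"
    using l_mass by eventually_elim (simp add: power_of_def l_integrable cong: Bochner_Integration.integral_cong)
  have "(LINT x|R. mix f x) = (LINT x|R. indicator (space R) x * mix f x)"
    by (intro Bochner_Integration.integral_cong) auto
  also have "\<dots> = (LINT u|\<pi>. f u * power_of (space R) u)"
    using assms by (intro integral_mix_set) auto
  also have "\<dots> = (LINT u|\<pi>. f u)"
    using 1 integrable_power_of[OF assms sets.top] assms by (intro integral_cong_AE) auto
  finally show ?thesis .
qed

lemma mix_one_pos:
  assumes "integrable \<pi> (\<lambda>u. l u x)"
  shows "0 < mix (\<lambda>_. 1) x"
proof -
  have "emeasure \<pi> {u \<in> space \<pi>. l u x \<noteq> 0} = 1"
    using l_pos[of _ x] prior.emeasure_space_1 by (simp add: less_imp_neq[symmetric])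
  then have "(LINT u|\<pi>. l u x) \<noteq> 0"
    using integral_nonneg_eq_0_iff_AE[OF assms] l_pos[of _ x]
    by (auto simp: less_imp_le less_imp_neq[symmetric] prior.AE_False)
  moreover have "0 \<le> (LINT u|\<pi>. l u x)"
    using l_pos by (intro integral_nonneg_AE) (simp add: less_imp_le)
  ultimately show ?thesis by (simp add: mix_def)
qed

end

section \<open>Exponential likelihoods and monotone estimands\<close>

text \<open>The constant is the supremum of \<open>e\<close> over the points with \<open>w < 0\<close>. This is Chebyshev's inequality in
  a form that does not require the product \<open>e * w\<close> to be integrable.\<close>

lemma comonotone_split:
  fixes e w :: "real \<Rightarrow> real"
  assumes e: "mono_on X e" and w: "mono_on X w" and "p \<in> X" "w p < 0" "q \<in> X" "0 < w q"
  obtains c where "\<And>x. x \<in> X \<Longrightarrow> c * w x \<le> e x * w x"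
proof -
  define N where "N = {x \<in> X. w x < 0}"
  have order: "x \<le> y" if "x \<in> X" "y \<in> X" "w x < w y" for x y
    using mono_onD[OF w that(2,1)] that(3) by (cases "x \<le> y") auto
  have below: "e x \<le> e y" if "x \<in> N" "y \<in> X" "0 \<le> w y" for x y
    using that order[of x y] mono_onD[OF e, of x y] by (auto simp: N_def)
  have bdd: "bdd_above (e ` N)" using below[of _ q] assms by (intro bdd_aboveI[of _ "e q"]) auto
  have ne: "N \<noteq> {}" using assms by (auto simp: N_def)
  show thesis
  proof (rule that[of "Sup (e ` N)"])
    fix x assume x: "x \<in> X"
    show "Sup (e ` N) * w x \<le> e x * w x"
    proof (cases "w x < 0")
      case True
      then have "e x \<le> Sup (e ` N)" using x bdd by (intro cSup_upper) (auto simp: N_def)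
      then show ?thesis using True by (intro mult_right_mono_neg) auto
    next
      case False
      then have "Sup (e ` N) \<le> e x" using below[of _ x] x ne by (intro cSup_least) auto
      then show ?thesis using False by (intro mult_right_mono) auto
    qed
  qed
qed

locale monotone_estimation =
  likelihood_mixture \<pi> Q "\<lambda>u x. exp ((u - u0) * x - b u)"
  for \<pi> Q :: "real measure" and u0 :: real and b :: "real \<Rightarrow> real" +
  fixes S :: "real set" and T :: "real \<Rightarrow> real"
  assumes sets_obs: "sets Q = sets borel"
    and prior_S: "AE u in \<pi>. u \<in> S"
    and mass_S: "\<And>u. u \<in> S \<Longrightarrow> (\<integral>\<^sup>+x. ennreal (exp ((u - u0) * x - b u)) \<partial>Q) = 1"
    and T_mono: "mono_on S T"
    and T_not_const: "\<not> (\<exists>c. AE u in \<pi>. T u = c)"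
    and T_integrable: "integrable \<pi> T"
    and id_integrable: "integrable \<pi> (\<lambda>u. u)"
    and T_id_integrable: "integrable \<pi> (\<lambda>u. T u * u)"
begin

abbreviation "lik u x \<equiv> exp ((u - u0) * x - b u)"

text \<open>The observations at which all posterior integrals used below converge: almost all of them. The
  monotonicity of the estimate is available only there.\<close>

definition regular_obs :: "real set" where
  "regular_obs = {x. integrable \<pi> (\<lambda>u. lik u x) \<and> integrable \<pi> (\<lambda>u. T u * lik u x) \<and>
     integrable \<pi> (\<lambda>u. u * lik u x) \<and> integrable \<pi> (\<lambda>u. T u * u * lik u x)}"

definition estimate :: "real \<Rightarrow> real" where
  "estimate x = mix T x / mix (\<lambda>_. 1) x"

lemma space_obs: "space Q = UNIV"
  using sets_eq_imp_space_eq[OF sets_obs] by simp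

lemma AE_regular_obs: "AE x in Q. x \<in> regular_obs"
proof -
  have "integrable \<pi> (\<lambda>u. 1::real)" by simp
  from mix_AE_integrable[OF this] mix_AE_integrable[OF T_integrable]
    mix_AE_integrable[OF id_integrable] mix_AE_integrable[OF T_id_integrable]
  show ?thesis unfolding regular_obs_def by eventually_elim simp
qed

lemma mix_one_pos_regular: "x \<in> regular_obs \<Longrightarrow> 0 < mix (\<lambda>_. 1) x"
  by (rule mix_one_pos) (simp add: regular_obs_def)

text \<open>Passing from \<open>x\<close> to \<open>y \<ge> x\<close> multiplies the likelihood by an increasing function of \<open>u\<close>, which is
  nonnegatively correlated with \<open>f\<close>.\<close>

lemma posterior_mean_mono:
  assumes f: "mono_on S f" and int: "\<And>x. x \<in> X \<Longrightarrow> integrable \<pi> (\<lambda>u. f u * lik u x)"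
    and X: "X \<subseteq> regular_obs"
  shows "mono_on X (\<lambda>x. mix f x / mix (\<lambda>_. 1) x)"
proof (rule mono_onI)
  fix x y assume xy: "x \<in> X" "y \<in> X" "x \<le> y"
  have y: "lik u y = lik u x * exp ((u - u0) * (y - x))" for u
    by (simp add: exp_add[symmetric] algebra_simps)
  have "mono_on S (\<lambda>u. exp ((u - u0) * (y - x)))"
    using xy by (intro mono_onI) (simp add: mult_right_mono)
  moreover have "integrable \<pi> (\<lambda>u. lik u x * f u)" using int[OF xy(1)] by (simp add: mult.commute)
  moreover have "(\<lambda>u. lik u x * (f u * exp ((u - u0) * (y - x)))) = (\<lambda>u. f u * lik u y)"
    unfolding y by (simp add: mult_ac)
  ultimately have "(LINT u|\<pi>. lik u x * f u) * (LINT u|\<pi>. lik u y) \<le>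
      (LINT u|\<pi>. lik u x) * (LINT u|\<pi>. f u * lik u y)"
    using weighted_chebyshev[OF prior_S _ f, of "\<lambda>u. lik u x" "\<lambda>u. exp ((u - u0) * (y - x))"]
      xy(1,2) X int[OF xy(2)] unfolding y[symmetric] by (auto simp: regular_obs_def subset_eq)
  then have "mix f x * mix (\<lambda>_. 1) y \<le> mix (\<lambda>_. 1) x * mix f y"
    unfolding mix_def by (simp add: mult.commute)
  then show "mix f x / mix (\<lambda>_. 1) x \<le> mix f y / mix (\<lambda>_. 1) y"
    using mix_one_pos_regular[of x] mix_one_pos_regular[of y] xy X
    by (simp add: frac_le_eq divide_simps mult.commute subset_eq)
qed

lemma estimate_mono: "mono_on regular_obs estimate"
  unfolding estimate_def[abs_def] using T_mono by (rule posterior_mean_mono) (auto simp: regular_obs_def)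

text \<open>The likelihood ratio \<open>\<rho>\<close> of \<open>v\<close> against \<open>u\<close> is increasing in the observation. Either it is at least \<open>1\<close>
  on \<open>A\<close>, or it is at most \<open>1\<close> on the complement, in both cases within the set \<open>X\<close> of full measure.\<close>

lemma power_of_mono:
  assumes A: "A \<in> sets Q" and X: "AE x in Q. x \<in> X"
    and upper: "\<And>x y. \<lbrakk>x \<in> A; x \<in> X; y \<in> X; x \<le> y\<rbrakk> \<Longrightarrow> y \<in> A"
  shows "mono_on S (power_of A)"
proof (rule mono_onI)
  fix u v assume uv: "u \<in> S" "v \<in> S" "u \<le> v"
  define \<rho> where "\<rho> x = exp ((v - u) * x - (b v - b u))" for x
  have lv: "lik v x = lik u x * \<rho> x" for x
    by (simp add: \<rho>_def exp_add[symmetric] algebra_simps)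
  have \<rho>_mono: "\<rho> x \<le> \<rho> y" if "x \<le> y" for x y
    using that uv(3) by (simp add: \<rho>_def mult_left_mono)
  note int = set_l_integrable[OF mass_S[OF uv(1)]] set_l_integrable[OF mass_S[OF uv(2)]]
  show "power_of A u \<le> power_of A v"
  proof (cases "\<exists>x\<in>A \<inter> X. \<rho> x < 1")
    case True
    then obtain x where x: "x \<in> A" "x \<in> X" "\<rho> x < 1" by blast
    have "lik v y \<le> lik u y" if "y \<in> X" "y \<notin> A" for y
    proof -
      have "y \<le> x" using upper[OF x(1,2) that(1)] that(2) by force
      then have "\<rho> y \<le> 1" using \<rho>_mono x(3) by (meson less_imp_le order_trans)
      then show ?thesis unfolding lv by (simp add: mult_le_cancel_left1)
    qed
    then have "power_of (space Q - A) v \<le> power_of (space Q - A) u"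
      unfolding power_of_def using X A
      by (intro integral_mono_AE int) (auto simp: indicator_def)
    then show ?thesis using power_of_compl[OF mass_S A] uv by simp
  next
    case False
    then have "lik u y \<le> lik v y" if "y \<in> X" "y \<in> A" for y
      using that unfolding lv by (force simp: mult_le_cancel_left1 not_less)
    then show ?thesis
      unfolding power_of_def using X A
      by (intro integral_mono_AE int) (auto simp: indicator_def)
  qed
qed

abbreviation "prior_mean \<equiv> (LINT u|\<pi>. u)"

lemma centred_integrable:
  shows "integrable \<pi> (\<lambda>u. T u - a)" "integrable \<pi> (\<lambda>u. u - m)"
    "integrable \<pi> (\<lambda>u. (T u - a) * (u - m))"
  using T_integrable id_integrable T_id_integrable by (auto simp: algebra_simps)

text \<open>Given \<open>x\<close>, the variables \<open>T\<close> and \<open>u\<close> are nonnegatively correlated; so the contribution of \<open>x\<close> to the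
  integral is at least \<open>e x * W x\<close>, where \<open>e\<close> is the increasing function in the hypothesis and \<open>W x\<close> is the
  unnormalised posterior mean of \<open>u\<close> minus its prior mean. The posterior mean of \<open>u\<close> increases in \<open>x\<close>
  and \<open>W\<close> integrates to zero, so \<open>e\<close> may be replaced by a constant, whose contribution vanishes.\<close>

lemma covariance_on_event_nonneg:
  assumes A: "A \<in> sets Q"
    and e: "mono_on regular_obs (\<lambda>x. indicator A x * (estimate x - a))"
  shows "0 \<le> (LINT u|\<pi>. (T u - a) * (u - prior_mean) * power_of A u)"
proof -
  let ?m = prior_mean
  let ?e = "\<lambda>x. indicator A x * (estimate x - a)"
  let ?K = "mix (\<lambda>u. (T u - a) * (u - ?m))"
  let ?W = "mix (\<lambda>u. u - ?m)"
  let ?w = "\<lambda>x. ?W x / mix (\<lambda>_. 1) x"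
  have reg: "integrable \<pi> (\<lambda>u. lik u x * (T u - a))" "integrable \<pi> (\<lambda>u. lik u x * (u - ?m))"
      "integrable \<pi> (\<lambda>u. lik u x * ((T u - a) * (u - ?m)))"
    if "x \<in> regular_obs" for x
    using centred_likelihood_integrable[of x T] that unfolding regular_obs_def by blast+
  have mono: "mono_on S (\<lambda>u. T u - a)" "mono_on S (\<lambda>u. u - ?m)"
    using T_mono by (auto simp: mono_on_def)
  have w: "mono_on regular_obs ?w"
    using mono(2) by (rule posterior_mean_mono) (use reg(2) in \<open>auto simp: mult.commute\<close>)
  have K: "?e x * ?W x \<le> indicator A x * ?K x" if x: "x \<in> regular_obs" for x
  proof -
    note pos = mix_one_pos_regular[OF x]
    have "mix (\<lambda>u. T u - a) x = mix T x - a * mix (\<lambda>_. 1) x"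
      using x by (intro mix_centred) (simp_all add: regular_obs_def)
    then have est: "(estimate x - a) * mix (\<lambda>_. 1) x = mix (\<lambda>u. T u - a) x"
      using pos by (simp add: estimate_def left_diff_distrib)
    have "mix (\<lambda>u. T u - a) x * ?W x \<le> mix (\<lambda>_. 1) x * ?K x"
      using weighted_chebyshev[OF prior_S _ mono, of "\<lambda>u. lik u x"] reg[OF x] x
      unfolding mix_def regular_obs_def by (simp add: mult.commute)
    then have "mix (\<lambda>_. 1) x * ((estimate x - a) * ?W x) \<le> mix (\<lambda>_. 1) x * ?K x"
      unfolding est[symmetric] by (simp add: mult_ac)
    then have "(estimate x - a) * ?W x \<le> ?K x" using pos by (simp add: mult_le_cancel_left)
    then show ?thesis by (simp add: indicator_def)
  qed
  have int_W: "integrable Q ?W" "(LINT x|Q. ?W x) = 0"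
    using mix_integrable[OF centred_integrable(2)] integral_mix[OF centred_integrable(2)]
      id_integrable by (auto simp: prior.prob_space)
  have int_K: "integrable Q (\<lambda>x. indicator A x * ?K x)"
    using integrable_mult_indicator[OF A mix_integrable[OF centred_integrable(3)]] by simp
  \<comment> \<open>If \<open>W\<close> does not take both signs it vanishes almost everywhere, and any constant will do.\<close>
  have "\<exists>c. AE x in Q. c * ?W x \<le> ?e x * ?W x"
  proof (cases "(\<exists>p\<in>regular_obs. ?w p < 0) \<and> (\<exists>q\<in>regular_obs. 0 < ?w q)")
    case True
    then obtain c where c: "\<And>x. x \<in> regular_obs \<Longrightarrow> c * ?w x \<le> ?e x * ?w x"
      using comonotone_split[OF e w] by blast
    have "c * ?W x \<le> ?e x * ?W x" if x: "x \<in> regular_obs" for x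
      using c[OF x] mix_one_pos_regular[OF x] by (simp add: divide_le_cancel)
    then show ?thesis using AE_regular_obs by (intro exI[of _ c]) auto
  next
    case False
    then consider "\<forall>x\<in>regular_obs. 0 \<le> ?W x" | "\<forall>x\<in>regular_obs. 0 \<le> - ?W x"
      using mix_one_pos_regular by (fastforce simp: not_less divide_less_0_iff zero_less_divide_iff)
    then have "AE x in Q. ?W x = 0"
    proof cases
      case 1
      then have "AE x in Q. 0 \<le> ?W x" using AE_regular_obs by auto
      then show ?thesis using integral_nonneg_eq_0_iff_AE[OF int_W(1)] int_W(2) by simp
    next
      case 2
      then have "AE x in Q. 0 \<le> - ?W x" using AE_regular_obs by auto
      then show ?thesis using integral_nonneg_eq_0_iff_AE[of Q "\<lambda>x. - ?W x"] int_W by simp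
    qed
    then show ?thesis by (intro exI[of _ 0]) auto
  qed
  then obtain c where c: "AE x in Q. c * ?W x \<le> ?e x * ?W x" by blast
  from c AE_regular_obs have "AE x in Q. c * ?W x \<le> indicator A x * ?K x"
    by eventually_elim (rule order_trans[OF _ K])
  then have "(LINT x|Q. c * ?W x) \<le> (LINT x|Q. indicator A x * ?K x)"
    using int_W int_K by (intro integral_mono_AE) auto
  then show ?thesis
    using int_W(2) integral_mix_set[OF centred_integrable(3) A] by simp
qed

text \<open>The density \<open>V = s * v + t * w\<close> turns \<open>\<pi>\<close> into a prior with the same mean of \<open>T\<close>. The
  left-hand side is \<open>E ((T - a) G)\<close> for the power function \<open>G\<close> of the event that the estimate exceeds \<open>a\<close>,
  and each integral on the right is at least what this event contributes under the tilted prior. So it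
  suffices that \<open>V - 1\<close> has a nonnegative integral against \<open>(T - a) * G\<close>. This follows from the cut
  criterion after subtracting \<open>\<beta> * (T - a) + \<alpha>\<close>, which integrates to zero against \<open>V - 1\<close>.\<close>

lemma stop_loss_le_mixture:
  assumes I: "open I" "convex I" "S \<subseteq> I" and v: "convex_on I (\<lambda>u. s * v u + t * w u)"
    and st: "0 \<le> s" "0 \<le> t"
    and int: "integrable \<pi> v" "integrable \<pi> w"
      "integrable \<pi> (\<lambda>u. v u * T u)" "integrable \<pi> (\<lambda>u. w u * T u)"
    and mass: "s * (LINT u|\<pi>. v u) + t * (LINT u|\<pi>. w u) = 1"
    and mean: "s * (LINT u|\<pi>. v u * T u) + t * (LINT u|\<pi>. w u * T u) = (LINT u|\<pi>. T u)"
  shows "(LINT x|Q. max 0 (mix T x - a * mix (\<lambda>_. 1) x)) \<le>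
      s * (LINT x|Q. max 0 (mix (\<lambda>u. v u * T u) x - a * mix v x)) +
      t * (LINT x|Q. max 0 (mix (\<lambda>u. w u * T u) x - a * mix w x))"
proof -
  let ?m = prior_mean and ?z = "LINT u|\<pi>. T u"
  have one: "integrable \<pi> (\<lambda>_. 1::real)" by simp
  note mT = mix_integrable[OF T_integrable] and m1 = mix_integrable[OF one]
  note [measurable] = borel_measurable_integrable[OF mT] borel_measurable_integrable[OF m1]
  define A where "A = {x \<in> space Q. a * mix (\<lambda>_. 1) x < mix T x}"
  have A: "A \<in> sets Q" unfolding A_def by measurable
  have Ac: "space Q - A \<in> sets Q" using A by auto
  define G where "G = power_of A"
  define Cov where "Cov = (LINT u|\<pi>. T u * (u - ?m))"
  \<comment> \<open>The slope for which \<open>d\<close> below is uncorrelated with \<open>u\<close>.\<close>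
  define \<beta> where "\<beta> = (LINT u|\<pi>. (T u - a) * (u - ?m) * G u) / Cov"
  define \<psi> where "\<psi> = (LINT x|Q. max 0 (mix T x - a * mix (\<lambda>_. 1) x))"
  have in_A: "x \<in> A \<longleftrightarrow> a < estimate x" if "x \<in> regular_obs" for x
    using mix_one_pos_regular[OF that] by (simp add: A_def space_obs estimate_def less_divide_eq)
  have est_mono: "estimate x \<le> estimate y" if "x \<in> regular_obs" "y \<in> regular_obs" "x \<le> y" for x y
    using mono_onD[OF estimate_mono that] .
  have G_mono: "mono_on S G"
    unfolding G_def
    by (rule power_of_mono[OF A AE_regular_obs]) (meson in_A est_mono less_le_trans)
  have Cov_eq: "Cov = (LINT u|\<pi>. T u * u) - ?z * ?m"
    unfolding Cov_def using T_integrable T_id_integrable by (simp add: right_diff_distrib)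
  have "strict_mono_on S (\<lambda>u. u)" by (simp add: strict_mono_on_def)
  then have Cov_pos: "0 < Cov"
    using strict_chebyshev[OF prior.prob_space_axioms prior_S T_mono _ T_integrable id_integrable
        T_id_integrable T_not_const] by (simp add: Cov_eq)
  have intG: "integrable \<pi> (\<lambda>u. f u * G u)" if "integrable \<pi> f" for f
    unfolding G_def using integrable_power_of[OF that A] .
  \<comment> \<open>\<open>0 \<le> \<beta>\<close> because the positive part of \<open>estimate - a\<close> increases with the observation.\<close>
  have "0 \<le> (LINT u|\<pi>. (T u - a) * (u - ?m) * G u)"
    unfolding G_def
  proof (rule covariance_on_event_nonneg[OF A], rule mono_onI)
    fix x y assume "x \<in> regular_obs" "y \<in> regular_obs" "x \<le> y"
    then show "indicator A x * (estimate x - a) \<le> indicator A y * (estimate y - a)"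
      using est_mono[of x y] in_A[of x] in_A[of y] by (auto simp: indicator_def)
  qed
  then have \<beta>0: "0 \<le> \<beta>" using Cov_pos by (simp add: \<beta>_def)
  \<comment> \<open>\<open>\<beta> \<le> 1\<close> because the negative part of \<open>estimate - a\<close>, taken with its sign, increases too.\<close>
  have "0 \<le> (LINT u|\<pi>. (T u - a) * (u - ?m) * power_of (space Q - A) u)"
  proof (rule covariance_on_event_nonneg[OF Ac], rule mono_onI)
    fix x y assume "x \<in> regular_obs" "y \<in> regular_obs" "x \<le> y"
    then show "indicator (space Q - A) x * (estimate x - a) \<le> indicator (space Q - A) y * (estimate y - a)"
      using est_mono[of x y] in_A[of x] in_A[of y] by (auto simp: indicator_def space_obs)
  qed
  also have "\<dots> = (LINT u|\<pi>. (T u - a) * (u - ?m) - (T u - a) * (u - ?m) * G u)"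
  proof (rule integral_cong_AE)
    show "AE u in \<pi>. (T u - a) * (u - ?m) * power_of (space Q - A) u =
        (T u - a) * (u - ?m) - (T u - a) * (u - ?m) * G u"
      using prior_S
    proof eventually_elim
      case (elim u)
      show ?case
        using power_of_compl[OF mass_S[OF elim] A]
        by (simp only: G_def right_diff_distrib mult_1_right)
    qed
    show "(\<lambda>u. (T u - a) * (u - ?m) * power_of (space Q - A) u) \<in> borel_measurable \<pi>"
      using integrable_power_of[OF centred_integrable(3) Ac] by simp
    show "(\<lambda>u. (T u - a) * (u - ?m) - (T u - a) * (u - ?m) * G u) \<in> borel_measurable \<pi>"
      using centred_integrable(3) intG[OF centred_integrable(3)] by simp
  qed
  also have "\<dots> = Cov - \<beta> * Cov"
  proof -
    have "(LINT u|\<pi>. (T u - a) * (u - ?m)) = (LINT u|\<pi>. T u * (u - ?m) - a * (u - ?m))"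
      by (simp add: left_diff_distrib)
    also have "\<dots> = Cov - a * (LINT u|\<pi>. u - ?m)"
      unfolding Cov_def using centred_integrable(3)[of 0] centred_integrable(2) by simp
    also have "(LINT u|\<pi>. u - ?m) = 0" using id_integrable by (simp add: prior.prob_space)
    finally show ?thesis
      using centred_integrable(3) intG[OF centred_integrable(3)] Cov_pos by (simp add: \<beta>_def)
  qed
  finally have "0 \<le> (1 - \<beta>) * Cov" by (simp add: algebra_simps)
  then have \<beta>1: "\<beta> \<le> 1" using Cov_pos by (simp add: zero_le_mult_iff)
  have "\<psi> = (LINT x|Q. indicator A x * mix (\<lambda>u. T u - a) x)"
    unfolding \<psi>_def
  proof (rule integral_cong_AE)
    show "AE x in Q. max 0 (mix T x - a * mix (\<lambda>_. 1) x) = indicator A x * mix (\<lambda>u. T u - a) x"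
      using AE_regular_obs
    proof eventually_elim
      case (elim x)
      then have "mix (\<lambda>u. T u - a) x = mix T x - a * mix (\<lambda>_. 1) x"
        by (intro mix_centred) (simp_all add: regular_obs_def)
      then show ?case by (auto simp: A_def space_obs indicator_def max_def)
    qed
    show "(\<lambda>x. indicator A x * mix (\<lambda>u. T u - a) x) \<in> borel_measurable Q"
      using mix_integrable[OF centred_integrable(1)] A by simp
  qed measurable
  also have "\<dots> = (LINT u|\<pi>. (T u - a) * G u)"
    unfolding G_def using integral_mix_set[OF centred_integrable(1) A] .
  finally have \<psi>: "\<psi> = (LINT u|\<pi>. (T u - a) * G u)" .
  have int_psi: "integrable Q (\<lambda>x. max 0 (mix T x - a * mix (\<lambda>_. 1) x))" using mT m1 by auto
  have "0 \<le> \<psi>" unfolding \<psi>_def by (intro integral_nonneg_AE) auto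
  have "(LINT x|Q. mix T x - a * mix (\<lambda>_. 1) x) = ?z - a"
    using mT m1 integral_mix[OF T_integrable] integral_mix[OF one] by (simp add: prior.prob_space)
  moreover have "(LINT x|Q. mix T x - a * mix (\<lambda>_. 1) x) \<le> \<psi>"
    unfolding \<psi>_def using mT m1 int_psi by (intro integral_mono_AE) auto
  ultimately have "?z - a \<le> \<psi>" by simp
  define \<alpha> where "\<alpha> = \<psi> - \<beta> * (?z - a)"
  have \<alpha>: "0 \<le> \<alpha>"
  proof (cases "?z \<le> a")
    case True
    then have "\<beta> * (?z - a) \<le> 0" using \<beta>0 by (simp add: mult_nonneg_nonpos)
    then show ?thesis using \<open>0 \<le> \<psi>\<close> by (simp add: \<alpha>_def)
  next
    case False
    then have "\<beta> * (?z - a) \<le> 1 * (?z - a)" using \<beta>1 by (intro mult_right_mono) auto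
    then show ?thesis using \<open>?z - a \<le> \<psi>\<close> by (simp add: \<alpha>_def)
  qed
  define d where "d u = (T u - a) * (G u - \<beta>) - \<alpha>" for u
  have d_eq: "f u * d u = f u * (T u - a) * G u - \<beta> * (f u * (T u - a)) - \<alpha> * f u" for f u
    by (simp add: d_def algebra_simps)
  have int_d: "integrable \<pi> (\<lambda>u. f u * d u)"
    and integral_d: "(LINT u|\<pi>. f u * d u) = (LINT u|\<pi>. f u * (T u - a) * G u)
      - \<beta> * (LINT u|\<pi>. f u * (T u - a)) - \<alpha> * (LINT u|\<pi>. f u)"
    if f: "integrable \<pi> f" "integrable \<pi> (\<lambda>u. f u * T u)" for f
  proof -
    have 1: "integrable \<pi> (\<lambda>u. f u * (T u - a))" using f by (simp add: algebra_simps)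
    show "integrable \<pi> (\<lambda>u. f u * d u)" unfolding d_eq using f 1 intG[OF 1] by simp
    show "(LINT u|\<pi>. f u * d u) = (LINT u|\<pi>. f u * (T u - a) * G u)
      - \<beta> * (LINT u|\<pi>. f u * (T u - a)) - \<alpha> * (LINT u|\<pi>. f u)"
      unfolding d_eq using f 1 intG[OF 1] by simp
  qed
  have d1: "integrable \<pi> d" "(LINT u|\<pi>. d u) = 0"
    using int_d[OF one] integral_d[OF one] T_integrable
    by (auto simp: \<psi>[symmetric] \<alpha>_def prior.prob_space)
  have idT: "integrable \<pi> (\<lambda>u. u * T u)" using T_id_integrable by (simp add: mult.commute)
  have "(LINT u|\<pi>. (u - ?m) * d u) = 0"
  proof -
    have 1: "integrable \<pi> (\<lambda>u. (u - ?m) * T u)" using idT T_integrable by (simp add: algebra_simps)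
    have 2: "(LINT u|\<pi>. u - ?m) = 0" using id_integrable by (simp add: prior.prob_space)
    have "(LINT u|\<pi>. (u - ?m) * (T u - a)) = (LINT u|\<pi>. T u * (u - ?m) - a * (u - ?m))"
      by (simp add: algebra_simps)
    also have "\<dots> = Cov"
      using 1 2 centred_integrable(2) unfolding Cov_def by (simp add: mult.commute)
    finally have 3: "(LINT u|\<pi>. (u - ?m) * (T u - a)) = Cov" .
    have "(LINT u|\<pi>. (u - ?m) * (T u - a) * G u) = \<beta> * Cov"
      using Cov_pos by (simp add: \<beta>_def mult.commute)
    then show ?thesis using integral_d[OF centred_integrable(2) 1] 2 3 by simp
  qed
  then have d2: "integrable \<pi> (\<lambda>u. u * d u)" "(LINT u|\<pi>. u * d u) = 0"
    using int_d[OF id_integrable idT] d1 by (simp_all add: left_diff_distrib)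
  \<comment> \<open>Where \<open>T - a\<close> and \<open>G - \<beta>\<close> have opposite signs, \<open>d \<le> - \<alpha> \<le> 0\<close>. Where both are nonnegative their
    product increases with \<open>u\<close>, and where both are nonpositive it decreases.\<close>
  have cut: "d q \<le> 0" if pqr: "p \<in> S" "q \<in> S" "r \<in> S" "p < q" "q < r" and neg: "d p < 0" "d r < 0"
    for p q r
  proof -
    have 1: "T p \<le> T q" "T q \<le> T r" "G p \<le> G q" "G q \<le> G r"
      using pqr mono_onD[OF T_mono] mono_onD[OF G_mono] by auto
    consider "a \<le> T q" "\<beta> \<le> G q" | "T q \<le> a" "G q \<le> \<beta>" | "(T q - a) * (G q - \<beta>) \<le> 0"
      by (fastforce simp: mult_le_0_iff)
    then show ?thesis
    proof cases
      case 1
      then have "(T q - a) * (G q - \<beta>) \<le> (T r - a) * (G r - \<beta>)"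
        using \<open>T q \<le> T r\<close> \<open>G q \<le> G r\<close> by (intro mult_mono) auto
      then show ?thesis using neg by (simp add: d_def)
    next
      case 2
      then have "(a - T q) * (\<beta> - G q) \<le> (a - T p) * (\<beta> - G p)"
        using \<open>T p \<le> T q\<close> \<open>G p \<le> G q\<close> by (intro mult_mono) auto
      then have "(T q - a) * (G q - \<beta>) \<le> (T p - a) * (G p - \<beta>)" by (simp add: algebra_simps)
      then show ?thesis using neg by (simp add: d_def)
    next
      case 3
      then show ?thesis using \<alpha> by (simp add: d_def)
    qed
  qed
  define V where "V u = s * v u + t * w u" for u
  have V: "integrable \<pi> V" "integrable \<pi> (\<lambda>u. V u * T u)"
    unfolding V_def using int by (auto simp: distrib_right mult.assoc)
  have V_int: "(LINT u|\<pi>. V u) = 1" "(LINT u|\<pi>. V u * T u) = ?z"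
    unfolding V_def using int mass mean by (auto simp: distrib_right mult.assoc)
  have "0 \<le> (LINT u|\<pi>. V u * d u)"
    using convex_cut_criterion[OF I _ prior_S cut d1(1) d2(1) int_d[OF V] d1(2) d2(2)] v
    by (simp add: V_def[abs_def])
  also have "\<dots> = (LINT u|\<pi>. V u * (T u - a) * G u) - \<beta> * (?z - a) - \<alpha>"
    unfolding integral_d[OF V] using V V_int by (simp add: right_diff_distrib)
  finally have main: "\<psi> \<le> (LINT u|\<pi>. V u * (T u - a) * G u)" by (simp add: \<alpha>_def)
  have piece: "integrable \<pi> (\<lambda>u. f u * (T u - a) * G u)"
      "(LINT u|\<pi>. f u * (T u - a) * G u) \<le> (LINT x|Q. max 0 (mix (\<lambda>u. f u * T u) x - a * mix f x))"
    if f: "integrable \<pi> f" "integrable \<pi> (\<lambda>u. f u * T u)" for f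
  proof -
    have 1: "integrable \<pi> (\<lambda>u. f u * (T u - a))" using f by (simp add: algebra_simps)
    show "integrable \<pi> (\<lambda>u. f u * (T u - a) * G u)" using intG[OF 1] .
    have "(LINT u|\<pi>. f u * (T u - a) * G u) = (LINT x|Q. indicator A x * mix (\<lambda>u. f u * (T u - a)) x)"
      unfolding G_def using integral_mix_set[OF 1 A] by simp
    also have "\<dots> \<le> (LINT x|Q. max 0 (mix (\<lambda>u. f u * T u) x - a * mix f x))"
    proof (rule integral_mono_AE)
      show "integrable Q (\<lambda>x. indicator A x * mix (\<lambda>u. f u * (T u - a)) x)"
        using integrable_mult_indicator[OF A mix_integrable[OF 1]] by simp
      show "integrable Q (\<lambda>x. max 0 (mix (\<lambda>u. f u * T u) x - a * mix f x))"
        using mix_integrable[OF f(1)] mix_integrable[OF f(2)] by auto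
      show "AE x in Q. indicator A x * mix (\<lambda>u. f u * (T u - a)) x
          \<le> max 0 (mix (\<lambda>u. f u * T u) x - a * mix f x)"
        using mix_AE_integrable[OF f(1)] mix_AE_integrable[OF f(2)]
      proof eventually_elim
        case (elim x)
        have "mix (\<lambda>u. f u * (T u - a)) x = (LINT u|\<pi>. f u * T u * lik u x - a * (f u * lik u x))"
          unfolding mix_def by (simp add: algebra_simps)
        also have "\<dots> = mix (\<lambda>u. f u * T u) x - a * mix f x"
          using elim by (simp add: mix_def)
        finally show ?case by (simp add: indicator_def)
      qed
    qed
    finally show "(LINT u|\<pi>. f u * (T u - a) * G u)
        \<le> (LINT x|Q. max 0 (mix (\<lambda>u. f u * T u) x - a * mix f x))" .
  qed
  have "(LINT u|\<pi>. V u * (T u - a) * G u) =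
      (LINT u|\<pi>. s * (v u * (T u - a) * G u) + t * (w u * (T u - a) * G u))"
    by (simp add: V_def algebra_simps)
  also have "\<dots> = s * (LINT u|\<pi>. v u * (T u - a) * G u) + t * (LINT u|\<pi>. w u * (T u - a) * G u)"
    using piece(1) int by simp
  also have "\<dots> \<le> s * (LINT x|Q. max 0 (mix (\<lambda>u. v u * T u) x - a * mix v x)) +
      t * (LINT x|Q. max 0 (mix (\<lambda>u. w u * T u) x - a * mix w x))"
    using st piece(2) int by (intro add_mono mult_left_mono) auto
  finally show ?thesis using main by (simp add: \<psi>_def)
qed

end

section \<open>The law of the estimate\<close>

context likelihood_mixture
begin

text \<open>The marginal density of the observation as it arises from mixing measures, before it is known to
  be finite.\<close>

definition evidence :: "'b \<Rightarrow> ennreal" where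
  "evidence x = (\<integral>\<^sup>+u. ennreal (l u x) \<partial>\<pi>)"

lemma AE_evidence: "AE x in R. evidence x = ennreal (mix (\<lambda>_. 1) x)"
proof -
  have "integrable \<pi> (\<lambda>_. 1::real)" by simp
  from mix_AE_integrable[OF this] show ?thesis
  proof eventually_elim
    case (elim x)
    then show ?case
      using l_pos by (simp add: evidence_def mix_def nn_integral_eq_integral less_imp_le)
  qed
qed

lemma mix_measurable[measurable]: "integrable \<pi> f \<Longrightarrow> mix f \<in> borel_measurable R"
  using mix_integrable by blast

lemma AE_mix_one_pos: "AE x in R. 0 < mix (\<lambda>_. 1) x"
proof -
  have "integrable \<pi> (\<lambda>_. 1::real)" by simp
  from mix_AE_integrable[OF this] show ?thesis
    by eventually_elim (simp add: mix_one_pos)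
qed

text \<open>The law of the posterior mean of \<open>f\<close> when the observation follows its marginal law.\<close>

definition estimate_law :: "(real \<Rightarrow> real) \<Rightarrow> real measure" where
  "estimate_law f = distr (density R (\<lambda>x. ennreal (mix (\<lambda>_. 1) x))) borel
     (\<lambda>x. mix f x / mix (\<lambda>_. 1) x)"

context
  fixes f :: "real \<Rightarrow> real"
  assumes f: "integrable \<pi> f"
begin

lemma estimate_measurable: "(\<lambda>x. mix f x / mix (\<lambda>_. 1) x) \<in> borel_measurable R"
  using f by measurable

lemma sets_estimate_law: "sets (estimate_law f) = sets borel"
  by (simp add: estimate_law_def)

lemma
  assumes [measurable]: "g \<in> borel_measurable borel"
  shows integral_estimate_law:
      "(LINT w|estimate_law f. g w) = (LINT x|R. mix (\<lambda>_. 1) x * g (mix f x / mix (\<lambda>_. 1) x))" (is ?A)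
    and integrable_estimate_law:
      "integrable (estimate_law f) g \<longleftrightarrow>
        integrable R (\<lambda>x. mix (\<lambda>_. 1) x * g (mix f x / mix (\<lambda>_. 1) x))" (is ?B)
proof -
  have [measurable]: "mix (\<lambda>_. 1) \<in> borel_measurable R" "mix f \<in> borel_measurable R"
    using f by measurable
  have pos: "AE x in R. 0 \<le> mix (\<lambda>_. 1) x"
    using AE_mix_one_pos by eventually_elim simp
  show ?A
    unfolding estimate_law_def
    by (subst integral_distr, simp, simp, subst integral_density) (use pos in simp_all)
  show ?B
    unfolding estimate_law_def
    by (subst integrable_distr_eq, simp, simp, subst integrable_density) (use pos in simp_all)
qed

lemma prob_space_estimate_law: "prob_space (estimate_law f)"
  unfolding estimate_law_def
proof (rule prob_space.prob_space_distr)
  have one: "integrable \<pi> (\<lambda>_. 1::real)" by simp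
  have "(\<integral>\<^sup>+x. ennreal (mix (\<lambda>_. 1) x) \<partial>R) = ennreal (LINT x|R. mix (\<lambda>_. 1) x)"
    using AE_mix_one_pos by (intro nn_integral_eq_integral mix_integrable one) (auto elim: eventually_mono)
  also have "\<dots> = 1" using integral_mix[OF one] by (simp add: prior.prob_space)
  finally show "prob_space (density R (\<lambda>x. ennreal (mix (\<lambda>_. 1) x)))"
    using one by (intro prob_spaceI) (simp add: emeasure_density cong: nn_integral_cong)
  show "(\<lambda>x. mix f x / mix (\<lambda>_. 1) x)
      \<in> measurable (density R (\<lambda>x. ennreal (mix (\<lambda>_. 1) x))) borel"
    using estimate_measurable by simp
qed

lemma mean_estimate_law:
  "integrable (estimate_law f) (\<lambda>w. w)" "(LINT w|estimate_law f. w) = (LINT u|\<pi>. f u)"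
proof -
  have eq: "AE x in R. mix (\<lambda>_. 1) x * (mix f x / mix (\<lambda>_. 1) x) = mix f x"
    using AE_mix_one_pos by eventually_elim simp
  have [measurable]: "mix (\<lambda>_. 1) \<in> borel_measurable R" "mix f \<in> borel_measurable R"
    using f by measurable
  show "integrable (estimate_law f) (\<lambda>w. w)"
    by (subst integrable_estimate_law, simp, subst integrable_cong_AE[OF _ _ eq])
      (use mix_integrable[OF f] in simp_all)
  show "(LINT w|estimate_law f. w) = (LINT u|\<pi>. f u)"
    by (subst integral_estimate_law, simp, subst integral_cong_AE[OF _ _ eq])
      (use integral_mix[OF f] in simp_all)
qed

lemma stop_loss_estimate_law:
  "(LINT w|estimate_law f. max 0 (w - a)) = (LINT x|R. max 0 (mix f x - a * mix (\<lambda>_. 1) x))"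
proof -
  have [measurable]: "mix (\<lambda>_. 1) \<in> borel_measurable R" "mix f \<in> borel_measurable R"
    using f by measurable
  have "(LINT w|estimate_law f. max 0 (w - a)) =
      (LINT x|R. mix (\<lambda>_. 1) x * max 0 (mix f x / mix (\<lambda>_. 1) x - a))"
    by (rule integral_estimate_law) measurable
  also have "\<dots> = (LINT x|R. max 0 (mix f x - a * mix (\<lambda>_. 1) x))"
  proof (rule integral_cong_AE)
    show "AE x in R. mix (\<lambda>_. 1) x * max 0 (mix f x / mix (\<lambda>_. 1) x - a) =
        max 0 (mix f x - a * mix (\<lambda>_. 1) x)"
      using AE_mix_one_pos
    proof eventually_elim
      case (elim x)
      then show ?case by (simp add: max_mult_distrib_left right_diff_distrib mult.commute)
    qed
  qed measurable
  finally show ?thesis .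
qed

end

end

section \<open>Log-partition functions and supports\<close>

text \<open>Convexity of the exponential function bounds the likelihood at the convex combination \<open>m\<close> by
  \<open>exp gap\<close> times the convex combination of the likelihoods. All of them integrate to \<open>1\<close>, hence \<open>exp gap \<ge> 1\<close>.\<close>

lemma log_laplace_convex:
  assumes I: "convex I" and Q: "prob_space Q" "sets Q = sets borel"
    and mass: "\<And>u. u \<in> I \<Longrightarrow> (\<integral>\<^sup>+x. ennreal (exp ((u - u0) * x - b u)) \<partial>Q) = 1"
  shows "convex_on I b"
proof (rule convex_onI)
  fix t u v :: real
  assume t: "0 < t" "t < 1" and uv: "u \<in> I" "v \<in> I"
  define m where "m = (1 - t) *\<^sub>R u + t *\<^sub>R v"
  define gap where "gap = (1 - t) * b u + t * b v - b m"
  have m: "m \<in> I" using I uv t unfolding m_def by (intro convexD) auto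
  have le: "exp ((m - u0) * x - b m) \<le>
      exp gap * ((1 - t) * exp ((u - u0) * x - b u) + t * exp ((v - u0) * x - b v))" for x
  proof -
    have "exp ((1 - t) *\<^sub>R ((u - u0) * x - b u) + t *\<^sub>R ((v - u0) * x - b v)) \<le>
        (1 - t) * exp ((u - u0) * x - b u) + t * exp ((v - u0) * x - b v)"
      using convex_onD[OF exp_convex, of t] t by simp
    moreover have "(m - u0) * x - b m =
        gap + ((1 - t) *\<^sub>R ((u - u0) * x - b u) + t *\<^sub>R ((v - u0) * x - b v))"
      by (simp add: gap_def m_def algebra_simps)
    ultimately show ?thesis by (simp only: exp_add) (simp add: mult_left_mono)
  qed
  have "1 = (\<integral>\<^sup>+x. ennreal (exp ((m - u0) * x - b m)) \<partial>Q)" using mass[OF m] by simp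
  also have "\<dots> \<le> (\<integral>\<^sup>+x. ennreal (exp gap) * (ennreal (1 - t) * ennreal (exp ((u - u0) * x - b u))
      + ennreal t * ennreal (exp ((v - u0) * x - b v))) \<partial>Q)"
    using le t by (intro nn_integral_mono)
      (simp add: ennreal_mult[symmetric] ennreal_plus[symmetric] del: ennreal_plus)
  also have "\<dots> = ennreal (exp gap) * (ennreal (1 - t) * 1 + ennreal t * 1)"
    using Q(2) mass[OF uv(1)] mass[OF uv(2)]
    by (simp add: nn_integral_cmult nn_integral_add cong: measurable_cong_sets)
  also have "\<dots> = ennreal (exp gap)"
    using t by (simp add: ennreal_plus[symmetric] del: ennreal_plus)
  finally have "1 \<le> exp gap" by simp
  then show "b ((1 - t) *\<^sub>R u + t *\<^sub>R v) \<le> (1 - t) * b u + t * b v"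
    by (simp add: gap_def m_def)
qed (rule I)

lemma convex_on_exp_comp:
  fixes f :: "real \<Rightarrow> real"
  assumes "convex_on I f"
  shows "convex_on I (\<lambda>u. exp (f u))"
proof (rule convex_onI)
  fix t x y :: real
  assume t: "0 < t" "t < 1" and xy: "x \<in> I" "y \<in> I"
  have "f ((1 - t) *\<^sub>R x + t *\<^sub>R y) \<le> (1 - t) *\<^sub>R f x + t *\<^sub>R f y"
    using convex_onD[OF assms, of t x y] t xy by simp
  then have "exp (f ((1 - t) *\<^sub>R x + t *\<^sub>R y)) \<le> exp ((1 - t) *\<^sub>R f x + t *\<^sub>R f y)" by simp
  also have "\<dots> \<le> (1 - t) * exp (f x) + t * exp (f y)"
    using convex_onD[OF exp_convex, of t "f x" "f y"] t by simp
  finally show "exp (f ((1 - t) *\<^sub>R x + t *\<^sub>R y)) \<le> (1 - t) * exp (f x) + t * exp (f y)" .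
qed (use assms in \<open>simp add: convex_on_def\<close>)

text \<open>The complement of the support is the union of the null sets in a countable base.\<close>

lemma AE_in_measure_support:
  fixes \<mu> :: "'a::second_countable_topology measure"
  assumes "sets \<mu> = sets borel"
  shows "AE x in \<mu>. x \<in> measure_support \<mu>" and "closed (measure_support \<mu>)"
proof -
  obtain \<B> :: "'a set set" where \<B>: "countable \<B>" "topological_basis \<B>"
    using ex_countable_basis by blast
  define N where "N = {B \<in> \<B>. emeasure \<mu> B = 0}"
  have open_B: "open B" if "B \<in> \<B>" for B using topological_basis_open[OF \<B>(2) that] .
  have eq: "- measure_support \<mu> = \<Union>N"
  proof (intro set_eqI iffI)
    fix x assume "x \<in> - measure_support \<mu>"
    then obtain U where U: "open U" "x \<in> U" "emeasure \<mu> U = 0"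
      by (auto simp: measure_support_def)
    obtain B where B: "B \<in> \<B>" "x \<in> B" "B \<subseteq> U"
      using topological_basisE[OF \<B>(2) U(1,2)] by blast
    have "emeasure \<mu> B \<le> emeasure \<mu> U"
      using B U(1) assms by (intro emeasure_mono) auto
    then have "B \<in> N" using U(3) B(1) by (simp add: N_def)
    then show "x \<in> \<Union>N" using B(2) by blast
  next
    fix x assume "x \<in> \<Union>N"
    then show "x \<in> - measure_support \<mu>" using open_B by (force simp: N_def measure_support_def)
  qed
  have "\<Union>N \<in> null_sets \<mu>"
    using \<B>(1) open_B assms unfolding N_def
    by (intro null_sets_UN'[of _ "\<lambda>B. B", simplified]) (auto intro!: null_setsI)
  then show "AE x in \<mu>. x \<in> measure_support \<mu>"
    by (intro AE_I'[of "\<Union>N"]) (auto simp: eq[symmetric])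
  have "open (\<Union>N)" using open_B by (auto simp: N_def)
  then show "closed (measure_support \<mu>)" by (simp add: closed_def eq)
qed

lemma convex_exp_domain: 
  assumes "sets \<nu> = sets borel"
  shows "convex (exp_domain \<nu>)"
proof (rule convexI)
  fix u v s t :: real
  assume uv: "u \<in> exp_domain \<nu>" "v \<in> exp_domain \<nu>" and st: "0 \<le> s" "0 \<le> t" "s + t = 1"
  have [measurable]: "(\<lambda>x. exp (c * x)) \<in> borel_measurable \<nu>" for c :: real
    using assms by (simp cong: measurable_cong_sets)
  have "(\<integral>\<^sup>+x. ennreal (exp ((s *\<^sub>R u + t *\<^sub>R v) * x)) \<partial>\<nu>) \<le>
      (\<integral>\<^sup>+x. ennreal s * ennreal (exp (u * x)) + ennreal t * ennreal (exp (v * x)) \<partial>\<nu>)"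
  proof (rule nn_integral_mono)
    fix x
    have s: "s = 1 - t" using st by simp
    have "exp (s *\<^sub>R (u * x) + t *\<^sub>R (v * x)) \<le> s * exp (u * x) + t * exp (v * x)"
      using convex_onD[OF exp_convex, of t "u * x" "v * x"] st s by simp
    then show "ennreal (exp ((s *\<^sub>R u + t *\<^sub>R v) * x))
        \<le> ennreal s * ennreal (exp (u * x)) + ennreal t * ennreal (exp (v * x))"
      using st by (simp add: ennreal_mult[symmetric] ennreal_plus[symmetric] algebra_simps
          del: ennreal_plus)
  qed
  also have "\<dots> = ennreal s * (\<integral>\<^sup>+x. ennreal (exp (u * x)) \<partial>\<nu>) + ennreal t * (\<integral>\<^sup>+x. ennreal (exp (v * x)) \<partial>\<nu>)"
    by (simp add: nn_integral_add nn_integral_cmult)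
  also have "\<dots> < \<infinity>"
    using uv by (simp add: exp_domain_def ennreal_mult_less_top)
  finally show "s *\<^sub>R u + t *\<^sub>R v \<in> exp_domain \<nu>" by (simp add: exp_domain_def)
qed

lemma log_partition_measurable:
  assumes "sigma_finite_measure \<nu>" "sets \<nu> = sets borel"
  shows "log_partition \<nu> \<in> borel_measurable borel"
proof -
  interpret sigma_finite_measure \<nu> by fact
  have "sets (borel \<Otimes>\<^sub>M \<nu>) = sets (borel \<Otimes>\<^sub>M borel)"
    using assms(2) by (intro sets_pair_measure_cong) auto
  then have "(\<lambda>(u, x). exp (u * x)) \<in> borel_measurable (borel \<Otimes>\<^sub>M \<nu> :: (real \<times> real) measure)"
    by (subst measurable_cong_sets[OF _ refl], assumption) measurable
  then have "(\<lambda>u. LINT x|\<nu>. exp (u * x)) \<in> borel_measurable borel"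
    by (intro borel_measurable_lebesgue_integral) simp
  then show ?thesis unfolding log_partition_def[abs_def] by measurable
qed

section \<open>The Bayesian model: Esscher laws and posteriors\<close>

locale esscher_bayes_model =
  fixes \<nu> \<mu> :: "real measure" and u0 :: real
    and P :: "real \<Rightarrow> 'a measure" and M :: "'a measure"
    and L :: "real \<Rightarrow> 'a \<Rightarrow> real" and \<Theta> :: "'a \<Rightarrow> real"
  assumes base_sigma_finite: "sigma_finite_measure \<nu>" and sets_base: "sets \<nu> = sets borel"
    and u0: "u0 \<in> interior (exp_domain \<nu>)"
    and space_P0: "space (P u0) = space M"
    and esscher: "\<And>u. u \<in> interior (exp_domain \<nu>) \<Longrightarrow> esscher_law \<nu> u0 (P u0) L u (P u)"
    and prior_prob: "prob_space \<mu>" and sets_prior: "sets \<mu> = sets borel"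
    and support: "measure_support \<mu> \<subseteq> interior (exp_domain \<nu>)"
    and bayes: "bayes_model \<mu> P L \<Theta> M"
begin

abbreviation "I \<equiv> interior (exp_domain \<nu>)"
abbreviation "S \<equiv> measure_support \<mu>"
abbreviation "B \<equiv> log_partition \<nu>"
abbreviation "F r \<equiv> natural_filtration (space M) L r"
abbreviation "base_law r \<equiv> restr_to_subalg (P u0) (F r)"

lemma open_I: "open I" by simp

lemma convex_I: "convex I"
  using convex_interior[OF convex_exp_domain[OF sets_base]] .

lemma B_measurable[measurable]: "B \<in> borel_measurable borel"
  using log_partition_measurable[OF base_sigma_finite sets_base] .

lemma AE_S: "AE u in \<mu>. u \<in> S" and closed_S: "closed S"
  using AE_in_measure_support[OF sets_prior] by auto

lemma S_borel[measurable]: "S \<in> sets borel"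
  using closed_S by simp

lemma S_nonempty: "S \<noteq> {}"
proof
  interpret prob_space \<mu> by (rule prior_prob)
  assume "S = {}"
  then show False using AE_S by simp
qed

lemma space_generated: "space (generated_algebra \<Omega> X J) = \<Omega>"
  unfolding generated_algebra_def by (rule space_measure_of) auto

lemma sets_generated:
  "sets (generated_algebra \<Omega> X J) = sigma_sets \<Omega> {X r -` A \<inter> \<Omega> | r A. r \<in> J \<and> A \<in> sets borel}"
  unfolding generated_algebra_def by (rule sets_measure_of) auto

lemma generated_measurable: "r \<in> J \<Longrightarrow> X r \<in> borel_measurable (generated_algebra \<Omega> X J)"
  by (rule measurableI) (auto simp: space_generated sets_generated)

lemma sets_generated_mono: "J \<subseteq> K \<Longrightarrow> sets (generated_algebra \<Omega> X J) \<subseteq> sets (generated_algebra \<Omega> X K)"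
  unfolding sets_generated by (intro sigma_sets_mono') auto

lemma L_F[measurable]: "0 \<le> r \<Longrightarrow> L r \<in> borel_measurable (F r)"
  by (rule generated_measurable) simp

lemma F_sub_generated: "sets (F r) \<subseteq> sets (generated_algebra (space M) L {0..})"
  by (rule sets_generated_mono) auto

lemma
  assumes "u \<in> I"
  shows prob_P: "prob_space (P u)" and space_P: "space (P u) = space M"
    and sub_P: "subalgebra (P u) (F r)"
    and restr_P: "0 \<le> r \<Longrightarrow> restr_to_subalg (P u) (F r) =
      density (base_law r) (\<lambda>\<omega>. ennreal (esscher_density \<nu> u0 r u (L r \<omega>)))"
proof -
  note e = esscher[OF assms, unfolded esscher_law_def space_P0]
  show "prob_space (P u)" "space (P u) = space M"
    using e by (auto simp: subalgebra_def space_generated)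
  show "subalgebra (P u) (F r)"
    using e F_sub_generated[of r] unfolding subalgebra_def space_generated by (metis order_trans)
  show "0 \<le> r \<Longrightarrow> restr_to_subalg (P u) (F r) =
      density (base_law r) (\<lambda>\<omega>. ennreal (esscher_density \<nu> u0 r u (L r \<omega>)))"
    using e by auto
qed

lemma sub_M: "subalgebra M (F r)"
proof -
  have L: "L q \<in> borel_measurable M" if "0 \<le> q" for q
    using bayes that by (simp add: bayes_model_def)
  have "{L q -` A \<inter> space M | q A. q \<in> {0..r} \<and> A \<in> sets borel} \<subseteq> sets M"
    using L by (auto intro: measurable_sets)
  then show ?thesis
    unfolding subalgebra_def sets_generated space_generated by (simp add: sets.sigma_sets_subset)
qed

lemma prob_M: "prob_space M"
  using bayes by (simp add: bayes_model_def)

lemma \<Theta>_measurable[measurable]: "\<Theta> \<in> borel_measurable M" and \<Theta>_law: "distr M borel \<Theta> = \<mu>"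
  using bayes by (auto simp: bayes_model_def)

lemma prob_base_law: "prob_space (base_law r)"
proof (rule prob_spaceI)
  have "space M \<in> sets (F r)" using sets.top[of "F r"] by (simp add: space_generated)
  then show "emeasure (base_law r) (space (base_law r)) = 1"
    using emeasure_restr_to_subalg[OF sub_P[OF u0]] prob_space.emeasure_space_1[OF prob_P[OF u0]]
    by (simp add: space_restr_to_subalg space_P0)
qed

lemma sets_base_law[simp]: "sets (base_law r) = sets (F r)"
  using sets_restr_to_subalg[OF sub_P[OF u0]] .

lemma space_base_law[simp]: "space (base_law r) = space M"
  by (simp add: space_restr_to_subalg space_P0)

lemma L_base_law[measurable]: "0 \<le> r \<Longrightarrow> L r \<in> borel_measurable (base_law r)"
  using L_F by (simp cong: measurable_cong_sets)

lemma emeasure_P: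
  assumes u: "u \<in> I" and C: "C \<in> sets (F r)" and r: "0 \<le> r"
  shows "emeasure (P u) C =
    (\<integral>\<^sup>+\<omega>. ennreal (esscher_density \<nu> u0 r u (L r \<omega>)) * indicator C \<omega> \<partial>base_law r)"
proof -
  have [measurable]: "L r \<in> borel_measurable (base_law r)" using r by (rule L_base_law)
  have "emeasure (P u) C = emeasure (restr_to_subalg (P u) (F r)) C"
    using emeasure_restr_to_subalg[OF sub_P[OF u] C] by simp
  also have "\<dots> = (\<integral>\<^sup>+\<omega>. ennreal (esscher_density \<nu> u0 r u (L r \<omega>)) * indicator C \<omega> \<partial>base_law r)"
    unfolding restr_P[OF u r] esscher_density_def using C by (intro emeasure_density) auto
  finally show ?thesis .
qed

lemma esscher_mass:
  assumes "u \<in> I" "0 \<le> r"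
  shows "(\<integral>\<^sup>+\<omega>. ennreal (esscher_density \<nu> u0 r u (L r \<omega>)) \<partial>base_law r) = 1"
proof -
  interpret prob_space "P u" using prob_P[OF assms(1)] .
  have "space M \<in> sets (F r)" using sets.top[of "F r"] by (simp add: space_generated)
  from emeasure_P[OF assms(1) this assms(2)]
  have "(\<integral>\<^sup>+\<omega>. ennreal (esscher_density \<nu> u0 r u (L r \<omega>)) * indicator (space M) \<omega> \<partial>base_law r) = 1"
    using emeasure_space_1 space_P[OF assms(1)] by simp
  moreover have "(\<integral>\<^sup>+\<omega>. ennreal (esscher_density \<nu> u0 r u (L r \<omega>)) \<partial>base_law r) =
      (\<integral>\<^sup>+\<omega>. ennreal (esscher_density \<nu> u0 r u (L r \<omega>)) * indicator (space M) \<omega> \<partial>base_law r)"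
    by (rule nn_integral_cong) (simp add: space_restr_to_subalg space_P0)
  ultimately show ?thesis by simp
qed

section \<open>Sufficiency and the posterior of the parameter\<close>

text \<open>The observation is the path up to time \<open>r\<close>, that is, a point of the underlying space with the
  \<open>\<sigma>\<close>-algebra \<open>F r\<close>.\<close>

lemma likelihood_mixture_path:
  assumes r: "0 \<le> r"
  shows "likelihood_mixture \<mu> (base_law r) (\<lambda>u \<omega>. esscher_density \<nu> u0 r u (L r \<omega>))"
proof -
  interpret prior: prob_space \<mu> by (rule prior_prob)
  interpret obs: prob_space "base_law r" by (rule prob_base_law)
  show ?thesis
  proof
    show "sets \<mu> = sets borel" by (rule sets_prior)
    have [measurable]: "L r \<in> borel_measurable (base_law r)" using r by (rule L_base_law)
    have [measurable]: "B \<in> borel_measurable \<mu>" "(\<lambda>u. u) \<in> borel_measurable \<mu>"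
      using B_measurable by (simp_all add: sets_prior cong: measurable_cong_sets)
    show "(\<lambda>(u, x). esscher_density \<nu> u0 r u (L r x)) \<in> borel_measurable (\<mu> \<Otimes>\<^sub>M base_law r)"
      unfolding esscher_density_def by measurable
    show "AE u in \<mu>. (\<integral>\<^sup>+x. ennreal (esscher_density \<nu> u0 r u (L r x)) \<partial>base_law r) = 1"
      using AE_S by eventually_elim (use support r in \<open>auto intro: esscher_mass\<close>)
  qed (simp add: esscher_density_def)
qed

text \<open>Bayes' formula for the posterior mean of \<open>f\<close>, as a function of the value of \<open>L r\<close>. It is stated
  with the density of the Esscher law instead of the posterior weight, so that it is a ratio of two
  instances of \<open>mix\<close>; a factor that depends on the value alone cancels in \<open>posterior_ratio_eq\<close>.\<close>

definition posterior_ratio :: "real \<Rightarrow> (real \<Rightarrow> real) \<Rightarrow> real \<Rightarrow> real" where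
  "posterior_ratio r f x = (LINT u|\<mu>. f u * esscher_density \<nu> u0 r u x) /
     (LINT u|\<mu>. 1 * esscher_density \<nu> u0 r u x)"

lemma posterior_ratio_measurable:
  assumes [measurable]: "f \<in> borel_measurable \<mu>"
  shows "posterior_ratio r f \<in> borel_measurable borel"
proof -
  interpret prior: prob_space \<mu> by (rule prior_prob)
  have [measurable]: "B \<in> borel_measurable \<mu>" "(\<lambda>u. u) \<in> borel_measurable \<mu>"
    using B_measurable by (simp_all add: sets_prior cong: measurable_cong_sets)
  show ?thesis unfolding posterior_ratio_def[abs_def] esscher_density_def by measurable
qed

text \<open>The defining property of the model on Borel sets of parameters, as an identity of measures, so that
  arbitrary functions of the parameter can be integrated over the event \<open>C\<close>.\<close>

lemma joint_law:
  assumes r: "0 \<le> r" and C: "C \<in> sets (F r)"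
  shows "distr (density M (\<lambda>\<omega>. ennreal (indicator C \<omega>))) borel \<Theta> = density \<mu> (\<lambda>u. ennreal (indicator S u *
    likelihood_mixture.power_of (base_law r) (\<lambda>u \<omega>. esscher_density \<nu> u0 r u (L r \<omega>)) C u))"
proof -
  interpret likelihood_mixture \<mu> "base_law r" "\<lambda>u \<omega>. esscher_density \<nu> u0 r u (L r \<omega>)"
    using r by (rule likelihood_mixture_path)
  have C': "C \<in> sets (base_law r)" using C by simp
  have CM: "C \<in> sets M" using C sub_M by (auto simp: subalgebra_def)
  have [measurable]: "power_of C \<in> borel_measurable \<mu>"
    using integrable_power_of[of "\<lambda>_. 1", OF _ C'] by (simp add: borel_measurable_integrable)
  have [measurable]: "S \<in> sets \<mu>" using sets_prior by simp
  show ?thesis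
  proof (rule measure_eqI)
    fix A assume "A \<in> sets (distr (density M (\<lambda>\<omega>. ennreal (indicator C \<omega>))) borel \<Theta>)"
    then have A[measurable]: "A \<in> sets borel" by simp
    have A\<mu>: "A \<in> sets \<mu>" using A sets_prior by simp
    have \<Theta>A: "\<Theta> -` A \<inter> space M \<in> sets M" using A by measurable
    have P: "emeasure (P u) C = ennreal (power_of C u)" if "u \<in> S" for u
    proof -
      have u: "u \<in> I" using that support by auto
      have i: "integrable (base_law r) (\<lambda>\<omega>. indicator C \<omega> * esscher_density \<nu> u0 r u (L r \<omega>))"
        using set_l_integrable[OF esscher_mass[OF u r] C'] .
      show ?thesis
        unfolding emeasure_P[OF u C r] power_of_def
        using nn_integral_eq_integral[OF i] by (simp add: esscher_density_def mult.commute
            ennreal_mult'[symmetric] ennreal_indicator[symmetric])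
    qed
    have "emeasure (distr (density M (\<lambda>\<omega>. ennreal (indicator C \<omega>))) borel \<Theta>) A =
        emeasure (density M (\<lambda>\<omega>. ennreal (indicator C \<omega>))) (\<Theta> -` A \<inter> space M)"
      using A by (subst emeasure_distr) auto
    also have "\<dots> = (\<integral>\<^sup>+\<omega>. indicator ((\<Theta> -` A \<inter> space M) \<inter> C) \<omega> \<partial>M)"
      using CM \<Theta>A
      by (subst emeasure_density, simp, simp, intro nn_integral_cong) (auto simp: indicator_def)
    also have "\<dots> = emeasure M ((\<Theta> -` A \<inter> space M) \<inter> C)"
      using CM \<Theta>A by (intro nn_integral_indicator) auto
    also have "\<dots> = (\<integral>\<^sup>+u\<in>A \<inter> S. emeasure (P u) C \<partial>\<mu>)"
      using bayes A subsetD[OF F_sub_generated C] unfolding bayes_model_def by blast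
    also have "\<dots> = (\<integral>\<^sup>+u. ennreal (indicator S u * power_of C u) * indicator A u \<partial>\<mu>)"
      using P by (intro nn_integral_cong) (auto simp: indicator_def)
    also have "\<dots> = emeasure (density \<mu> (\<lambda>u. ennreal (indicator S u * power_of C u))) A"
      using A\<mu> by (subst emeasure_density) auto
    finally show "emeasure (distr (density M (\<lambda>\<omega>. ennreal (indicator C \<omega>))) borel \<Theta>) A =
        emeasure (density \<mu> (\<lambda>u. ennreal (indicator S u * power_of C u))) A" .
  qed (simp add: sets_prior)
qed

text \<open>Restricted to \<open>F r\<close>, the joint law has density \<open>mix (\<lambda>_. 1)\<close> with respect to the base law; this
  factor cancels the denominator of \<open>posterior_ratio\<close>.\<close>

lemma
  assumes r: "0 \<le> r" and f: "integrable \<mu> f"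
  shows integrable_\<Theta>: "integrable M (\<lambda>\<omega>. f (\<Theta> \<omega>))"
    and integrable_posterior_ratio: "integrable M (\<lambda>\<omega>. posterior_ratio r f (L r \<omega>))"
    and posterior_ratio_averages: "C \<in> sets (F r) \<Longrightarrow>
      (LINT \<omega>:C|M. f (\<Theta> \<omega>)) = (LINT \<omega>:C|M. posterior_ratio r f (L r \<omega>))"
proof -
  interpret likelihood_mixture \<mu> "base_law r" "\<lambda>u \<omega>. esscher_density \<nu> u0 r u (L r \<omega>)"
    using r by (rule likelihood_mixture_path)
  have one: "integrable \<mu> (\<lambda>_. 1::real)" by simp
  have [measurable]: "S \<in> sets \<mu>" using sets_prior by simp
  have f_borel: "f \<in> borel_measurable borel"
    using borel_measurable_integrable[OF f] by (simp add: sets_prior cong: measurable_cong_sets)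
  show "integrable M (\<lambda>\<omega>. f (\<Theta> \<omega>))"
    using f f_borel unfolding \<Theta>_law[symmetric] by (subst (asm) integrable_distr_eq) auto
  have joint: "(LINT \<omega>|M. indicator C \<omega> * g (\<Theta> \<omega>)) = (LINT \<omega>|base_law r. indicator C \<omega> * mix g \<omega>)"
    if C: "C \<in> sets (F r)" and g: "integrable \<mu> g" for C g
  proof -
    have C': "C \<in> sets (base_law r)" using C by simp
    have CM: "C \<in> sets M" using C sub_M by (auto simp: subalgebra_def)
    have [measurable]: "power_of C \<in> borel_measurable \<mu>"
      using integrable_power_of[of "\<lambda>_. 1", OF _ C'] by (simp add: borel_measurable_integrable)
    have gb[measurable]: "g \<in> borel_measurable borel"
      using borel_measurable_integrable[OF g] by (simp add: sets_prior cong: measurable_cong_sets)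
    have [measurable]: "g \<in> borel_measurable \<mu>" using g by simp
    have "(LINT \<omega>|M. indicator C \<omega> * g (\<Theta> \<omega>)) =
        (LINT \<omega>|density M (\<lambda>\<omega>. ennreal (indicator C \<omega>)). g (\<Theta> \<omega>))"
      using CM by (subst integral_density) auto
    also have "\<dots> = (LINT u|distr (density M (\<lambda>\<omega>. ennreal (indicator C \<omega>))) borel \<Theta>. g u)"
      by (subst integral_distr) auto
    also have "\<dots> = (LINT u|\<mu>. indicator S u * power_of C u * g u)"
      unfolding joint_law[OF r C] using power_of_nonneg
      by (subst integral_density) auto
    also have "\<dots> = (LINT u|\<mu>. g u * power_of C u)"
      using AE_S by (intro integral_cong_AE) (auto elim: eventually_mono)
    also have "\<dots> = (LINT \<omega>|base_law r. indicator C \<omega> * mix g \<omega>)"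
      using integral_mix_set[OF g C'] by simp
    finally show ?thesis .
  qed
  have m1[measurable]: "mix (\<lambda>_. 1) \<in> borel_measurable (base_law r)" by (rule mix_measurable[OF one])
  have mf[measurable]: "mix f \<in> borel_measurable (base_law r)" by (rule mix_measurable[OF f])
  have restr_M: "restr_to_subalg M (F r) = density (base_law r) (\<lambda>\<omega>. ennreal (mix (\<lambda>_. 1) \<omega>))"
  proof (rule measure_eqI)
    interpret M: prob_space M by (rule prob_M)
    show "sets (restr_to_subalg M (F r)) = sets (density (base_law r) (\<lambda>\<omega>. ennreal (mix (\<lambda>_. 1) \<omega>)))"
      by (simp add: sets_restr_to_subalg[OF sub_M])
    fix C assume "C \<in> sets (restr_to_subalg M (F r))"
    then have C: "C \<in> sets (F r)" by (simp add: sets_restr_to_subalg[OF sub_M])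
    have CM: "C \<in> sets M" using C sub_M by (auto simp: subalgebra_def)
    have pos: "AE \<omega> in base_law r. 0 \<le> indicator C \<omega> * mix (\<lambda>_. 1) \<omega>"
      using AE_mix_one_pos by eventually_elim (simp add: indicator_def)
    have "integrable (base_law r) (\<lambda>\<omega>. indicator C \<omega> * mix (\<lambda>_. 1) \<omega>)"
      using integrable_mult_indicator[OF _ mix_integrable[OF one], of C] C by simp
    from nn_integral_eq_integral[OF this pos] joint[OF C one]
    have "ennreal (M.prob C) = (\<integral>\<^sup>+\<omega>. ennreal (indicator C \<omega> * mix (\<lambda>_. 1) \<omega>) \<partial>base_law r)"
      using CM sets.sets_into_space[OF CM] by (simp add: Int_absorb2)
    also have "\<dots> = emeasure (density (base_law r) (\<lambda>\<omega>. ennreal (mix (\<lambda>_. 1) \<omega>))) C"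
      using C by (subst emeasure_density) (auto intro!: nn_integral_cong simp: indicator_def)
    finally show "emeasure (restr_to_subalg M (F r)) C =
        emeasure (density (base_law r) (\<lambda>\<omega>. ennreal (mix (\<lambda>_. 1) \<omega>))) C"
      using emeasure_restr_to_subalg[OF sub_M C] by (simp add: M.emeasure_eq_measure)
  qed
  have ratio: "posterior_ratio r f (L r \<omega>) = mix f \<omega> / mix (\<lambda>_. 1) \<omega>" for \<omega>
    by (simp add: posterior_ratio_def mix_def)
  have ratio_F: "(\<lambda>\<omega>. posterior_ratio r f (L r \<omega>)) \<in> borel_measurable (F r)"
    using posterior_ratio_measurable[of f r] f L_F[OF r] by (auto intro: measurable_compose)
  have ratio_base[measurable]: "(\<lambda>\<omega>. posterior_ratio r f (L r \<omega>)) \<in> borel_measurable (base_law r)"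
    using ratio_F by (simp cong: measurable_cong_sets)
  have cancel: "AE \<omega> in base_law r. mix (\<lambda>_. 1) \<omega> * posterior_ratio r f (L r \<omega>) = mix f \<omega>"
    using AE_mix_one_pos by eventually_elim (simp add: ratio)
  have pos: "AE \<omega> in base_law r. 0 \<le> mix (\<lambda>_. 1) \<omega>"
    using AE_mix_one_pos by eventually_elim simp
  have "integrable (restr_to_subalg M (F r)) (\<lambda>\<omega>. posterior_ratio r f (L r \<omega>))"
    unfolding restr_M
    by (subst integrable_density, measurable, rule pos, simp, subst integrable_cong_AE[OF _ _ cancel])
      (use mix_integrable[OF f] in auto)
  then show "integrable M (\<lambda>\<omega>. posterior_ratio r f (L r \<omega>))"
    by (rule integrable_from_subalg[OF sub_M])
  assume C: "C \<in> sets (F r)"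
  have C': "C \<in> sets (base_law r)" using C by simp
  note [measurable] = C C'
  have "(LINT \<omega>:C|M. posterior_ratio r f (L r \<omega>)) =
      (LINT \<omega>|restr_to_subalg M (F r). indicator C \<omega> * posterior_ratio r f (L r \<omega>))"
    unfolding set_lebesgue_integral_def real_scaleR_def
    by (rule integral_subalgebra2[OF sub_M, symmetric]) (intro borel_measurable_times ratio_F, measurable)
  also have "\<dots> = (LINT \<omega>|base_law r. mix (\<lambda>_. 1) \<omega> * (indicator C \<omega> * posterior_ratio r f (L r \<omega>)))"
    unfolding restr_M by (subst integral_density) (use pos in simp_all)
  also have "\<dots> = (LINT \<omega>|base_law r. indicator C \<omega> * mix f \<omega>)"
    using cancel by (intro integral_cong_AE) (auto elim!: eventually_mono simp: indicator_def)
  also have "\<dots> = (LINT \<omega>:C|M. f (\<Theta> \<omega>))"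
    using joint[OF C f] by (simp add: set_lebesgue_integral_def)
  finally show "(LINT \<omega>:C|M. f (\<Theta> \<omega>)) = (LINT \<omega>:C|M. posterior_ratio r f (L r \<omega>))" by simp
qed

abbreviation "stat_algebra r \<equiv> vimage_algebra (space M) (L r) borel"

lemma sub_stat: "0 \<le> r \<Longrightarrow> subalgebra (F r) (stat_algebra r)"
  using measurable_sets[OF L_F]
  by (auto simp: subalgebra_def space_generated sets_vimage_algebra2)

lemma L_stat: "L r \<in> borel_measurable (stat_algebra r)"
  by (rule measurable_vimage_algebra1) simp

lemma subalgebra_trans: "subalgebra A G \<Longrightarrow> subalgebra G H \<Longrightarrow> subalgebra A H"
  by (auto simp: subalgebra_def)

text \<open>The ratio depends on the path through \<open>L r\<close>, so it is the conditional expectation for every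
  \<open>\<sigma>\<close>-algebra between those generated by \<open>L r\<close> and by the path. Taking both extremes gives Bayesian
  sufficiency.\<close>

lemma cond_exp_posterior_ratio:
  assumes r: "0 \<le> r" and f: "integrable \<mu> f"
    and G: "subalgebra (F r) G" and L: "L r \<in> borel_measurable G"
  shows "AE \<omega> in M. real_cond_exp M G (\<lambda>\<omega>. f (\<Theta> \<omega>)) \<omega> = posterior_ratio r f (L r \<omega>)"
proof -
  interpret M: prob_space M by (rule prob_M)
  interpret finite_measure_subalgebra M G
    using subalgebra_trans[OF sub_M G] by unfold_locales
  show ?thesis
  proof (rule real_cond_exp_charact)
    show "(\<lambda>\<omega>. posterior_ratio r f (L r \<omega>)) \<in> borel_measurable G"
      using posterior_ratio_measurable[of f r] f L by (auto intro: measurable_compose)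
  qed (use r f G integrable_\<Theta> integrable_posterior_ratio posterior_ratio_averages in
      \<open>auto simp: subalgebra_def\<close>)
qed

lemma esscher_density_posterior_weight:
  "esscher_density \<nu> u0 r u x = exp (r * B u0 - u0 * x) * posterior_weight \<nu> r x u"
  by (simp add: esscher_density_def posterior_weight_def exp_add[symmetric] algebra_simps)

abbreviation "weight r y u \<equiv> posterior_weight \<nu> r y u"
abbreviation "normaliser r y \<equiv> (LINT u:S|\<mu>. weight r y u)"

lemma weight_measurable[measurable]: "posterior_weight \<nu> r y \<in> borel_measurable \<mu>"
  unfolding posterior_weight_def[abs_def] using B_measurable
  by (simp add: sets_prior cong: measurable_cong_sets)

lemma normaliser_eq: "normaliser r y = (LINT u|\<mu>. weight r y u)"
  unfolding set_lebesgue_integral_def using AE_S sets_prior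
  by (intro integral_cong_AE) (auto elim!: eventually_mono)

lemma normaliser_nonneg: "0 \<le> normaliser r y"
  unfolding normaliser_eq by (intro integral_nonneg_AE) (simp add: posterior_weight_def)

lemma integral_posterior:
  assumes "f \<in> borel_measurable \<mu>"
  shows "(LINT u|posterior \<nu> \<mu> r y. f u) = (LINT u|\<mu>. indicator S u * f u * weight r y u) / normaliser r y"
proof -
  have [measurable]: "S \<in> sets \<mu>" using sets_prior by simp
  have nn: "0 \<le> indicat_real S u * weight r y u / normaliser r y" for u
    using normaliser_nonneg by (simp add: posterior_weight_def)
  have "(LINT u|posterior \<nu> \<mu> r y. f u) =
      (LINT u|\<mu>. (indicat_real S u * weight r y u / normaliser r y) * f u)"
    unfolding posterior_def using assms nn by (subst integral_density) auto
  also have "\<dots> = (LINT u|\<mu>. indicator S u * f u * weight r y u / normaliser r y)"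
    by (simp add: mult_ac)
  finally show ?thesis by simp
qed

lemma posterior_ratio_eq:
  assumes f: "f \<in> borel_measurable \<mu>"
  shows "posterior_ratio r f x = (LINT u|posterior \<nu> \<mu> r x. f u)"
proof -
  let ?k = "exp (r * B u0 - u0 * x)"
  have [measurable]: "S \<in> sets \<mu>" using sets_prior by simp
  have "posterior_ratio r f x =
      (LINT u|\<mu>. ?k * (f u * weight r x u)) / (LINT u|\<mu>. ?k * weight r x u)"
    unfolding posterior_ratio_def esscher_density_posterior_weight by (simp add: mult.left_commute)
  also have "\<dots> = (LINT u|\<mu>. f u * weight r x u) / normaliser r x"
    unfolding normaliser_eq by simp
  also have "(LINT u|\<mu>. f u * weight r x u) = (LINT u|\<mu>. indicator S u * f u * weight r x u)"
    using AE_S f by (intro integral_cong_AE) (auto elim!: eventually_mono)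
  finally show ?thesis using integral_posterior[OF f] by simp
qed

lemma bayes_sufficient:
  assumes r: "0 \<le> r"
  shows "bayes_sufficient_statistic M (F r) \<Theta> (L r)"
  unfolding bayes_sufficient_statistic_def
proof (intro conjI ballI)
  show "L r \<in> borel_measurable (F r)" using r by (rule L_F)
  fix A :: "real set" assume A: "A \<in> sets borel"
  interpret prior: prob_space \<mu> by (rule prior_prob)
  have f: "integrable \<mu> (indicat_real A)"
    using A sets_prior by (intro integrable_real_indicator) (auto simp: less_top[symmetric])
  have "subalgebra (F r) (F r)" by (simp add: subalgebra_def)
  from cond_exp_posterior_ratio[OF r f this L_F[OF r]] cond_exp_posterior_ratio[OF r f sub_stat[OF r] L_stat]
  show "AE \<omega> in M. real_cond_exp M (F r) (\<lambda>\<omega>. indicat_real A (\<Theta> \<omega>)) \<omega> =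
      real_cond_exp M (vimage_algebra (space (F r)) (L r) borel) (\<lambda>\<omega>. indicat_real A (\<Theta> \<omega>)) \<omega>"
    unfolding space_generated by eventually_elim simp
qed

lemma posterior_cond_prob:
  assumes r: "0 \<le> r" and A: "A \<in> sets borel"
  shows "AE \<omega> in M. real_cond_exp M (F r) (\<lambda>\<omega>. indicat_real A (\<Theta> \<omega>)) \<omega> =
    measure (posterior \<nu> \<mu> r (L r \<omega>)) A"
proof -
  interpret prior: prob_space \<mu> by (rule prior_prob)
  have f: "integrable \<mu> (indicat_real A)"
    using A sets_prior by (intro integrable_real_indicator) (auto simp: less_top[symmetric])
  have "subalgebra (F r) (F r)" by (simp add: subalgebra_def)
  from cond_exp_posterior_ratio[OF r f this L_F[OF r]] show ?thesis
  proof eventually_elim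
    case (elim \<omega>)
    have "space (posterior \<nu> \<mu> r (L r \<omega>)) = UNIV"
      using sets_eq_imp_space_eq[OF sets_prior] by (simp add: posterior_def)
    then show ?case using posterior_ratio_eq[of "indicat_real A"] f elim by simp
  qed
qed

lemma posterior_cond_mean:
  assumes r: "0 \<le> r" and T: "set_integrable \<mu> S T"
  shows "AE \<omega> in M. real_cond_exp M (F r) (\<lambda>\<omega>. indicat_real S (\<Theta> \<omega>) * T (\<Theta> \<omega>)) \<omega> =
    posterior_mean \<nu> \<mu> T r (L r \<omega>)"
proof -
  have f: "integrable \<mu> (\<lambda>u. indicat_real S u * T u)" using T by (simp add: set_integrable_def)
  have "subalgebra (F r) (F r)" by (simp add: subalgebra_def)
  from cond_exp_posterior_ratio[OF r f this L_F[OF r]] show ?thesis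
    using f by (simp add: posterior_ratio_eq posterior_mean_def set_lebesgue_integral_def)
qed

text \<open>Fisher-Neyman factorisation: the density of \<open>P u\<close> with respect to \<open>P u0\<close> on \<open>F r\<close> is a function
  of \<open>L r\<close>, so a conditional probability given \<open>L r\<close> under \<open>P u0\<close> is one under every \<open>P u\<close>.\<close>

lemma sufficient:
  assumes r: "0 \<le> r"
  shows "sufficient_statistic (F r) P S (L r)"
  unfolding sufficient_statistic_def space_generated
proof (intro conjI ballI)
  show "L r \<in> borel_measurable (F r)" using r by (rule L_F)
  fix C assume C: "C \<in> sets (F r)"
  define k where "k = real_cond_exp (P u0) (stat_algebra r) (indicat_real C)"
  have k: "k \<in> borel_measurable (stat_algebra r)" unfolding k_def by (rule borel_measurable_cond_exp)
  interpret P0: prob_space "P u0" using prob_P[OF u0] .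
  interpret P0: finite_measure_subalgebra "P u0" "stat_algebra r"
    using subalgebra_trans[OF sub_P[OF u0] sub_stat[OF r]] by unfold_locales
  show "\<exists>k\<in>borel_measurable (stat_algebra r). \<forall>u\<in>S. AE \<omega> in P u.
      real_cond_exp (P u) (stat_algebra r) (indicat_real C) \<omega> = k \<omega>"
  proof (intro bexI[OF _ k] ballI)
    fix u assume "u \<in> S"
    then have u: "u \<in> I" using support by auto
    interpret Pu: prob_space "P u" using prob_P[OF u] .
    interpret Pu: finite_measure_subalgebra "P u" "stat_algebra r"
      using subalgebra_trans[OF sub_P[OF u] sub_stat[OF r]] by unfold_locales
    let ?l = "\<lambda>\<omega>. esscher_density \<nu> u0 r u (L r \<omega>)"
    have l_stat: "?l \<in> borel_measurable (stat_algebra r)"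
      unfolding esscher_density_def using L_stat[of r] by measurable
    have l_base: "?l \<in> borel_measurable (base_law r)"
      using measurable_from_subalg[OF sub_stat[OF r] l_stat] by (simp cong: measurable_cong_sets)
    have change: "(LINT \<omega>|P u. g \<omega>) = (LINT \<omega>|P u0. ?l \<omega> * g \<omega>)"
        "integrable (P u0) (\<lambda>\<omega>. ?l \<omega> * g \<omega>) \<Longrightarrow> integrable (P u) g"
      if g: "g \<in> borel_measurable (F r)" for g
    proof -
      have g': "g \<in> borel_measurable (base_law r)" using g by (simp cong: measurable_cong_sets)
      have lg: "(\<lambda>\<omega>. ?l \<omega> * g \<omega>) \<in> borel_measurable (F r)"
        using measurable_from_subalg[OF sub_stat[OF r] l_stat] g by simp
      have "(LINT \<omega>|P u. g \<omega>) = (LINT \<omega>|restr_to_subalg (P u) (F r). g \<omega>)"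
        by (rule integral_subalgebra2[OF sub_P[OF u] g, symmetric])
      also have "\<dots> = (LINT \<omega>|base_law r. ?l \<omega> * g \<omega>)"
        unfolding restr_P[OF u r] using l_base g'
        by (subst integral_density) (auto simp: esscher_density_def)
      also have "\<dots> = (LINT \<omega>|P u0. ?l \<omega> * g \<omega>)"
        by (rule integral_subalgebra2[OF sub_P[OF u0] lg])
      finally show "(LINT \<omega>|P u. g \<omega>) = (LINT \<omega>|P u0. ?l \<omega> * g \<omega>)" .
      assume "integrable (P u0) (\<lambda>\<omega>. ?l \<omega> * g \<omega>)"
      then have "integrable (base_law r) (\<lambda>\<omega>. ?l \<omega> * g \<omega>)"
        by (rule integrable_in_subalg[OF sub_P[OF u0] lg])
      then have "integrable (restr_to_subalg (P u) (F r)) g"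
        unfolding restr_P[OF u r] using l_base g'
        by (subst integrable_density) (auto simp: esscher_density_def)
      then show "integrable (P u) g" by (rule integrable_from_subalg[OF sub_P[OF u]])
    qed
    have "integrable (base_law r) ?l"
      using esscher_mass[OF u r] l_base
      by (intro integrableI_nonneg) (auto simp: esscher_density_def)
    then have l_int: "integrable (P u0) ?l" by (rule integrable_from_subalg[OF sub_P[OF u0]])
    have C0: "C \<in> sets (P u0)" and Cu: "C \<in> sets (P u)"
      using C sub_P[OF u0, of r] sub_P[OF u, of r] by (auto simp: subalgebra_def)
    have k_F: "k \<in> borel_measurable (F r)" using measurable_from_subalg[OF sub_stat[OF r] k] .
    show "AE \<omega> in P u. real_cond_exp (P u) (stat_algebra r) (indicat_real C) \<omega> = k \<omega>"
    proof (rule Pu.real_cond_exp_charact)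
      show "integrable (P u) (indicat_real C)"
        using Cu by (intro integrable_real_indicator) (auto simp: less_top[symmetric])
      show "k \<in> borel_measurable (stat_algebra r)" by (rule k)
      have "integrable (P u0) (\<lambda>\<omega>. ?l \<omega> * indicat_real C \<omega>)"
        using integrable_mult_indicator[OF C0 l_int] by (simp add: mult.commute)
      then have "integrable (P u0) (\<lambda>\<omega>. ?l \<omega> * k \<omega>)"
        unfolding k_def using l_stat C0 by (intro P0.real_cond_exp_intg) auto
      then show "integrable (P u) k" by (rule change(2)[OF k_F])
    next
      fix A assume A: "A \<in> sets (stat_algebra r)"
      have AF: "A \<in> sets (F r)" using A sub_stat[OF r] by (auto simp: subalgebra_def)
      have A0: "A \<in> sets (P u0)" using AF sub_P[OF u0, of r] by (auto simp: subalgebra_def)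
      have "(LINT \<omega>:A|P u. indicat_real C \<omega>) =
          (LINT \<omega>|P u0. (?l \<omega> * indicat_real A \<omega>) * indicat_real C \<omega>)"
        using AF C by (simp add: set_lebesgue_integral_def change(1) mult.assoc)
      also have "\<dots> = (LINT \<omega>|P u0. (?l \<omega> * indicat_real A \<omega>) * k \<omega>)"
        unfolding k_def
      proof (rule P0.real_cond_exp_intg(2)[symmetric])
        have "integrable (P u0) (\<lambda>\<omega>. indicator (A \<inter> C) \<omega> *\<^sub>R ?l \<omega>)"
          using A0 C0 l_int by (intro integrable_mult_indicator) auto
        then show "integrable (P u0) (\<lambda>\<omega>. (?l \<omega> * indicat_real A \<omega>) * indicat_real C \<omega>)"
          by (simp add: indicator_inter_arith mult_ac)
        show "(\<lambda>\<omega>. ?l \<omega> * indicat_real A \<omega>) \<in> borel_measurable (stat_algebra r)"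
          using l_stat A by simp
      qed (use C0 in simp)
      also have "\<dots> = (LINT \<omega>:A|P u. k \<omega>)"
        using AF k_F by (simp add: set_lebesgue_integral_def change(1) mult.assoc)
      finally show "(LINT \<omega>:A|P u. indicat_real C \<omega>) = (LINT \<omega>:A|P u. k \<omega>)" .
    qed
  qed
qed

end

section \<open>The law of an increment and the convexity of the log-partition function\<close>

context esscher_bayes_model
begin

abbreviation "obs_law h \<equiv> distr (P u0) borel (L h)"
abbreviation "lik h u x \<equiv> exp ((u - u0) * x - h * (B u - B u0))"

lemma L_P: "u \<in> I \<Longrightarrow> 0 \<le> h \<Longrightarrow> L h \<in> borel_measurable (P u)"
  using measurable_from_subalg[OF sub_P L_F] by blast

lemma emeasure_obs:
  assumes u: "u \<in> I" and h: "0 \<le> h" and A[measurable]: "A \<in> sets borel"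
  shows "emeasure (distr (P u) borel (L h)) A = (\<integral>\<^sup>+x. ennreal (lik h u x) * indicator A x \<partial>obs_law h)"
proof -
  have [measurable]: "L h \<in> borel_measurable (F h)" using h by (rule L_F)
  have [measurable]: "L h \<in> borel_measurable (P u0)" using u0 h by (rule L_P)
  have C: "L h -` A \<inter> space M \<in> sets (F h)"
    using measurable_sets[OF L_F[OF h] A] by (simp add: space_generated)
  have "emeasure (distr (P u) borel (L h)) A = emeasure (P u) (L h -` A \<inter> space M)"
    using L_P[OF u h] A by (simp add: emeasure_distr space_P[OF u])
  also have "\<dots> = (\<integral>\<^sup>+\<omega>. ennreal (lik h u (L h \<omega>)) * indicator (L h -` A \<inter> space M) \<omega> \<partial>base_law h)"
    using emeasure_P[OF u C h] by (simp add: esscher_density_def)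
  also have "\<dots> = (\<integral>\<^sup>+\<omega>. ennreal (lik h u (L h \<omega>)) * indicator A (L h \<omega>) \<partial>base_law h)"
    by (rule nn_integral_cong) (auto simp: indicator_def)
  also have "\<dots> = (\<integral>\<^sup>+\<omega>. ennreal (lik h u (L h \<omega>)) * indicator A (L h \<omega>) \<partial>P u0)"
    by (rule nn_integral_subalgebra2[OF sub_P[OF u0]]) measurable
  also have "\<dots> = (\<integral>\<^sup>+x. ennreal (lik h u x) * indicator A x \<partial>obs_law h)"
    by (subst nn_integral_distr) auto
  finally show ?thesis .
qed

lemma prob_obs_law: "0 \<le> h \<Longrightarrow> prob_space (obs_law h)"
  using prob_space.prob_space_distr[OF prob_P[OF u0] L_P[OF u0]] .

lemma obs_mass:
  assumes "u \<in> I" "0 \<le> h"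
  shows "(\<integral>\<^sup>+x. ennreal (lik h u x) \<partial>obs_law h) = 1"
proof -
  interpret prob_space "distr (P u) borel (L h)"
    using prob_space.prob_space_distr[OF prob_P[OF assms(1)] L_P[OF assms]] .
  show ?thesis using emeasure_obs[OF assms, of UNIV] emeasure_space_1 by simp
qed

lemma B_convex: "convex_on I B"
proof -
  have "convex_on I (\<lambda>u. 1 * (B u - B u0))"
    by (rule log_laplace_convex[OF convex_I, of "obs_law 1" u0])
      (use prob_obs_law[of 1] obs_mass[of _ 1] in auto)
  then have "convex_on I (\<lambda>u. 1 * (B u - B u0) + B u0)"
    using convex_I by (intro convex_on_add) (simp_all add: convex_on_const)
  then show ?thesis by simp
qed

lemma tilt_convex:
  assumes "0 \<le> c"
  shows "convex_on I (\<lambda>u. exp (u * d + c * B u))"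
proof (rule convex_on_exp_comp, rule convex_on_add)
  show "convex_on I (\<lambda>u. u * d)"
    using convex_I by (simp add: convex_on_def algebra_simps)
  show "convex_on I (\<lambda>u. c * B u)" using assms B_convex by (rule convex_on_cmul)
qed

end

section \<open>The posterior family\<close>

locale monotone_bayes_model = esscher_bayes_model +
  fixes T :: "real \<Rightarrow> real"
  assumes T_mono: "mono_on (measure_support \<mu>) T"
    and T_set_integrable: "set_integrable \<mu> (measure_support \<mu>) T"
    and T_not_const: "\<not> (\<exists>c. AE u in \<mu>. u \<in> measure_support \<mu> \<longrightarrow> T u = c)"
begin

text \<open>The estimand, extended by zero outside the support so that it is Borel on the whole line.\<close>

definition TS :: "real \<Rightarrow> real" where
  "TS u = indicat_real S u * T u"

text \<open>The integrability that defines \<open>regular_domain\<close>, at a single point instead of a neighbourhood.\<close>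

definition admissible :: "real \<Rightarrow> real \<Rightarrow> bool" where
  "admissible r y \<longleftrightarrow> (\<integral>\<^sup>+u\<in>S. ennreal ((1 + \<bar>T u\<bar>) * (1 + u\<^sup>2 + \<bar>B u\<bar>) * weight r y u) \<partial>\<mu>) < \<infinity>"

abbreviation "post r y \<equiv> posterior \<nu> \<mu> r y"

lemma TS_measurable[measurable]: "TS \<in> borel_measurable borel"
  using borel_measurable_integrable[OF T_set_integrable[unfolded set_integrable_def]] sets_prior
  by (simp add: TS_def[abs_def] cong: measurable_cong_sets)

lemma TS_eq: "u \<in> S \<Longrightarrow> TS u = T u"
  by (simp add: TS_def)

lemma weight_pos: "0 < weight r y u"
  by (simp add: posterior_weight_def)

lemma borel_\<mu>: "f \<in> borel_measurable borel \<Longrightarrow> f \<in> borel_measurable \<mu>"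
  by (simp add: sets_prior cong: measurable_cong_sets)

lemma regular_admissible:
  assumes "y \<in> regular_states \<nu> \<mu> T r"
  shows "admissible r y"
  using assms interior_of_subset unfolding regular_states_def regular_domain_def admissible_def
  by fastforce

lemma admissible_integrable:
  assumes adm: "admissible r y" and g: "g \<in> borel_measurable borel"
    and bound: "\<And>u. u \<in> S \<Longrightarrow> \<bar>g u\<bar> \<le> (1 + \<bar>T u\<bar>) * (1 + u\<^sup>2 + \<bar>B u\<bar>)"
  shows "integrable \<mu> (\<lambda>u. g u * weight r y u)"
proof (rule integrableI_bounded)
  show "(\<lambda>u. g u * weight r y u) \<in> borel_measurable \<mu>"
    using borel_\<mu>[OF g] by measurable
  have "(\<integral>\<^sup>+u. ennreal (norm (g u * weight r y u)) \<partial>\<mu>) \<le>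
      (\<integral>\<^sup>+u\<in>S. ennreal ((1 + \<bar>T u\<bar>) * (1 + u\<^sup>2 + \<bar>B u\<bar>) * weight r y u) \<partial>\<mu>)"
  proof (rule nn_integral_mono_AE)
    show "AE u in \<mu>. ennreal (norm (g u * weight r y u)) \<le>
        ennreal ((1 + \<bar>T u\<bar>) * (1 + u\<^sup>2 + \<bar>B u\<bar>) * weight r y u) * indicator S u"
      using AE_S
    proof eventually_elim
      case (elim u)
      have "\<bar>g u\<bar> * weight r y u \<le> (1 + \<bar>T u\<bar>) * (1 + u\<^sup>2 + \<bar>B u\<bar>) * weight r y u"
        using bound[OF elim] weight_pos[of r y u] by (intro mult_right_mono) auto
      then show ?case
        using elim weight_pos[of r y u] by (simp add: abs_mult ennreal_leI)
    qed
  qed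
  also have "\<dots> < \<infinity>" using adm by (simp add: admissible_def)
  finally show "(\<integral>\<^sup>+u. ennreal (norm (g u * weight r y u)) \<partial>\<mu>) < \<infinity>" .
qed

lemma admissible_moments:
  assumes "admissible r y"
  shows "integrable \<mu> (\<lambda>u. 1 * weight r y u)" "integrable \<mu> (\<lambda>u. TS u * weight r y u)"
    "integrable \<mu> (\<lambda>u. u * weight r y u)" "integrable \<mu> (\<lambda>u. (TS u * u) * weight r y u)"
proof -
  have u: "\<bar>u\<bar> \<le> 1 + u\<^sup>2" for u :: real
  proof -
    have "0 \<le> (\<bar>u\<bar> - 1)\<^sup>2" by simp
    then show ?thesis by (simp add: power2_eq_square algebra_simps)
  qed
  have 1: "a * b \<le> (1 + \<bar>T u\<bar>) * (1 + u\<^sup>2 + \<bar>B u\<bar>)"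
    if "0 \<le> a" "0 \<le> b" "a \<le> 1 + \<bar>T u\<bar>" "b \<le> 1 + u\<^sup>2" for a b u
    using that by (intro mult_mono) auto
  show "integrable \<mu> (\<lambda>u. 1 * weight r y u)"
    using 1[of 1 1] by (intro admissible_integrable[OF assms]) auto
  show "integrable \<mu> (\<lambda>u. TS u * weight r y u)"
    using 1[of "\<bar>T u\<bar>" 1 u for u] by (intro admissible_integrable[OF assms]) (auto simp: TS_eq)
  show "integrable \<mu> (\<lambda>u. u * weight r y u)"
    using 1[of 1 "\<bar>u\<bar>" u for u] u by (intro admissible_integrable[OF assms]) auto
  show "integrable \<mu> (\<lambda>u. (TS u * u) * weight r y u)"
    using 1[of "\<bar>T u\<bar>" "\<bar>u\<bar>" u for u] u
    by (intro admissible_integrable[OF assms]) (auto simp: TS_eq abs_mult)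
qed

lemma normaliser_pos:
  assumes "admissible r y"
  shows "0 < normaliser r y"
proof -
  interpret prior: prob_space \<mu> by (rule prior_prob)
  have int: "integrable \<mu> (\<lambda>u. weight r y u)" using admissible_moments(1)[OF assms] by simp
  have "(LINT u|\<mu>. weight r y u) \<noteq> 0"
    using integral_nonneg_eq_0_iff_AE[OF int] weight_pos[of r y]
    by (auto simp: less_imp_le less_imp_neq[symmetric] prior.AE_False)
  then show ?thesis using normaliser_nonneg[of r y] unfolding normaliser_eq by simp
qed

lemma sets_post[simp]: "sets (post r y) = sets borel"
  by (simp add: posterior_def sets_prior)

lemma borel_post: "f \<in> borel_measurable borel \<Longrightarrow> f \<in> borel_measurable (post r y)"
  by (simp cong: measurable_cong_sets)

lemma post_density_measurable[measurable]:
  "(\<lambda>u. indicat_real S u * weight r y u / normaliser r y) \<in> borel_measurable \<mu>"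
proof -
  have [measurable]: "S \<in> sets \<mu>" using sets_prior by simp
  show ?thesis by measurable
qed

lemma integrable_post:
  assumes g: "g \<in> borel_measurable borel" and int: "integrable \<mu> (\<lambda>u. g u * weight r y u)"
  shows "integrable (post r y) g"
proof -
  have [measurable]: "S \<in> sets \<mu>" using sets_prior by simp
  have "integrable \<mu> (\<lambda>u. indicator S u *\<^sub>R (g u * weight r y u))"
    using int by (intro integrable_mult_indicator) auto
  then have "integrable \<mu> (\<lambda>u. (indicator S u *\<^sub>R (g u * weight r y u)) / normaliser r y)"
    by simp
  moreover have "(\<lambda>u. (indicator S u *\<^sub>R (g u * weight r y u)) / normaliser r y) =
      (\<lambda>u. (indicat_real S u * weight r y u / normaliser r y) * g u)"
    by (auto simp: mult_ac)
  ultimately show ?thesis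
    unfolding posterior_def
    using borel_\<mu>[OF g] normaliser_nonneg[of r y] weight_pos[of r y]
    by (subst integrable_density) (auto simp: less_imp_le)
qed

lemma prob_post:
  assumes "admissible r y"
  shows "prob_space (post r y)"
proof (rule prob_spaceI)
  have [measurable]: "S \<in> sets \<mu>" using sets_prior by simp
  let ?d = "\<lambda>u. indicat_real S u * weight r y u / normaliser r y"
  have pos: "AE u in \<mu>. 0 \<le> ?d u"
    using normaliser_nonneg[of r y] weight_pos[of r y] by (auto simp: less_imp_le)
  have int: "integrable \<mu> (\<lambda>u. indicator S u *\<^sub>R weight r y u)"
    using admissible_moments(1)[OF assms] by (intro integrable_mult_indicator) auto
  then have int_d: "integrable \<mu> ?d" by simp
  have "emeasure (post r y) (space (post r y)) = (\<integral>\<^sup>+u. ennreal (?d u) \<partial>\<mu>)"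
    unfolding posterior_def by (subst emeasure_density) (auto intro!: nn_integral_cong)
  also have "\<dots> = ennreal (LINT u|\<mu>. ?d u)"
    using nn_integral_eq_integral[OF int_d pos] .
  also have "(LINT u|\<mu>. ?d u) = normaliser r y / normaliser r y"
    by (simp add: set_lebesgue_integral_def)
  finally show "emeasure (post r y) (space (post r y)) = 1"
    using normaliser_pos[OF assms] by simp
qed

lemma AE_post_S: "AE u in post r y. u \<in> S"
  using AE_S unfolding posterior_def by (subst AE_density) auto

lemma AE_postD:
  assumes adm: "admissible r y" and ae: "AE u in post r y. Q u"
  shows "AE u in \<mu>. Q u"
proof -
  from ae have "AE u in \<mu>. 0 < ennreal (indicat_real S u * weight r y u / normaliser r y) \<longrightarrow> Q u"
    unfolding posterior_def by (subst (asm) AE_density) auto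
  with AE_S show ?thesis
    by eventually_elim (use normaliser_pos[OF adm] weight_pos[of r y] in simp)
qed

lemma posterior_mean_eq: "posterior_mean \<nu> \<mu> T r y = (LINT u|post r y. TS u)"
  by (simp add: posterior_mean_def set_lebesgue_integral_def TS_def)

lemma TS_not_const_post:
  assumes "admissible r y"
  shows "\<not> (\<exists>c. AE u in post r y. TS u = c)"
proof
  assume "\<exists>c. AE u in post r y. TS u = c"
  then obtain c where "AE u in \<mu>. TS u = c" using AE_postD[OF assms] by blast
  then have "AE u in \<mu>. u \<in> S \<longrightarrow> T u = c" by eventually_elim (auto simp: TS_eq)
  then show False using T_not_const by blast
qed

lemma TS_mono: "mono_on S TS"
  using T_mono by (simp add: mono_on_def TS_eq)

lemma post_moments:
  assumes "admissible r y"
  shows "integrable (post r y) TS" "integrable (post r y) (\<lambda>u. u)"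
    "integrable (post r y) (\<lambda>u. TS u * u)"
  using admissible_moments[OF assms] by (auto intro!: integrable_post)

text \<open>The density of \<open>post r' y'\<close> with respect to \<open>post r y\<close>. For \<open>r' \<le> r\<close> it is convex in \<open>u\<close>, because
  \<open>B\<close> is convex.\<close>

definition tilt :: "real \<Rightarrow> real \<Rightarrow> real \<Rightarrow> real \<Rightarrow> real \<Rightarrow> real" where
  "tilt r y r' y' u = normaliser r y / normaliser r' y' * exp (u * (y' - y) + (r - r') * B u)"

lemma tilt_measurable[measurable]: "tilt r y r' y' \<in> borel_measurable borel"
  unfolding tilt_def[abs_def] by measurable

lemma tilt_nonneg: "0 \<le> tilt r y r' y' u"
  using normaliser_nonneg by (simp add: tilt_def)

lemma weight_tilt:
  assumes "admissible r y" "admissible r' y'"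
  shows "weight r y u / normaliser r y * tilt r y r' y' u = weight r' y' u / normaliser r' y'"
proof -
  have "weight r y u * exp (u * (y' - y) + (r - r') * B u) = weight r' y' u"
    by (simp add: posterior_weight_def exp_add[symmetric] algebra_simps)
  then show ?thesis
    using normaliser_pos[OF assms(1)] by (simp add: tilt_def field_simps)
qed

lemma post_tilt:
  assumes "admissible r y" "admissible r' y'"
  shows "post r' y' = density (post r y) (\<lambda>u. ennreal (tilt r y r' y' u))"
proof -
  have [measurable]: "tilt r y r' y' \<in> borel_measurable \<mu>" by (rule borel_\<mu>) measurable
  have "density (post r y) (\<lambda>u. ennreal (tilt r y r' y' u)) =
      density \<mu> (\<lambda>u. ennreal (indicat_real S u * weight r y u / normaliser r y) * ennreal (tilt r y r' y' u))"
    unfolding posterior_def by (rule density_density_eq) measurable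
  also have "\<dots> = post r' y'"
    unfolding posterior_def
  proof (rule arg_cong[where f = "density \<mu>"], rule ext)
    fix u
    have "ennreal (indicat_real S u * weight r y u / normaliser r y) * ennreal (tilt r y r' y' u) =
        ennreal (indicat_real S u * (weight r y u / normaliser r y * tilt r y r' y' u))"
      using normaliser_nonneg[of r y] weight_pos[of r y u] tilt_nonneg
      by (subst ennreal_mult[symmetric]) (auto simp: less_imp_le mult_ac)
    then show "ennreal (indicat_real S u * weight r y u / normaliser r y) * ennreal (tilt r y r' y' u)
        = ennreal (indicat_real S u * weight r' y' u / normaliser r' y')"
      unfolding weight_tilt[OF assms] by simp
  qed
  finally show ?thesis ..
qed

lemma integral_post_tilt:
  assumes "admissible r y" "admissible r' y'" and f: "f \<in> borel_measurable borel"
  shows "(LINT u|post r' y'. f u) = (LINT u|post r y. tilt r y r' y' u * f u)"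
    and "integrable (post r' y') f \<longleftrightarrow> integrable (post r y) (\<lambda>u. tilt r y r' y' u * f u)"
  unfolding post_tilt[OF assms(1,2)] using borel_post[OF f] borel_post[OF tilt_measurable] tilt_nonneg
  by (auto simp: integral_density integrable_density)

text \<open>Increasing \<open>y\<close> tilts the posterior by a strictly increasing density, which has positive
  covariance with \<open>TS\<close>.\<close>

lemma posterior_mean_strict_mono:
  assumes adm: "admissible r y" "admissible r y'" and "y < y'"
  shows "posterior_mean \<nu> \<mu> T r y < posterior_mean \<nu> \<mu> T r y'"
proof -
  interpret post: prob_space "post r y" using prob_post[OF adm(1)] .
  interpret post': prob_space "post r y'" using prob_post[OF adm(2)] .
  let ?v = "tilt r y r y'"
  have "integrable (post r y') (\<lambda>u. 1::real)" by simp
  then have v: "integrable (post r y) ?v"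
    using integral_post_tilt(2)[OF adm, of "\<lambda>u. 1"] by simp
  have Tv: "integrable (post r y) (\<lambda>u. TS u * ?v u)"
    using integral_post_tilt(2)[OF adm, of TS] post_moments(1)[OF adm(2)] by (simp add: mult.commute)
  have "strict_mono_on S ?v"
    using normaliser_pos[OF adm(1)] normaliser_pos[OF adm(2)] \<open>y < y'\<close>
    by (intro strict_mono_onI) (simp add: tilt_def divide_strict_right_mono)
  then have "(LINT u|post r y. TS u) * (LINT u|post r y. ?v u) < (LINT u|post r y. TS u * ?v u)"
    using strict_chebyshev[OF post.prob_space_axioms AE_post_S TS_mono _ post_moments(1)[OF adm(1)] v Tv
        TS_not_const_post[OF adm(1)]] by simp
  moreover have "(LINT u|post r y. ?v u) = 1"
    using integral_post_tilt(1)[OF adm, of "\<lambda>u. 1"] by (simp add: post'.prob_space)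
  moreover have "(LINT u|post r y. TS u * ?v u) = (LINT u|post r y'. TS u)"
    using integral_post_tilt(1)[OF adm, of TS] by (simp add: mult.commute)
  ultimately show ?thesis by (simp add: posterior_mean_eq)
qed

lemma state_of_mean:
  assumes "z \<in> regular_means \<nu> \<mu> T r"
  shows "admissible r (state_of_mean \<nu> \<mu> T r z)"
    and "posterior_mean \<nu> \<mu> T r (state_of_mean \<nu> \<mu> T r z) = z"
proof -
  obtain y where y: "y \<in> regular_states \<nu> \<mu> T r" "posterior_mean \<nu> \<mu> T r y = z"
    using assms by (auto simp: regular_means_def)
  have "state_of_mean \<nu> \<mu> T r z \<in> regular_states \<nu> \<mu> T r \<and>
      posterior_mean \<nu> \<mu> T r (state_of_mean \<nu> \<mu> T r z) = z"
    unfolding state_of_mean_def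
  proof (rule theI)
    show "y \<in> regular_states \<nu> \<mu> T r \<and> posterior_mean \<nu> \<mu> T r y = z" using y by simp
    fix x assume "x \<in> regular_states \<nu> \<mu> T r \<and> posterior_mean \<nu> \<mu> T r x = z"
    then show "x = y"
      using y posterior_mean_strict_mono[of r x y] posterior_mean_strict_mono[of r y x]
        regular_admissible by (cases x y rule: linorder_cases) auto
  qed
  then show "admissible r (state_of_mean \<nu> \<mu> T r z)"
    and "posterior_mean \<nu> \<mu> T r (state_of_mean \<nu> \<mu> T r z) = z"
    using regular_admissible by auto
qed

lemma monotone_estimation_post:
  assumes adm: "admissible r y" and h: "0 \<le> h"
  shows "monotone_estimation (post r y) (obs_law h) u0 (\<lambda>u. h * (B u - B u0)) S TS"
proof -
  interpret prior: prob_space "post r y" using prob_post[OF adm] .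
  interpret obs: prob_space "obs_law h" using prob_obs_law[OF h] .
  have mass: "(\<integral>\<^sup>+x. ennreal (lik h u x) \<partial>obs_law h) = 1" if "u \<in> S" for u
    using that support h by (auto intro: obs_mass)
  show ?thesis
  proof
    show "sets (post r y) = sets borel" by simp
    have [measurable]: "B \<in> borel_measurable (post r y)" "(\<lambda>u. u) \<in> borel_measurable (post r y)"
      by (rule borel_post, measurable)+
    show "(\<lambda>(u, x). lik h u x) \<in> borel_measurable (post r y \<Otimes>\<^sub>M obs_law h)" by measurable
    show "AE u in post r y. (\<integral>\<^sup>+x. ennreal (lik h u x) \<partial>obs_law h) = 1"
      using AE_post_S by eventually_elim (rule mass)
  qed (use mass AE_post_S TS_mono TS_not_const_post[OF adm] post_moments[OF adm] in auto)
qed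

section \<open>The transition kernel as a law of estimates\<close>

definition estimates :: "real \<Rightarrow> real \<Rightarrow> real \<Rightarrow> real measure" where
  "estimates r y h = likelihood_mixture.estimate_law (post r y) (obs_law h) (lik h) TS"

lemma
  assumes adm: "admissible r y" and h: "0 \<le> h"
  shows prob_estimates: "prob_space (estimates r y h)"
    and sets_estimates: "sets (estimates r y h) = sets borel"
    and integrable_estimates: "integrable (estimates r y h) (\<lambda>w. w)"
    and mean_estimates: "(LINT w|estimates r y h. w) = posterior_mean \<nu> \<mu> T r y"
proof -
  interpret E: monotone_estimation "post r y" "obs_law h" u0 "\<lambda>u. h * (B u - B u0)" S TS
    using adm h by (rule monotone_estimation_post)
  show "prob_space (estimates r y h)" "sets (estimates r y h) = sets borel"
    "integrable (estimates r y h) (\<lambda>w. w)"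
    "(LINT w|estimates r y h. w) = posterior_mean \<nu> \<mu> T r y"
    unfolding estimates_def posterior_mean_eq
    using E.prob_space_estimate_law[OF E.T_integrable] E.sets_estimate_law[OF E.T_integrable]
      E.mean_estimate_law[OF E.T_integrable] by auto
qed

text \<open>Weights \<open>1\<close> and \<open>0\<close> at an earlier time give the order of the kernels in time; two states at the
  same time give convexity in the state. As \<open>r1\<close> and \<open>r2\<close> are at most \<open>r\<close>,
  the mixture on the right has a convex density with respect to \<open>post r y\<close>.\<close>

lemma estimates_convex_le:
  assumes h: "0 \<le> h"
    and adm: "admissible r y" "admissible r1 y1" "admissible r2 y2" and r: "r1 \<le> r" "r2 \<le> r"
    and st: "0 \<le> s" "0 \<le> t" "s + t = 1"
    and mean: "posterior_mean \<nu> \<mu> T r y =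
      s * posterior_mean \<nu> \<mu> T r1 y1 + t * posterior_mean \<nu> \<mu> T r2 y2"
    and f: "convex_on UNIV f" "integrable (estimates r y h) f"
      "integrable (estimates r1 y1 h) f" "integrable (estimates r2 y2 h) f"
  shows "(LINT w|estimates r y h. f w) \<le>
    s * (LINT w|estimates r1 y1 h. f w) + t * (LINT w|estimates r2 y2 h. f w)"
proof (rule stop_loss_imp_convex_le[OF
      prob_estimates[OF adm(1) h] sets_estimates[OF adm(1) h] integrable_estimates[OF adm(1) h]
      prob_estimates[OF adm(2) h] sets_estimates[OF adm(2) h] integrable_estimates[OF adm(2) h]
      prob_estimates[OF adm(3) h] sets_estimates[OF adm(3) h] integrable_estimates[OF adm(3) h]
      st(3) _ _ f])
  show "(LINT w|estimates r y h. w) = s * (LINT w|estimates r1 y1 h. w) + t * (LINT w|estimates r2 y2 h. w)"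
    using mean by (simp add: mean_estimates adm h)
  fix a
  let ?l = "lik h"
  interpret E: monotone_estimation "post r y" "obs_law h" u0 "\<lambda>u. h * (B u - B u0)" S TS
    using adm(1) h by (rule monotone_estimation_post)
  have tilted: "(LINT w|estimates r' y' h. max 0 (w - a)) =
      (LINT x|obs_law h. max 0 (E.mix (\<lambda>u. tilt r y r' y' u * TS u) x - a * E.mix (tilt r y r' y') x))"
    "integrable (post r y) (tilt r y r' y')" "integrable (post r y) (\<lambda>u. tilt r y r' y' u * TS u)"
    "(LINT u|post r y. tilt r y r' y' u) = 1"
    "(LINT u|post r y. tilt r y r' y' u * TS u) = posterior_mean \<nu> \<mu> T r' y'"
    if adm': "admissible r' y'" for r' y'
  proof -
    interpret E': monotone_estimation "post r' y'" "obs_law h" u0 "\<lambda>u. h * (B u - B u0)" S TS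
      using adm' h by (rule monotone_estimation_post)
    have mix: "E'.mix g x = E.mix (\<lambda>u. tilt r y r' y' u * g u) x" if "g \<in> borel_measurable borel" for g x
      unfolding E.mix_def E'.mix_def using that integral_post_tilt(1)[OF adm(1) adm', of "\<lambda>u. g u * ?l u x"]
      by (simp add: mult.assoc)
    show "(LINT w|estimates r' y' h. max 0 (w - a)) =
      (LINT x|obs_law h. max 0 (E.mix (\<lambda>u. tilt r y r' y' u * TS u) x - a * E.mix (tilt r y r' y') x))"
      unfolding estimates_def E'.stop_loss_estimate_law[OF E'.T_integrable] by (simp add: mix)
    have "integrable (post r' y') (\<lambda>u. 1::real)" by simp
    then show "integrable (post r y) (tilt r y r' y')"
      using integral_post_tilt(2)[OF adm(1) adm', of "\<lambda>u. 1"] by simp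
    show "integrable (post r y) (\<lambda>u. tilt r y r' y' u * TS u)"
      using integral_post_tilt(2)[OF adm(1) adm', of TS] E'.T_integrable by simp
    show "(LINT u|post r y. tilt r y r' y' u) = 1"
      using integral_post_tilt(1)[OF adm(1) adm', of "\<lambda>u. 1"] by (simp add: E'.prior.prob_space)
    show "(LINT u|post r y. tilt r y r' y' u * TS u) = posterior_mean \<nu> \<mu> T r' y'"
      using integral_post_tilt(1)[OF adm(1) adm', of TS] by (simp add: posterior_mean_eq)
  qed
  have convex: "convex_on I (\<lambda>u. s * tilt r y r1 y1 u + t * tilt r y r2 y2 u)"
    unfolding tilt_def using r st normaliser_nonneg
    by (intro convex_on_add convex_on_cmul tilt_convex) auto
  have "(LINT w|estimates r y h. max 0 (w - a)) =
      (LINT x|obs_law h. max 0 (E.mix TS x - a * E.mix (\<lambda>_. 1) x))"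
    unfolding estimates_def by (rule E.stop_loss_estimate_law[OF E.T_integrable])
  also have "\<dots> \<le> s * (LINT x|obs_law h. max 0 (E.mix (\<lambda>u. tilt r y r1 y1 u * TS u) x - a * E.mix (tilt r y r1 y1) x))
      + t * (LINT x|obs_law h. max 0 (E.mix (\<lambda>u. tilt r y r2 y2 u * TS u) x - a * E.mix (tilt r y r2 y2) x))"
    by (rule E.stop_loss_le_mixture[OF open_I convex_I support convex st(1,2)])
      (use tilted(2-)[OF adm(2)] tilted(2-)[OF adm(3)] st(3) mean in \<open>auto simp: posterior_mean_eq\<close>)
  finally show "(LINT w|estimates r y h. max 0 (w - a)) \<le>
      s * (LINT w|estimates r1 y1 h. max 0 (w - a)) + t * (LINT w|estimates r2 y2 h. max 0 (w - a))"
    using tilted(1)[OF adm(2)] tilted(1)[OF adm(3)] by simp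
qed

lemma predictive_law_eq:
  assumes y: "state_of_mean \<nu> \<mu> T r z = y" and adm: "admissible r y" and h: "0 \<le> h"
  shows "predictive_law P L \<nu> \<mu> T r h z =
    density (obs_law h) (likelihood_mixture.evidence (post r y) (lik h))"
proof -
  interpret E: monotone_estimation "post r y" "obs_law h" u0 "\<lambda>u. h * (B u - B u0)" S TS
    using adm h by (rule monotone_estimation_post)
  have [measurable]: "S \<in> sets (post r y)" by simp
  have [measurable]: "B \<in> borel_measurable (post r y)" "(\<lambda>u. u) \<in> borel_measurable (post r y)"
    by (rule borel_post, measurable)+
  have space: "space (restrict_space (post r y) S) = S"
    using sets_eq_imp_space_eq[OF sets_post] by (simp add: space_restrict_space)
  have law: "emeasure (distr (P u) borel (L h)) A = (\<integral>\<^sup>+x. ennreal (lik h u x) * indicator A x \<partial>obs_law h)"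
    if "u \<in> S" "A \<in> sets borel" for u A
    using that support h by (auto intro: emeasure_obs)
  have joint: "(\<lambda>(u, x). ennreal (lik h u x) * indicator A x) \<in> borel_measurable (post r y \<Otimes>\<^sub>M obs_law h)"
    if [measurable]: "A \<in> sets borel" for A by measurable
  have kernel: "(\<lambda>u. distr (P u) borel (L h)) \<in> measurable (restrict_space (post r y) S) (subprob_algebra borel)"
  proof (rule measurable_subprob_algebra)
    fix u assume "u \<in> space (restrict_space (post r y) S)"
    then have "u \<in> I" using space support by auto
    then show "subprob_space (distr (P u) borel (L h))"
      using h by (intro prob_space_imp_subprob_space prob_space.prob_space_distr prob_P L_P)
  next
    fix A :: "real set" assume A: "A \<in> sets borel"
    have "(\<lambda>u. \<integral>\<^sup>+x. ennreal (lik h u x) * indicator A x \<partial>obs_law h) \<in> borel_measurable (post r y)"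
      using E.obs.borel_measurable_nn_integral[OF joint[OF A]] .
    then show "(\<lambda>u. emeasure (distr (P u) borel (L h)) A) \<in> borel_measurable (restrict_space (post r y) S)"
      by (subst measurable_cong[where g = "\<lambda>u. \<integral>\<^sup>+x. ennreal (lik h u x) * indicator A x \<partial>obs_law h"])
        (auto simp: space law A intro: measurable_restrict_space1)
  qed simp
  show ?thesis
  proof (rule measure_eqI)
    show "sets (predictive_law P L \<nu> \<mu> T r h z) = sets (density (obs_law h) (E.evidence))"
      unfolding predictive_law_def posterior_of_mean_def y
      using sets_bind[of "restrict_space (post r y) S" "\<lambda>u. distr (P u) borel (L h)" borel]
        S_nonempty by (simp add: space)
    fix A assume "A \<in> sets (predictive_law P L \<nu> \<mu> T r h z)"
    then have A[measurable]: "A \<in> sets borel"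
      unfolding predictive_law_def posterior_of_mean_def y
      using sets_bind[of "restrict_space (post r y) S" "\<lambda>u. distr (P u) borel (L h)" borel]
        S_nonempty by (simp add: space)
    have ev[measurable]: "E.evidence \<in> borel_measurable (obs_law h)"
      unfolding E.evidence_def[abs_def] by measurable
    have "emeasure (predictive_law P L \<nu> \<mu> T r h z) A =
        (\<integral>\<^sup>+u. emeasure (distr (P u) borel (L h)) A \<partial>restrict_space (post r y) S)"
      unfolding predictive_law_def posterior_of_mean_def y
      using S_nonempty kernel A by (intro emeasure_bind) (auto simp: space)
    also have "\<dots> = (\<integral>\<^sup>+u. emeasure (distr (P u) borel (L h)) A * indicator S u \<partial>post r y)"
      by (rule nn_integral_restrict_space) simp
    also have "\<dots> = (\<integral>\<^sup>+u. (\<integral>\<^sup>+x. ennreal (lik h u x) * indicator A x \<partial>obs_law h) \<partial>post r y)"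
      using AE_post_S[of r y] by (intro nn_integral_cong_AE) (auto elim!: eventually_mono simp: law A)
    also have "\<dots> = (\<integral>\<^sup>+x. (\<integral>\<^sup>+u. ennreal (lik h u x) * indicator A x \<partial>post r y) \<partial>obs_law h)"
      using E.pair.Fubini'[OF joint[OF A]] by simp
    also have "\<dots> = (\<integral>\<^sup>+x. E.evidence x * indicator A x \<partial>obs_law h)"
      unfolding E.evidence_def by (intro nn_integral_cong nn_integral_multc) measurable
    also have "\<dots> = emeasure (density (obs_law h) E.evidence) A"
      using A by (subst emeasure_density) auto
    finally show "emeasure (predictive_law P L \<nu> \<mu> T r h z) A =
        emeasure (density (obs_law h) E.evidence) A" .
  qed
qed

text \<open>The exceptional set in the definition of \<open>updated_mean\<close> is null for the observation law, and so is
  the set on which the predictive density differs from \<open>mix (\<lambda>_. 1)\<close>.\<close>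

lemma transition_kernel_eq:
  assumes y: "state_of_mean \<nu> \<mu> T r z = y" and adm: "admissible r y" and h: "0 \<le> h"
  shows "transition_kernel P L \<nu> u0 \<mu> T r h z = estimates r y h"
proof -
  interpret E: monotone_estimation "post r y" "obs_law h" u0 "\<lambda>u. h * (B u - B u0)" S TS
    using adm h by (rule monotone_estimation_post)
  have [measurable]: "S \<in> sets (post r y)" by simp
  have [measurable]: "B \<in> borel_measurable (post r y)" "(\<lambda>u. u) \<in> borel_measurable (post r y)"
      "TS \<in> borel_measurable (post r y)"
    by (rule borel_post, measurable)+
  define abs_ev where "abs_ev x = (\<integral>\<^sup>+u. ennreal (\<bar>TS u\<bar> * lik h u x) \<partial>post r y)" for x
  have [measurable]: "E.evidence \<in> borel_measurable (obs_law h)" "abs_ev \<in> borel_measurable (obs_law h)"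
    unfolding E.evidence_def[abs_def] abs_ev_def[abs_def] by measurable
  have m1[measurable]: "E.mix (\<lambda>_. 1) \<in> borel_measurable (obs_law h)" by (rule E.mix_measurable) simp
  have mT[measurable]: "E.mix TS \<in> borel_measurable (obs_law h)" by (rule E.mix_measurable[OF E.T_integrable])
  have upd: "updated_mean \<nu> u0 \<mu> T r h z =
      (\<lambda>x. if 0 < E.evidence x \<and> E.evidence x < \<infinity> \<and> abs_ev x < \<infinity>
        then E.mix TS x / E.mix (\<lambda>_. 1) x else z)"
  proof
    fix x
    have 1: "(\<integral>\<^sup>+u\<in>S. ennreal (lik h u x) \<partial>post r y) = E.evidence x"
      unfolding E.evidence_def using AE_post_S[of r y]
      by (intro nn_integral_cong_AE) (auto elim!: eventually_mono)
    have 2: "(\<integral>\<^sup>+u\<in>S. ennreal (\<bar>T u\<bar> * lik h u x) \<partial>post r y) = abs_ev x"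
      unfolding abs_ev_def by (intro nn_integral_cong) (simp add: TS_def indicator_def)
    have 3: "(LINT u:S|post r y. T u * lik h u x) = E.mix TS x"
      unfolding E.mix_def set_lebesgue_integral_def by (simp add: TS_def mult.assoc)
    have 4: "(LINT u:S|post r y. lik h u x) = E.mix (\<lambda>_. 1) x"
      unfolding E.mix_def set_lebesgue_integral_def using AE_post_S[of r y]
      by (intro integral_cong_AE) (auto elim!: eventually_mono)
    show "updated_mean \<nu> u0 \<mu> T r h z x =
        (if 0 < E.evidence x \<and> E.evidence x < \<infinity> \<and> abs_ev x < \<infinity>
          then E.mix TS x / E.mix (\<lambda>_. 1) x else z)"
      unfolding updated_mean_def posterior_of_mean_def y Let_def esscher_density_def 1 2 3 4 ..
  qed
  have AE_eq: "AE x in obs_law h. updated_mean \<nu> u0 \<mu> T r h z x = E.mix TS x / E.mix (\<lambda>_. 1) x"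
    using E.AE_evidence E.AE_mix_one_pos E.mix_AE_integrable[OF E.T_integrable]
  proof eventually_elim
    case (elim x)
    have "abs_ev x < \<infinity>"
      using elim(3) unfolding integrable_iff_bounded abs_ev_def by (simp add: abs_mult)
    then show ?case using elim(1,2) unfolding upd by simp
  qed
  have upd_meas: "updated_mean \<nu> u0 \<mu> T r h z \<in> borel_measurable (obs_law h)"
    unfolding upd by measurable
  have dens: "density (obs_law h) E.evidence = density (obs_law h) (\<lambda>x. ennreal (E.mix (\<lambda>_. 1) x))"
    using E.AE_evidence by (intro density_cong) auto
  show ?thesis
    unfolding transition_kernel_def predictive_law_eq[OF y adm h] dens estimates_def E.estimate_law_def
  proof (rule distr_cong_AE)
    show "AE x in density (obs_law h) (\<lambda>x. ennreal (E.mix (\<lambda>_. 1) x)).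
        updated_mean \<nu> u0 \<mu> T r h z x = E.mix TS x / E.mix (\<lambda>_. 1) x"
      using AE_eq by (subst AE_density) auto
  qed (use upd_meas in auto)
qed

end

section \<open>Posterior, order of the kernels and convexity in the state\<close>

theorem proposition4p1:
  fixes \<nu> \<mu> :: "real measure" and u0 :: real
    and P :: "real \<Rightarrow> 'a measure" and M :: "'a measure"
    and L :: "real \<Rightarrow> 'a \<Rightarrow> real" and \<Theta> :: "'a \<Rightarrow> real" and T :: "real \<Rightarrow> real"
  assumes "sigma_finite_measure \<nu>" and "sets \<nu> = sets borel"
    and "u0 \<in> interior (exp_domain \<nu>)"
    and "nondegenerate (exp_family \<nu> u0)" and "infinitely_divisible (exp_family \<nu> u0)"
    and "space (P u0) = space M"
    and "levy_process (P u0) L" and "distr (P u0) borel (L 1) = exp_family \<nu> u0"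
    and "\<And>u. u \<in> interior (exp_domain \<nu>) \<Longrightarrow> esscher_law \<nu> u0 (P u0) L u (P u)"
    and "prob_space \<mu>" and "sets \<mu> = sets borel"
    and "measure_support \<mu> \<subseteq> interior (exp_domain \<nu>)"
    and "bayes_model \<mu> P L \<Theta> M"
    and "mono_on (measure_support \<mu>) T"
    and "set_integrable \<mu> (measure_support \<mu>) T"
    and "\<not> (\<exists>c. AE u in \<mu>. u \<in> measure_support \<mu> \<longrightarrow> T u = c)"
  shows "(\<forall>r\<ge>0.
      sufficient_statistic (natural_filtration (space M) L r) P (measure_support \<mu>) (L r) \<and>
      bayes_sufficient_statistic M (natural_filtration (space M) L r) \<Theta> (L r) \<and>
      (\<forall>A\<in>sets borel. A \<subseteq> measure_support \<mu> \<longrightarrow>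
        (AE \<omega> in M. real_cond_exp M (natural_filtration (space M) L r)
            (\<lambda>\<omega>. indicat_real A (\<Theta> \<omega>)) \<omega> = measure (posterior \<nu> \<mu> r (L r \<omega>)) A)) \<and>
      (AE \<omega> in M. real_cond_exp M (natural_filtration (space M) L r)
          (\<lambda>\<omega>. indicat_real (measure_support \<mu>) (\<Theta> \<omega>) * T (\<Theta> \<omega>)) \<omega>
          = posterior_mean \<nu> \<mu> T r (L r \<omega>)))
    \<and>
    (\<forall>t s h J. 0 \<le> t \<and> t < s \<and> 0 < h \<and>
      J \<noteq> {} \<and> open J \<and> is_interval J \<and> J \<subseteq> (\<Inter>r\<in>{t..s}. regular_means \<nu> \<mu> T r) \<and>
      (\<forall>a b. a \<le> b \<and> {a..b} \<subseteq> J \<longrightarrow>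
        compact (closure {(r, state_of_mean \<nu> \<mu> T r z) | r z. r \<in> {t..s} \<and> z \<in> {a..b}}) \<and>
        closure {(r, state_of_mean \<nu> \<mu> T r z) | r z. r \<in> {t..s} \<and> z \<in> {a..b}}
          \<subseteq> regular_domain \<nu> \<mu> T)
      \<longrightarrow>
      (\<forall>z\<in>J.
        convex_order_le (transition_kernel P L \<nu> u0 \<mu> T s h z)
          (transition_kernel P L \<nu> u0 \<mu> T t h z) \<and>
        (\<forall>f. convex_on UNIV f \<and>
            integrable (transition_kernel P L \<nu> u0 \<mu> T s h z) f \<and>
            integrable (transition_kernel P L \<nu> u0 \<mu> T t h z) f \<longrightarrow>
          transition_operator P L \<nu> u0 \<mu> T s h f z \<le> transition_operator P L \<nu> u0 \<mu> T t h f z)) \<and>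
      (\<forall>r\<in>{t..s}. \<forall>f. convex_on UNIV f \<and>
          (\<forall>z\<in>J. (\<integral>\<^sup>+w. ennreal \<bar>f w\<bar> \<partial>transition_kernel P L \<nu> u0 \<mu> T r h z) < \<infinity>) \<longrightarrow>
        convex_on J (transition_operator P L \<nu> u0 \<mu> T r h f)))"
proof -
  interpret monotone_bayes_model \<nu> \<mu> u0 P M L \<Theta> T
    by (intro monotone_bayes_model.intro esscher_bayes_model.intro monotone_bayes_model_axioms.intro)
      (fact assms)+
  show ?thesis
  proof (intro conjI allI impI)
    fix r :: real assume r: "0 \<le> r"
    show "sufficient_statistic (natural_filtration (space M) L r) P (measure_support \<mu>) (L r)"
      using r by (rule sufficient)
    show "bayes_sufficient_statistic M (natural_filtration (space M) L r) \<Theta> (L r)"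
      using r by (rule bayes_sufficient)
    show "AE \<omega> in M. real_cond_exp M (natural_filtration (space M) L r)
        (\<lambda>\<omega>. indicat_real (measure_support \<mu>) (\<Theta> \<omega>) * T (\<Theta> \<omega>)) \<omega> = posterior_mean \<nu> \<mu> T r (L r \<omega>)"
      using r T_set_integrable by (rule posterior_cond_mean)
    show "\<forall>A\<in>sets borel. A \<subseteq> measure_support \<mu> \<longrightarrow>
        (AE \<omega> in M. real_cond_exp M (natural_filtration (space M) L r)
            (\<lambda>\<omega>. indicat_real A (\<Theta> \<omega>)) \<omega> = measure (posterior \<nu> \<mu> r (L r \<omega>)) A)"
      using posterior_cond_prob[OF r] by blast
  next
    fix t s h :: real and J :: "real set"
    assume "0 \<le> t \<and> t < s \<and> 0 < h \<and>
      J \<noteq> {} \<and> open J \<and> is_interval J \<and> J \<subseteq> (\<Inter>r\<in>{t..s}. regular_means \<nu> \<mu> T r) \<and>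
      (\<forall>a b. a \<le> b \<and> {a..b} \<subseteq> J \<longrightarrow>
        compact (closure {(r, state_of_mean \<nu> \<mu> T r z) | r z. r \<in> {t..s} \<and> z \<in> {a..b}}) \<and>
        closure {(r, state_of_mean \<nu> \<mu> T r z) | r z. r \<in> {t..s} \<and> z \<in> {a..b}}
          \<subseteq> regular_domain \<nu> \<mu> T)"
    then have ts: "t < s" and "0 < h" and "is_interval J"
      and sub: "J \<subseteq> (\<Inter>r\<in>{t..s}. regular_means \<nu> \<mu> T r)"
      by blast+
    then have h: "0 \<le> h" and J: "convex J" by (simp_all add: is_interval_convex_1)
    have means: "z \<in> regular_means \<nu> \<mu> T r" if "r \<in> {t..s}" "z \<in> J" for r z
      using sub that by blast
    let ?y = "state_of_mean \<nu> \<mu> T" and ?K = "\<lambda>r z. transition_kernel P L \<nu> u0 \<mu> T r h z"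
    have adm: "admissible r (?y r z)" and mean: "posterior_mean \<nu> \<mu> T r (?y r z) = z"
      and K: "?K r z = estimates r (?y r z) h" if "r \<in> {t..s}" "z \<in> J" for r z
      using state_of_mean[OF means[OF that]] transition_kernel_eq[OF refl _ h] by auto
    have order: "(LINT w|?K s z. f w) \<le> (LINT w|?K t z. f w)"
      if z: "z \<in> J" and f: "convex_on UNIV f" "integrable (?K s z) f" "integrable (?K t z) f" for z f
    proof -
      have ts': "s \<in> {t..s}" "t \<in> {t..s}" using ts by auto
      show ?thesis
        using estimates_convex_le[OF h adm[OF ts'(1) z] adm[OF ts'(2) z] adm[OF ts'(2) z], of 1 0 f]
          f ts by (simp add: K[OF ts'(1) z] K[OF ts'(2) z] mean[OF ts'(1) z] mean[OF ts'(2) z])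
    qed
    show "\<forall>z\<in>J.
        convex_order_le (?K s z) (?K t z) \<and>
        (\<forall>f. convex_on UNIV f \<and> integrable (?K s z) f \<and> integrable (?K t z) f \<longrightarrow>
          transition_operator P L \<nu> u0 \<mu> T s h f z \<le> transition_operator P L \<nu> u0 \<mu> T t h f z)"
    proof (intro ballI conjI allI impI)
      fix z assume z: "z \<in> J"
      have ts': "s \<in> {t..s}" "t \<in> {t..s}" using ts by auto
      note basic = prob_estimates[OF adm[OF _ z] h] sets_estimates[OF adm[OF _ z] h]
        integrable_estimates[OF adm[OF _ z] h] mean_estimates[OF adm[OF _ z] h]
      show "convex_order_le (?K s z) (?K t z)"
        unfolding convex_order_le_def
        using order[OF z] basic[OF ts'(1)] basic[OF ts'(2)]
        by (simp add: K[OF ts'(1) z] K[OF ts'(2) z] mean[OF ts'(1) z] mean[OF ts'(2) z])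
    next
      fix z f assume "z \<in> J"
        "convex_on UNIV f \<and> integrable (?K s z) f \<and> integrable (?K t z) f"
      then show "transition_operator P L \<nu> u0 \<mu> T s h f z \<le> transition_operator P L \<nu> u0 \<mu> T t h f z"
        unfolding transition_operator_def by (intro order) auto
    qed
    show "\<forall>r\<in>{t..s}. \<forall>f. convex_on UNIV f \<and>
          (\<forall>z\<in>J. (\<integral>\<^sup>+w. ennreal \<bar>f w\<bar> \<partial>?K r z) < \<infinity>) \<longrightarrow>
        convex_on J (transition_operator P L \<nu> u0 \<mu> T r h f)"
    proof (intro ballI allI impI)
      fix r f assume r: "r \<in> {t..s}"
        and f: "convex_on UNIV f \<and> (\<forall>z\<in>J. (\<integral>\<^sup>+w. ennreal \<bar>f w\<bar> \<partial>?K r z) < \<infinity>)"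
      have int: "integrable (estimates r (?y r z) h) f" if z: "z \<in> J" for z
      proof (rule integrableI_bounded)
        show "f \<in> borel_measurable (estimates r (?y r z) h)"
          using convex_on_UNIV_borel_measurable f sets_estimates[OF adm[OF r z] h]
          by (simp cong: measurable_cong_sets)
        show "(\<integral>\<^sup>+w. ennreal (norm (f w)) \<partial>estimates r (?y r z) h) < \<infinity>"
        proof -
          have "(\<integral>\<^sup>+w. ennreal \<bar>f w\<bar> \<partial>?K r z) < \<infinity>" using f z by blast
          then show ?thesis unfolding K[OF r z] by simp
        qed
      qed
      show "convex_on J (transition_operator P L \<nu> u0 \<mu> T r h f)"
      proof (rule convex_onI[OF _ J])
        fix l x y :: real
        assume l: "0 < l" "l < 1" and xy: "x \<in> J" "y \<in> J"
        let ?z = "(1 - l) *\<^sub>R x + l *\<^sub>R y"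
        have z: "?z \<in> J" using J xy l by (intro convexD) auto
        show "transition_operator P L \<nu> u0 \<mu> T r h f ?z \<le>
            (1 - l) * transition_operator P L \<nu> u0 \<mu> T r h f x
            + l * transition_operator P L \<nu> u0 \<mu> T r h f y"
          unfolding transition_operator_def K[OF r z] K[OF r xy(1)] K[OF r xy(2)]
        proof (rule estimates_convex_le[OF h adm[OF r z] adm[OF r xy(1)] adm[OF r xy(2)]])
          show "posterior_mean \<nu> \<mu> T r (?y r ?z) =
              (1 - l) * posterior_mean \<nu> \<mu> T r (?y r x) + l * posterior_mean \<nu> \<mu> T r (?y r y)"
            unfolding mean[OF r z] mean[OF r xy(1)] mean[OF r xy(2)] by simp
        qed (use f l int[OF z] int[OF xy(1)] int[OF xy(2)] in auto)
      qed
    qed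
  qed
qed

end
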